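(* Let $p=p(n)\in(0,1)$ satisfy $p\gg n^{-2}$, let $G_{n,p}$ be the Erdős–Rényi random graph on $[n]$, let $\Delta_{n,p}$ be a unimodular triangulation of the random cosmological polytope $C_{n,p}=C_{G_{n,p}}$, and let $K_{n,p}=f_1(\Delta_{n,p})$ be its number of edges. Then, as $n\to\infty$, (1) $\mathbb{E}[K_{n,p}]\simeq n^4p^2$ and $\mathbb{V}(K_{n,p})\gtrsim n^6p^3(1-p)$; (2) $\displaystyle d_K\!\left(\frac{K_{n,p}-\mathbb{E}[K_{n,p}]}{\sqrt{\mathbb{V}(K_{n,p})}},N\right)\lesssim\frac{1}{n\sqrt{p(1-p)}}$, where $N\sim\mathcal N(0,1)$ is standard Gaussian.
   Context: For a finite simple graph $G=(V,E)$ (nodes $V$, arcs $E$), with standard basis $(\mathbf e_a)_{a\in V\cup E}$ of $\mathbb R^{V\cup E}$, the cosmological polytope is $C_G=\operatorname{conv}\{\mathbf e_i+\mathbf e_j-\mathbf e_f,\ \mathbf e_i-\mathbf e_j+\mathbf e_f,\ -\mathbf e_i+\mathbf e_j+\mathbf e_f : f=\{i,j\}\in E\}$, a lattice polytope. A unimodular triangulation of a lattice polytope is a triangulation into lattice simplices of minimal possible (normalized volume one) volume; $f_1$ denotes the number of edges (1-simplices). $G_{n,p}$ is the random graph on $[n]$ with each possible arc present independently with probability $p$. $a_n\lesssim b_n$ means $\limsup|a_n/b_n|<\infty$; $a_n\gtrsim b_n$ means $b_n\lesssim a_n$; $a_n\simeq b_n$ means $0<\liminf|a_n/b_n|\le\limsup|a_n/b_n|<\infty$;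 $a_n\gg b_n$ means $|a_n/b_n|\to\infty$. $d_K(Y,Z)=\sup_{z\in\mathbb R}|\mathbb P(Y\le z)-\mathbb P(Z\le z)|$. *)

theory Defs
  imports "HOL-Probability.Probability" "HOL-Analysis.Finite_Function_Topology"
begin

section \<open>Simplicial complexes and triangulations\<close>

text \<open>
  The library's predicates \<open>simplex\<close> and \<open>simplicial_complex\<close> are restricted to
  class \<open>euclidean_space\<close>, i.e. to a dimension fixed by the type. Here the dimension varies, so
  they are restated for \<open>real_vector\<close>. In that class affine independence no longer implies
  finiteness, which is therefore demanded explicitly. As in the library, the empty set is
  the simplex of dimension -1.
\<close>

definition simplex_of_dim :: "int \<Rightarrow> 'a::real_vector set \<Rightarrow> bool" where
  "simplex_of_dim k S \<longleftrightarrow>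
     (\<exists>C. finite C \<and> \<not> affine_dependent C \<and> int (card C) = k + 1 \<and> S = convex hull C)"

definition geometric_simplicial_complex :: "'a::real_vector set set \<Rightarrow> bool" where
  "geometric_simplicial_complex T \<longleftrightarrow>
     finite T \<and>
     (\<forall>S\<in>T. \<exists>k. simplex_of_dim k S) \<and>
     (\<forall>S\<in>T. \<forall>F. F face_of S \<longrightarrow> F \<in> T) \<and>
     (\<forall>S\<in>T. \<forall>S'\<in>T. (S \<inter> S') face_of S)"

definition triangulation_of :: "'a::real_vector set set \<Rightarrow> 'a set \<Rightarrow> bool" where
  "triangulation_of T P \<longleftrightarrow> geometric_simplicial_complex T \<and> \<Union>T = P"

definition face_number :: "nat \<Rightarrow> 'a::real_vector set set \<Rightarrow> nat" where
  "face_number k T = card {S\<in>T. simplex_of_dim (int k) S}"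


section \<open>Unimodular triangulations\<close>

text \<open>
  For finite \<open>A :: 'a set\<close>, the space of real vectors indexed by \<open>A\<close> is the coordinate subspace
  of \<open>'a \<Rightarrow>\<^sub>0 real\<close> consisting of the vectors supported in \<open>A\<close>.
\<close>

definition integer_points :: "('a \<Rightarrow>\<^sub>0 real) set" where
  "integer_points = {x. \<forall>a. Poly_Mapping.lookup x a \<in> \<int>}"

definition vertices :: "'a::real_vector set \<Rightarrow> 'a set" where
  "vertices S = {x. x extreme_point_of S}"

definition lattice_simplex :: "('a \<Rightarrow>\<^sub>0 real) set \<Rightarrow> bool" where
  "lattice_simplex S \<longleftrightarrow> (\<exists>k. simplex_of_dim k S) \<and> vertices S \<subseteq> integer_points"

definition edge_vectors :: "'a::real_vector set \<Rightarrow> 'a set" where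
  "edge_vectors S = {v - w |v w. v \<in> vertices S \<and> w \<in> vertices S}"

text \<open>The integer points of the linear space parallel to the affine hull of \<open>S\<close>.\<close>

definition direction_lattice :: "('a \<Rightarrow>\<^sub>0 real) set \<Rightarrow> ('a \<Rightarrow>\<^sub>0 real) set" where
  "direction_lattice S = integer_points \<inter> span (edge_vectors S)"

text \<open>The subgroup generated by the edge vectors.\<close>

definition edge_lattice :: "('a \<Rightarrow>\<^sub>0 real) set \<Rightarrow> ('a \<Rightarrow>\<^sub>0 real) set" where
  "edge_lattice S = module.span (\<lambda>(k::int) x. real_of_int k *\<^sub>R x) (edge_vectors S)"

text \<open>
  The normalized volume of a lattice simplex of dimension \<open>d\<close> is \<open>d!\<close> times its volume, relative
  to the lattice of integer points in its own affine hull. The parallelepiped spanned by its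
  edges at a vertex has \<open>d!\<close> times the volume of the simplex, so this is the covolume of the
  edge lattice measured in covolumes of the direction lattice, that is, the index of
  the former in the latter.
\<close>

definition normalized_volume :: "('a \<Rightarrow>\<^sub>0 real) set \<Rightarrow> nat" where
  "normalized_volume S =
     card (direction_lattice S //
             {(x, y) \<in> direction_lattice S \<times> direction_lattice S. x - y \<in> edge_lattice S})"

definition unimodular_triangulation ::
    "('a \<Rightarrow>\<^sub>0 real) set set \<Rightarrow> ('a \<Rightarrow>\<^sub>0 real) set \<Rightarrow> bool" where
  "unimodular_triangulation T P \<longleftrightarrow>
     triangulation_of T P \<and> (\<forall>S\<in>T. lattice_simplex S \<and> normalized_volume S = 1)"


section \<open>Cosmological polytopes\<close>

type_synonym 'v graph = "'v set \<times> 'v set set"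

abbreviation nodes :: "'v graph \<Rightarrow> 'v set" where "nodes \<equiv> fst"
abbreviation arcs :: "'v graph \<Rightarrow> 'v set set" where "arcs \<equiv> snd"

definition finite_simple_graph :: "'v graph \<Rightarrow> bool" where
  "finite_simple_graph G \<longleftrightarrow>
     finite (nodes G) \<and> (\<forall>f\<in>arcs G. f \<subseteq> nodes G \<and> card f = 2)"

definition node_vec :: "'v \<Rightarrow> ('v + 'v set) \<Rightarrow>\<^sub>0 real" where
  "node_vec i = Poly_Mapping.single (Inl i) 1"

definition arc_vec :: "'v set \<Rightarrow> ('v + 'v set) \<Rightarrow>\<^sub>0 real" where
  "arc_vec f = Poly_Mapping.single (Inr f) 1"

definition cosmological_polytope :: "'v graph \<Rightarrow> (('v + 'v set) \<Rightarrow>\<^sub>0 real) set" where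
  "cosmological_polytope G =
     convex hull (\<Union>{{node_vec i + node_vec j - arc_vec f,
                      node_vec i - node_vec j + arc_vec f,
                      - node_vec i + node_vec j + arc_vec f} |i j f. f \<in> arcs G \<and> f = {i, j}})"


section \<open>The random graph\<close>

definition possible_arcs :: "nat \<Rightarrow> nat set set" where
  "possible_arcs n = {f. f \<subseteq> {1..n} \<and> card f = 2}"

definition erdos_renyi_graph ::
    "'w measure \<Rightarrow> nat \<Rightarrow> real \<Rightarrow> ('w \<Rightarrow> nat graph) \<Rightarrow> bool" where
  "erdos_renyi_graph M n p G \<longleftrightarrow>
     prob_space M \<and>
     (\<forall>\<omega>\<in>space M. finite_simple_graph (G \<omega>) \<and> nodes (G \<omega>) = {1..n}) \<and>
     prob_space.indep_events M (\<lambda>f. {\<omega>\<in>space M. f \<in> arcs (G \<omega>)}) (possible_arcs n) \<and>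
     (\<forall>f\<in>possible_arcs n. measure M {\<omega>\<in>space M. f \<in> arcs (G \<omega>)} = p)"

definition kolmogorov_distance ::
    "'a measure \<Rightarrow> ('a \<Rightarrow> real) \<Rightarrow> 'b measure \<Rightarrow> ('b \<Rightarrow> real) \<Rightarrow> real" where
  "kolmogorov_distance M Y M' Z =
     (SUP z. \<bar>measure M {\<omega>\<in>space M. Y \<omega> \<le> z} - measure M' {\<omega>\<in>space M'. Z \<omega> \<le> z}\<bar>)"


section \<open>Asymptotic comparison of sequences\<close>

text \<open>
  The quotient is taken in the extended reals, where \<open>x / 0 = \<infinity>\<close> for \<open>x > 0\<close>: with real
  division, an infinitely often vanishing \<open>b\<close> would make \<open>lesssim a b\<close> easier to satisfy.
\<close>

definition asymp_ratio :: "(nat \<Rightarrow> real) \<Rightarrow> (nat \<Rightarrow> real) \<Rightarrow> nat \<Rightarrow> ereal" where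
  "asymp_ratio a b n = ereal \<bar>a n\<bar> / ereal \<bar>b n\<bar>"

definition lesssim :: "(nat \<Rightarrow> real) \<Rightarrow> (nat \<Rightarrow> real) \<Rightarrow> bool" where
  "lesssim a b \<longleftrightarrow> limsup (asymp_ratio a b) < \<infinity>"

definition gtrsim :: "(nat \<Rightarrow> real) \<Rightarrow> (nat \<Rightarrow> real) \<Rightarrow> bool" where
  "gtrsim a b \<longleftrightarrow> lesssim b a"

definition same_order :: "(nat \<Rightarrow> real) \<Rightarrow> (nat \<Rightarrow> real) \<Rightarrow> bool" where
  "same_order a b \<longleftrightarrow>
     0 < liminf (asymp_ratio a b) \<and>
     liminf (asymp_ratio a b) \<le> limsup (asymp_ratio a b) \<and>
     limsup (asymp_ratio a b) < \<infinity>"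

definition much_greater :: "(nat \<Rightarrow> real) \<Rightarrow> (nat \<Rightarrow> real) \<Rightarrow> bool" where
  "much_greater a b \<longleftrightarrow> asymp_ratio a b \<longlonglongrightarrow> \<infinity>"

end

theory Submission
  imports Defs
begin

text \<open>
  In a unimodular triangulation of \<open>P\<close>, every lattice point of \<open>2P\<close> is twice a vertex or, in a
  unique way, the sum of the end points of an edge. Hence \<open>f\<^sub>1\<close> is the number of sums \<open>a + b\<close> of lattice
  points of \<open>P\<close> that are not of the form \<open>2c\<close>. A cosmological polytope has \<open>S = V + 4E\<close> lattice points
  (\<open>V\<close> non-isolated nodes, \<open>E\<close> arcs), and the only coincidences among their pairwise sums are the six
  relations inside the triangle of each arc, so \<open>f\<^sub>1 = S(S - 1)/2 - 6E\<close>.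

  An arc raises \<open>S\<close> by \<open>4\<close>, \<open>5\<close> or \<open>6\<close>, and it raises \<open>f\<^sub>1\<close> by at least \<open>16\<close> times the number of other
  arcs. The latter bounds the covariance of \<open>f\<^sub>1\<close> and \<open>E\<close>, hence the variance of \<open>f\<^sub>1\<close>, from below.
  Writing \<open>S\<close> minus its mean as a sum of \<open>(X\<^sub>e - p) g\<^sub>e\<close>, where \<open>X\<^sub>e\<close> indicates the arc \<open>e\<close> and \<open>g\<^sub>e\<close> does not
  depend on it, gives a Stein identity for \<open>S\<close> with a kernel whose fluctuations the Efron-Stein
  inequality controls. Because the increments of \<open>S\<close> are bounded from above and below, testing the
  identity against a truncated identity function shows that \<open>S\<close> does not concentrate on short intervals,
  and Stein's method then yields the Berry-Esseen rate \<open>1 / sd(E)\<close> for \<open>S\<close>. Passing from \<open>S\<close> to \<open>f\<^sub>1\<close> costs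
  an error of the same order.
\<close>

section \<open>Unimodular triangulations count lattice points\<close>

text \<open>The detour through \<open>S\<close> is forced by the increments: an arc changes
  \<open>f_1\<close> by an amount that grows with the graph, but \<open>S\<close> by at most 6, and
  only a bounded increment suits Stein's method with a half-line test function. The kernel pairs the
  increment \<open>d\<close> of \<open>S\<close> with its conditional mean \<open>g\<close> given
  the earlier arcs (a discrete Clark-Ocone formula), so both factors lie in [4, 6]. Toggling one arc
  may disturb the kernel at all arcs that share a node with it. The factor \<open>p\<close> of the
  kernel compensates: j other possible arcs at a node are all absent only with probability
  \<open>(1 - p)^j\<close>, and \<open>(j p)\<^sup>2 (1 - p)^j\<close> is bounded, uniformly in
  \<open>p\<close>. After normalisation \<open>f_1\<close> becomes
  \<open>Y + \<epsilon> (Y\<^sup>2 - 1) - \<eta>\<close> with \<open>\<epsilon>\<close> at most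
  \<open>\<rho> = 1 / sd(E)\<close>. At level t the quadratic term shifts the threshold by an amount
  of order \<open>\<rho> (1 + t\<^sup>2)\<close>, which is harmless because the normal density is at
  most \<open>1 / (1 + t\<^sup>2)\<close>. Levels with \<open>\<rho> t\<^sup>2 \<ge> 1\<close> are
  left to Chebyshev.\<close>

lemma affine_independent_coeffs_eq:
  fixes C :: "'a::real_vector set"
  assumes "finite C" "\<not> affine_dependent C"
    and "(\<Sum>c\<in>C. a c *\<^sub>R c) = (\<Sum>c\<in>C. b c *\<^sub>R c)" "sum a C = sum b C" "c \<in> C"
  shows "a c = b c"
proof (rule ccontr)
  assume "a c \<noteq> b c"
  then have "\<exists>U. sum U C = 0 \<and> (\<exists>v\<in>C. U v \<noteq> 0) \<and> (\<Sum>v\<in>C. U v *\<^sub>R v) = 0"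
    using assms by (intro exI[of _ "\<lambda>v. a v - b v"]) (auto simp: sum_subtractf scaleR_left_diff_distrib)
  then show False
    using assms(1,2) by (simp add: affine_dependent_explicit_finite)
qed

text \<open>Extending both coefficient families by zero gives two affine representations of a common
  point over \<open>C\<close>. They must agree, so the one over \<open>T\<close> vanishes,
  contradicting its total weight 1. This is the condition under which \<open>convex hull T\<close>
  is a face.\<close>

lemma affine_hull_disjoint_convex_hull:
  fixes C :: "'a::real_vector set"
  assumes "finite C" "\<not> affine_dependent C" "T \<subseteq> C"
  shows "affine hull T \<inter> convex hull (C - T) = {}"
proof (rule ccontr)
  assume "\<not> ?thesis"
  then obtain x where x: "x \<in> affine hull T" "x \<in> convex hull (C - T)" by blast
  have fT: "finite T" using assms finite_subset by blast
  obtain a where a: "sum a T = 1" "(\<Sum>c\<in>T. a c *\<^sub>R c) = x"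
    using x(1) fT by (auto simp: affine_hull_finite)
  obtain b where b: "sum b (C - T) = 1" "(\<Sum>c\<in>C - T. b c *\<^sub>R c) = x"
    using x(2) assms(1) by (auto simp: convex_hull_finite)
  define a' where "a' c = (if c \<in> T then a c else 0)" for c
  define b' where "b' c = (if c \<in> T then 0 else b c)" for c
  have a': "sum a' C = 1" "(\<Sum>c\<in>C. a' c *\<^sub>R c) = x"
    using a assms(1,3) sum.subset_diff[of T C a'] sum.subset_diff[of T C "\<lambda>c. a' c *\<^sub>R c"]
    by (simp_all add: a'_def)
  have b': "sum b' C = 1" "(\<Sum>c\<in>C. b' c *\<^sub>R c) = x"
    using b assms(1,3) sum.subset_diff[of T C b'] sum.subset_diff[of T C "\<lambda>c. b' c *\<^sub>R c"]
    by (simp_all add: b'_def)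
  have ab: "a' c = b' c" if "c \<in> C" for c
    using affine_independent_coeffs_eq[OF assms(1,2) _ _ that, of a' b'] a' b' by simp
  have "a c = 0" if "c \<in> T" for c
    using ab[of c] that assms(3) by (auto simp: a'_def b'_def)
  then have "sum a T = 0" by simp
  then show False using a by simp
qed

lemma face_of_convex_hull_affine_independent_subset:
  fixes C :: "'a::real_vector set"
  assumes "finite C" "\<not> affine_dependent C" "T \<subseteq> C"
  shows "convex hull T face_of convex hull C"
  using face_of_convex_hulls[OF assms(1,3) affine_hull_disjoint_convex_hull[OF assms]] .

lemma vertices_convex_hull:
  fixes C :: "'a::real_vector set"
  assumes "finite C" "\<not> affine_dependent C"
  shows "vertices (convex hull C) = C"
proof -
  have "c extreme_point_of convex hull C" if "c \<in> C" for c
    using face_of_convex_hull_affine_independent_subset[OF assms, of "{c}"] that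
    by (simp add: face_of_singleton)
  then show ?thesis
    using extreme_point_of_convex_hull by (auto simp: vertices_def)
qed

lemma module_int_scaleR: "module (\<lambda>(k::int) (x::'a::real_vector). real_of_int k *\<^sub>R x)"
  by unfold_locales (simp_all add: algebra_simps)

text \<open>The integer combinations of weight zero form a subgroup that contains all differences of
  vertices. Together with the uniqueness of affine coefficients, membership in the edge lattice
  becomes integrality of coefficients.\<close>

lemma edge_lattice_convex_hull:
  fixes C :: "('a \<Rightarrow>\<^sub>0 real) set"
  assumes C: "finite C" "\<not> affine_dependent C" and x: "x \<in> edge_lattice (convex hull C)"
  obtains k where "(\<Sum>c\<in>C. real_of_int (k c) *\<^sub>R c) = x" "sum k C = (0::int)"
proof -
  interpret Z: module "\<lambda>(k::int) (x::'a \<Rightarrow>\<^sub>0 real). real_of_int k *\<^sub>R x"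
    by (rule module_int_scaleR)
  define H where "H = {x. \<exists>k. (\<Sum>c\<in>C. real_of_int (k c) *\<^sub>R c) = x \<and> sum k C = (0::int)}"
  have "Z.subspace H"
  proof (rule Z.subspaceI)
    show "0 \<in> H" unfolding H_def by (auto intro!: exI[of _ "\<lambda>_. 0"])
  next
    fix x y assume "x \<in> H" "y \<in> H"
    then obtain k l where "(\<Sum>c\<in>C. real_of_int (k c) *\<^sub>R c) = x" "sum k C = (0::int)"
      "(\<Sum>c\<in>C. real_of_int (l c) *\<^sub>R c) = y" "sum l C = (0::int)"
      unfolding H_def by blast
    then show "x + y \<in> H" unfolding H_def
      by (auto intro!: exI[of _ "\<lambda>c. k c + l c"] simp: sum.distrib scaleR_left_distrib)
  next
    fix m :: int and x assume "x \<in> H"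
    then obtain k where "(\<Sum>c\<in>C. real_of_int (k c) *\<^sub>R c) = x" "sum k C = (0::int)"
      unfolding H_def by blast
    then show "real_of_int m *\<^sub>R x \<in> H" unfolding H_def
      by (auto intro!: exI[of _ "\<lambda>c. m * k c"] simp: scaleR_right.sum sum_distrib_left[symmetric])
  qed
  moreover have "edge_vectors (convex hull C) \<subseteq> H"
  proof
    fix e assume "e \<in> edge_vectors (convex hull C)"
    then obtain v w where vw: "e = v - w" "v \<in> C" "w \<in> C"
      unfolding edge_vectors_def vertices_convex_hull[OF C] by blast
    let ?k = "\<lambda>c. (if c = v then 1 else 0) - (if c = w then 1 else (0::int))"
    have "(\<Sum>c\<in>C. real_of_int (?k c) *\<^sub>R c) = e"
      using vw C(1) by (simp add: scaleR_left_diff_distrib sum_subtractf if_distrib[of "\<lambda>k. real_of_int k *\<^sub>R _"] if_distrib[of "real_of_int"] if_distrib[of "\<lambda>k. k *\<^sub>R _"] sum.delta cong: if_cong)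
    moreover have "sum ?k C = 0" using vw C(1) by (simp add: sum_subtractf sum.delta)
    ultimately show "e \<in> H" unfolding H_def by (intro CollectI exI[of _ ?k] conjI)
  qed
  ultimately have "edge_lattice (convex hull C) \<subseteq> H"
    unfolding edge_lattice_def by (intro Z.span_minimal)
  with x that show thesis unfolding H_def by blast
qed

text \<open>Index 1 means a single coset, so every element is congruent to 0.\<close>

lemma direction_lattice_subset_edge_lattice:
  assumes "normalized_volume S = 1"
  shows "direction_lattice S \<subseteq> edge_lattice S"
proof
  interpret Z: module "\<lambda>(k::int) (x::'a \<Rightarrow>\<^sub>0 real). real_of_int k *\<^sub>R x"
    by (rule module_int_scaleR)
  let ?D = "direction_lattice S"
  let ?R = "{(x, y) \<in> ?D \<times> ?D. x - y \<in> edge_lattice S}"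
  fix x assume x: "x \<in> ?D"
  have 0: "0 \<in> ?D"
    unfolding direction_lattice_def integer_points_def by (simp add: span_zero)
  obtain Q where Q: "?D // ?R = {Q}"
    using assms[unfolded normalized_volume_def] by (rule card_1_singletonE)
  have "?R `` {x} \<in> {Q}" "?R `` {0} \<in> {Q}"
    unfolding Q[symmetric] using x 0 by (simp_all only: quotientI)
  moreover have "0 \<in> ?R `` {0}" using 0 by (simp add: edge_lattice_def Z.span_zero)
  ultimately have "0 \<in> ?R `` {x}" by simp
  then show "x \<in> edge_lattice S" by simp
qed

lemma integer_points_diff: "x \<in> integer_points \<Longrightarrow> y \<in> integer_points \<Longrightarrow> x - y \<in> integer_points"
  and integer_points_add: "x \<in> integer_points \<Longrightarrow> y \<in> integer_points \<Longrightarrow> x + y \<in> integer_points"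
  by (simp_all add: integer_points_def lookup_minus lookup_add)

text \<open>Subtracting the total weight at the vertex \<open>c\<close> leaves a combination of the
  differences \<open>b - c\<close>: an integer point of the direction space, hence by unimodularity
  an element of the edge lattice. Its integral coefficients are the only ones.\<close>

lemma unimodular_simplex_coeffs_Ints:
  fixes C :: "('a \<Rightarrow>\<^sub>0 real) set"
  assumes C: "finite C" "\<not> affine_dependent C" "C \<subseteq> integer_points"
    and vol: "normalized_volume (convex hull C) = 1"
    and x: "(\<Sum>c\<in>C. a c *\<^sub>R c) \<in> integer_points" and sum: "sum a C \<in> \<int>" and c: "c \<in> C"
  shows "a c \<in> \<int>"
proof -
  obtain s :: int where s: "sum a C = s" using sum by (auto elim: Ints_cases)
  let ?d = "\<lambda>b. a b - (if b = c then of_int s else 0)"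
  have sd: "(\<Sum>b\<in>C. ?d b *\<^sub>R b) = (\<Sum>b\<in>C. a b *\<^sub>R b) - of_int s *\<^sub>R c"
    using C c by (simp add: scaleR_left_diff_distrib sum_subtractf if_distrib[of "\<lambda>k. k *\<^sub>R _"] sum.delta cong: if_cong)
  have "of_int s *\<^sub>R c \<in> integer_points"
    using C c by (auto simp: integer_points_def scaleR_poly_mapping_def)
  then have "(\<Sum>b\<in>C. ?d b *\<^sub>R b) \<in> integer_points"
    unfolding sd using x by (rule integer_points_diff[rotated])
  moreover have "(\<Sum>b\<in>C. ?d b *\<^sub>R b) = (\<Sum>b\<in>C. ?d b *\<^sub>R (b - c))"
  proof -
    have "(\<Sum>b\<in>C. ?d b *\<^sub>R (b - c)) = (\<Sum>b\<in>C. ?d b *\<^sub>R b) - (sum ?d C) *\<^sub>R c"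
      by (simp add: scaleR_right_diff_distrib sum_subtractf flip: scaleR_left.sum)
    moreover have "sum ?d C = 0" using s C c by (simp add: sum_subtractf sum.delta)
    ultimately show ?thesis by simp
  qed
  moreover have "(\<Sum>b\<in>C. ?d b *\<^sub>R (b - c)) \<in> span (edge_vectors (convex hull C))"
    using c by (intro real_vector.span_sum real_vector.span_scale real_vector.span_base)
      (auto simp: edge_vectors_def vertices_convex_hull[OF C(1,2)])
  ultimately have "(\<Sum>b\<in>C. ?d b *\<^sub>R b) \<in> edge_lattice (convex hull C)"
    using direction_lattice_subset_edge_lattice[OF vol] by (auto simp: direction_lattice_def)
  then obtain k where k: "(\<Sum>b\<in>C. real_of_int (k b) *\<^sub>R b) = (\<Sum>b\<in>C. ?d b *\<^sub>R b)" "sum k C = (0::int)"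
    by (rule edge_lattice_convex_hull[OF C(1,2)])
  have "real_of_int (k c) = ?d c"
  proof (rule affine_independent_coeffs_eq[OF C(1,2) k(1) _ c])
    have "sum (\<lambda>b. real_of_int (k b)) C = 0" using k(2) by (metis of_int_0 of_int_sum)
    then show "(\<Sum>b\<in>C. real_of_int (k b)) = sum ?d C"
      using s C c by (simp add: sum_subtractf sum.delta)
  qed
  then have "a c = of_int (k c + s)" by simp
  then show ?thesis by (metis Ints_of_int)
qed

lemma scaled_sum_eq_one_element:
  fixes m :: "'a::real_vector \<Rightarrow> nat"
  assumes "finite C" "sum m C = 1"
  obtains c where "c \<in> C" "(\<Sum>b\<in>C. real (m b) *\<^sub>R b) = c"
proof -
  obtain c where c: "c \<in> C" "m c = 1" "\<And>b. b \<in> C \<Longrightarrow> c \<noteq> b \<Longrightarrow> m b = 0"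
    using assms(2) unfolding sum_eq_1_iff[OF assms(1)] by blast
  have "(\<Sum>b\<in>C. real (m b) *\<^sub>R b) = (\<Sum>b\<in>C. if b = c then c else 0)"
    using c by (intro sum.cong) auto
  also have "\<dots> = c" using c assms(1) by simp
  finally show thesis using that c(1) by blast
qed

lemma scaled_sum_eq_two_elements:
  fixes m :: "'a::real_vector \<Rightarrow> nat"
  assumes "finite C" "sum m C = 2"
  obtains c d where "c \<in> C" "d \<in> C" "(\<Sum>b\<in>C. real (m b) *\<^sub>R b) = c + d"
proof -
  obtain c where c: "c \<in> C" "m c \<noteq> 0"
    using assms by (metis sum.neutral zero_neq_numeral)
  define m' where "m' b = m b - (if b = c then 1 else 0)" for b
  have m: "m b = m' b + (if b = c then 1 else 0)" for b using c by (auto simp: m'_def)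
  have "sum m C = sum m' C + 1" unfolding m using c assms(1) by (simp add: sum.distrib)
  then have "sum m' C = 1" using assms(2) by simp
  then obtain d where d: "d \<in> C" "(\<Sum>b\<in>C. real (m' b) *\<^sub>R b) = d"
    by (rule scaled_sum_eq_one_element[OF assms(1)])
  have "(\<Sum>b\<in>C. real (m b) *\<^sub>R b) = (\<Sum>b\<in>C. real (m' b) *\<^sub>R b + (if b = c then b else 0))"
    by (intro sum.cong) (auto simp: m scaleR_left_distrib)
  also have "\<dots> = d + c" using c d assms(1) by (simp add: sum.distrib)
  finally show thesis using that[of c d] c d by (simp add: add.commute)
qed

text \<open>Barycentric coordinates are nonnegative, and after scaling by \<open>k\<close> they are
  integral. The case \<open>k = 1\<close> identifies lattice points with vertices;
  \<open>k = 2\<close> writes lattice points of the doubled simplex as sums of two vertices.\<close>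

lemma unimodular_simplex_lattice_coeffs:
  fixes C :: "('a \<Rightarrow>\<^sub>0 real) set"
  assumes C: "finite C" "\<not> affine_dependent C" "C \<subseteq> integer_points"
    and vol: "normalized_volume (convex hull C) = 1"
    and x: "x \<in> convex hull C" "real k *\<^sub>R x \<in> integer_points"
  obtains m :: "('a \<Rightarrow>\<^sub>0 real) \<Rightarrow> nat"
    where "sum m C = k" "(\<Sum>b\<in>C. real (m b) *\<^sub>R b) = real k *\<^sub>R x"
proof -
  obtain u where u: "\<forall>b\<in>C. 0 \<le> u b" "sum u C = 1" "(\<Sum>b\<in>C. u b *\<^sub>R b) = x"
    using x(1) C(1) by (auto simp: convex_hull_finite)
  have kx: "(\<Sum>b\<in>C. (real k * u b) *\<^sub>R b) = real k *\<^sub>R x"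
    unfolding u(3)[symmetric] by (simp add: scaleR_right.sum)
  have int: "real k * u b \<in> \<int>" if "b \<in> C" for b
  proof (rule unimodular_simplex_coeffs_Ints[OF C vol _ _ that, where a = "\<lambda>b. real k * u b"])
    show "(\<Sum>c\<in>C. (real k * u c) *\<^sub>R c) \<in> integer_points" using kx x(2) by simp
    show "(\<Sum>b\<in>C. real k * u b) \<in> \<int>" using u(2) by (simp flip: sum_distrib_left)
  qed
  have "\<forall>b\<in>C. \<exists>n. real k * u b = real n"
  proof
    fix b assume b: "b \<in> C"
    obtain z :: int where z: "real k * u b = of_int z" using int[OF b] by (rule Ints_cases)
    have "0 \<le> real k * u b" using b u(1) by simp
    then have "real k * u b = real (nat z)" using z by simp
    then show "\<exists>n. real k * u b = real n" ..
  qed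
  then obtain m where m: "\<And>b. b \<in> C \<Longrightarrow> real k * u b = real (m b)"
    unfolding bchoice_iff by blast
  have "real (sum m C) = (\<Sum>b\<in>C. real k * u b)" using m by simp
  also have "\<dots> = real k" using u(2) by (simp flip: sum_distrib_left)
  finally have "sum m C = k" by (simp only: of_nat_eq_iff)
  moreover have "(\<Sum>b\<in>C. real (m b) *\<^sub>R b) = real k *\<^sub>R x"
    unfolding kx[symmetric] by (intro sum.cong) (simp_all add: m)
  ultimately show thesis by (rule that)
qed

text \<open>A face contains both ends of every open segment of \<open>S\<close> that it
  meets.\<close>

lemma midpoint_mem_face:
  assumes "F face_of S" "a \<in> S" "b \<in> S" "(1/2) *\<^sub>R (a + b) \<in> F"
  shows "a \<in> F" "b \<in> F"
proof -
  have "a \<in> F \<and> b \<in> F"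
  proof (cases "a = b")
    case True
    then have "(1/2) *\<^sub>R (a + b) = a" by (simp flip: scaleR_2)
    then show ?thesis using True assms(4) by simp
  next
    case False
    then have "(1/2) *\<^sub>R (a + b) \<in> open_segment a b"
      by (auto simp: in_segment intro!: exI[of _ "1/2"] simp: scaleR_right_distrib)
    with face_ofD[OF assms(1)] assms(2-4) show ?thesis by blast
  qed
  then show "a \<in> F" "b \<in> F" by auto
qed

section \<open>Edges of a unimodular triangulation as sums of two lattice points\<close>

locale unimodular =
  fixes T :: "('a \<Rightarrow>\<^sub>0 real) set set" and P
  assumes T: "unimodular_triangulation T P" and convex_P: "convex P"
begin

lemma simplexE:
  assumes "S \<in> T"
  obtains C where "finite C" "\<not> affine_dependent C" "C \<subseteq> integer_points"
    "S = convex hull C" "normalized_volume (convex hull C) = 1"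
proof -
  obtain k C where C: "finite C" "\<not> affine_dependent C" "S = convex hull C"
    using T assms unfolding unimodular_triangulation_def lattice_simplex_def simplex_of_dim_def
    by metis
  then show thesis
    using T assms vertices_convex_hull[OF C(1,2)]
    by (intro that[of C]) (auto simp: unimodular_triangulation_def lattice_simplex_def)
qed

lemma face_mem: "S \<in> T \<Longrightarrow> F face_of S \<Longrightarrow> F \<in> T"
  and Int_face: "S \<in> T \<Longrightarrow> S' \<in> T \<Longrightarrow> S \<inter> S' face_of S"
  and Union_eq: "\<Union>T = P"
  using T unfolding unimodular_triangulation_def triangulation_of_def
    geometric_simplicial_complex_def by simp_all

text \<open>By unimodularity \<open>x\<close> is a vertex of any simplex that contains it, and
  vertices are faces.\<close>

lemma singleton_mem:
  assumes "x \<in> P" "x \<in> integer_points"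
  shows "{x} \<in> T"
proof -
  obtain S where S: "S \<in> T" "x \<in> S" using assms(1) Union_eq by blast
  obtain C where C: "finite C" "\<not> affine_dependent C" "C \<subseteq> integer_points"
    "S = convex hull C" "normalized_volume (convex hull C) = 1" using S(1) by (rule simplexE)
  have xi: "real 1 *\<^sub>R x \<in> integer_points" using assms(2) by simp
  have xC: "x \<in> convex hull C" using S(2) C(4) by simp
  obtain m where m: "sum m C = 1" "(\<Sum>b\<in>C. real (m b) *\<^sub>R b) = real 1 *\<^sub>R x"
    by (rule unimodular_simplex_lattice_coeffs[OF C(1-3) C(5) xC xi])
  obtain c where "c \<in> C" "(\<Sum>b\<in>C. real (m b) *\<^sub>R b) = c"
    by (rule scaled_sum_eq_one_element[OF C(1) m(1)])
  then have "x \<in> C" using m(2) by simp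
  then have "{x} face_of S"
    using face_of_convex_hull_affine_independent_subset[OF C(1,2), of "{x}"] C(4) by simp
  then show ?thesis using face_mem S(1) by blast
qed

lemma one_simplexE:
  assumes "S \<in> T" "simplex_of_dim 1 S"
  obtains a b where "a \<noteq> b" "S = convex hull {a, b}" "vertices S = {a, b}"
    "a \<in> P \<inter> integer_points" "b \<in> P \<inter> integer_points" "a \<in> S" "b \<in> S"
proof -
  obtain C where C: "finite C" "\<not> affine_dependent C" "int (card C) = 1 + 1" "S = convex hull C"
    using assms(2) unfolding simplex_of_dim_def by blast
  then have "card C = 2" by simp
  then obtain a b where ab: "C = {a, b}" "a \<noteq> b" unfolding card_2_iff by blast
  have v: "vertices S = {a, b}" unfolding C(4) ab(1)[symmetric] by (rule vertices_convex_hull[OF C(1,2)])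
  have "vertices S \<subseteq> integer_points"
    using T assms(1) by (simp add: unimodular_triangulation_def lattice_simplex_def)
  moreover have "C \<subseteq> S" using hull_subset[of C convex] C(4) by simp
  moreover have "S \<subseteq> P" using assms(1) Union_eq by blast
  ultimately have "a \<in> P \<inter> integer_points" "b \<in> P \<inter> integer_points" "a \<in> S" "b \<in> S"
    unfolding v ab(1) by blast+
  with ab(2) C(4)[unfolded ab(1)] v show thesis by (rule that)
qed

text \<open>The edge is recovered from the sum of its end points: a simplex through the midpoint
  contains the whole edge, because it meets the edge in a face of the edge. Doubles
  \<open>a + a\<close> are removed since their half is a vertex of the triangulation.\<close>

lemma face_number_1:
  defines "A \<equiv> P \<inter> integer_points"
  shows "face_number 1 T = card ({a + b |a b. a \<in> A \<and> b \<in> A} - {a + a |a. a \<in> A})"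
proof -
  let ?E = "{S \<in> T. simplex_of_dim 1 S}"
  have mid: "\<exists>a b. a \<in> S \<and> b \<in> S \<and> a \<noteq> b \<and> S = convex hull {a, b} \<and> a \<in> A \<and> b \<in> A \<and> \<Sum>(vertices S) = a + b"
    if S: "S \<in> T" "simplex_of_dim 1 S" for S
  proof -
    obtain a b where ab: "a \<noteq> b" "S = convex hull {a, b}" "vertices S = {a, b}"
      "a \<in> P \<inter> integer_points" "b \<in> P \<inter> integer_points" "a \<in> S" "b \<in> S"
      by (rule one_simplexE[OF S])
    then have "\<Sum>(vertices S) = a + b" by simp
    with ab show ?thesis unfolding A_def by blast
  qed
  have sub: "S \<subseteq> S'"
    if "S \<in> T" "S' \<in> T" "a \<in> S" "b \<in> S" "S = convex hull {a, b}" "(1/2) *\<^sub>R (a + b) \<in> S'" for S S' a b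
  proof -
    have "(1/2) *\<^sub>R (a + b) \<in> S"
      using convexD[of S a b "1/2" "1/2"] that by (simp add: scaleR_right_distrib)
    then have "a \<in> S \<inter> S'" "b \<in> S \<inter> S'"
      using midpoint_mem_face[OF Int_face[OF that(1,2)] that(3,4)] that(6) by auto
    moreover have "convex S'" by (rule simplexE[OF that(2)]) (simp add: convex_convex_hull)
    ultimately show ?thesis unfolding that(5) by (intro hull_minimal) auto
  qed
  have "bij_betw (\<lambda>S. \<Sum>(vertices S)) ?E ({a + b |a b. a \<in> A \<and> b \<in> A} - {a + a |a. a \<in> A})"
    unfolding bij_betw_def
  proof
    show "inj_on (\<lambda>S. \<Sum>(vertices S)) ?E"
    proof (rule inj_onI, clarify)
      fix S S' assume S: "S \<in> T" "simplex_of_dim 1 S" and S': "S' \<in> T" "simplex_of_dim 1 S'"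
        and eq: "\<Sum>(vertices S) = \<Sum>(vertices S')"
      obtain a b where ab: "a \<in> S" "b \<in> S" "S = convex hull {a, b}" "\<Sum>(vertices S) = a + b"
        using mid[OF S] by blast
      obtain c d where cd: "c \<in> S'" "d \<in> S'" "S' = convex hull {c, d}" "\<Sum>(vertices S') = c + d"
        using mid[OF S'] by blast
      have e: "a + b = c + d" using ab cd eq by simp
      have "(1/2) *\<^sub>R (a + b) \<in> S"
        using convexD[of S a b "1/2" "1/2"] ab by (simp add: scaleR_right_distrib)
      moreover have "(1/2) *\<^sub>R (c + d) \<in> S'"
        using convexD[of S' c d "1/2" "1/2"] cd by (simp add: scaleR_right_distrib)
      ultimately show "S = S'"
        using sub[OF S(1) S'(1) ab(1-3)] sub[OF S'(1) S(1) cd(1-3)] e by auto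
    qed
    show "(\<lambda>S. \<Sum>(vertices S)) ` ?E = {a + b |a b. a \<in> A \<and> b \<in> A} - {a + a |a. a \<in> A}"
    proof (intro equalityI subsetI)
      fix y assume "y \<in> (\<lambda>S. \<Sum>(vertices S)) ` ?E"
      then obtain S where ST: "S \<in> T" "simplex_of_dim 1 S" "y = \<Sum>(vertices S)" by blast
      obtain a b where ab: "a \<in> S" "b \<in> S" "a \<noteq> b"
        "S = convex hull {a, b}" "a \<in> A" "b \<in> A" "\<Sum>(vertices S) = a + b"
        using mid[OF ST(1,2)] by blast
      note S = ST(1) ST(3)[unfolded ab(7)] ab(1-6)
      have "a + b \<noteq> c + c" if "c \<in> A" for c
      proof
        assume "a + b = c + c"
        then have c: "(1/2) *\<^sub>R (a + b) \<in> {c}" by (simp flip: scaleR_2)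
        have "{c} \<in> T" using singleton_mem that by (auto simp: A_def)
        \<comment> \<open>The midpoint \<open>c\<close> would be a simplex of \<open>T\<close>
          itself, so the edge would collapse to it.\<close>
        then have "S \<subseteq> {c}" by (rule sub[OF S(1) _ S(3,4,6) c])
        then show False using S(3-5) by blast
      qed
      then show "y \<in> {a + b |a b. a \<in> A \<and> b \<in> A} - {a + a |a. a \<in> A}"
      proof (intro DiffI)
        show "y \<in> {a + b |a b. a \<in> A \<and> b \<in> A}"
          using S(7,8) unfolding S(2) by (intro CollectI exI[of _ a] exI[of _ b]) simp
      qed (auto simp: S(2))
    next
      fix y assume "y \<in> {a + b |a b. a \<in> A \<and> b \<in> A} - {a + a |a. a \<in> A}"
      then obtain a b where ab: "y = a + b" "a \<in> A" "b \<in> A" and ny: "\<And>c. c \<in> A \<Longrightarrow> y \<noteq> c + c"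
        by blast
      have "(1/2) *\<^sub>R y \<in> P"
        using convexD[OF convex_P, of a b "1/2" "1/2"] ab by (simp add: scaleR_right_distrib A_def)
      then obtain S where S: "S \<in> T" "(1/2) *\<^sub>R y \<in> S" using Union_eq by blast
      obtain C where C: "finite C" "\<not> affine_dependent C" "C \<subseteq> integer_points"
        "S = convex hull C" "normalized_volume (convex hull C) = 1" using S(1) by (rule simplexE)
      have yi: "real 2 *\<^sub>R ((1/2) *\<^sub>R y) \<in> integer_points"
        using ab by (simp add: A_def integer_points_add)
      have yC: "(1/2) *\<^sub>R y \<in> convex hull C" using S(2) C(4) by simp
      obtain m where m: "sum m C = 2" "(\<Sum>b\<in>C. real (m b) *\<^sub>R b) = real 2 *\<^sub>R ((1/2) *\<^sub>R y)"
        by (rule unimodular_simplex_lattice_coeffs[OF C(1-3) C(5) yC yi])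
      obtain c d where cd: "c \<in> C" "d \<in> C" "(\<Sum>b\<in>C. real (m b) *\<^sub>R b) = c + d"
        by (rule scaled_sum_eq_two_elements[OF C(1) m(1)])
      then have cd: "c \<in> C" "d \<in> C" "y = c + d" using m(2) by simp_all
      have CA: "C \<subseteq> A" using C(3,4) hull_subset[of C convex] S(1) Union_eq by (auto simp: A_def)
      with ny cd have "c \<noteq> d" by blast
      let ?S = "convex hull {c, d}"
      have "?S \<in> T"
        using face_of_convex_hull_affine_independent_subset[OF C(1,2), of "{c, d}"] cd C(4) S(1) face_mem by auto
      moreover have "simplex_of_dim 1 ?S"
        using \<open>c \<noteq> d\<close>
        unfolding simplex_of_dim_def by (intro exI[of _ "{c, d}"]) simp
      moreover have "\<Sum>(vertices ?S) = y"
        using vertices_convex_hull[of "{c, d}"]  \<open>c \<noteq> d\<close> cd by simp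
      ultimately show "y \<in> (\<lambda>S. \<Sum>(vertices S)) ` ?E" by force
    qed
  qed
  then show ?thesis unfolding face_number_def by (simp add: bij_betw_same_card)
qed

end

section \<open>Lattice points of cosmological polytopes\<close>

abbreviation "lookup \<equiv> Poly_Mapping.lookup"

lemma lookup_scaleR: "lookup (r *\<^sub>R x) i = r *\<^sub>R lookup x i"
proof -
  have "finite {i. r *\<^sub>R lookup x i \<noteq> 0}"
    by (rule finite_subset[OF _ finite_keys[of x]]) (auto simp: in_keys_iff)
  then show ?thesis by (simp add: scaleR_poly_mapping_def)
qed

text \<open>Names for the lattice points. The triangle of an arc {i, j} has the vertices
  \<open>Minus\<close>, \<open>Orient\<close> at i and \<open>Orient\<close> at j, with edge
  midpoints \<open>Node i\<close>, \<open>Node j\<close> and \<open>Arc\<close>; a node is shared by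
  the triangles of all its arcs. Sums of two points can then be compared by case analysis on integer
  coordinates.\<close>

datatype 'v label = Node 'v | Arc "'v set" | Minus "'v set" | Orient "'v set" 'v

fun node_coord :: "'v label \<Rightarrow> 'v \<Rightarrow> int" where
  "node_coord (Node u) v = of_bool (v = u)"
| "node_coord (Arc f) v = 0"
| "node_coord (Minus f) v = of_bool (v \<in> f)"
| "node_coord (Orient f u) v = (if v = u then 1 else - of_bool (v \<in> f))"

fun arc_coord :: "'v label \<Rightarrow> 'v set \<Rightarrow> int" where
  "arc_coord (Node u) g = 0"
| "arc_coord (Arc f) g = of_bool (g = f)"
| "arc_coord (Minus f) g = - of_bool (g = f)"
| "arc_coord (Orient f u) g = of_bool (g = f)"

fun label_vec :: "'v label \<Rightarrow> ('v + 'v set) \<Rightarrow>\<^sub>0 real" where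
  "label_vec (Node u) = node_vec u"
| "label_vec (Arc f) = arc_vec f"
| "label_vec (Minus f) = (\<Sum>v\<in>f. node_vec v) - arc_vec f"
| "label_vec (Orient f u) = node_vec u - (\<Sum>v\<in>f - {u}. node_vec v) + arc_vec f"

locale arc_set =
  fixes A :: "'v set set"
  assumes finite_A: "finite A" and card_arc: "f \<in> A \<Longrightarrow> card f = 2"
begin

definition "labels = Node ` \<Union>A \<union> Arc ` A \<union> Minus ` A \<union> (\<Union>f\<in>A. Orient f ` f)"

lemma finite_arc: "f \<in> A \<Longrightarrow> finite f"
  using card_arc by (metis card.infinite zero_neq_numeral)

lemma arcE:
  assumes "f \<in> A" "v \<in> f"
  obtains w where "f = {v, w}" "v \<noteq> w"
  using card_arc[OF assms(1)] assms(2) unfolding card_2_iff by blast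

lemma finite_labels: "finite labels"
  unfolding labels_def using finite_A finite_arc by auto

lemma card_labels: "card labels = card (\<Union>A) + 4 * card A"
proof -
  have fN: "finite (\<Union>A)" using finite_A finite_arc by auto
  have O: "card (\<Union>f\<in>A. Orient f ` f) = 2 * card A"
  proof -
    have "card (\<Union>f\<in>A. Orient f ` f) = (\<Sum>f\<in>A. card (Orient f ` f))"
      using finite_A finite_arc by (intro card_UN_disjoint) auto
    also have "\<dots> = (\<Sum>f\<in>A. 2)"
      using card_arc by (intro sum.cong refl) (simp add: card_image inj_on_def)
    finally show ?thesis by simp
  qed
  have fO: "finite (\<Union>f\<in>A. Orient f ` f)" using finite_A finite_arc by auto
  have "card (Node ` \<Union>A) = card (\<Union>A)" "card (Arc ` A) = card A" "card (Minus ` A) = card A"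
    by (simp_all add: card_image inj_on_def)
  moreover have "card labels = card (Node ` \<Union>A) + card (Arc ` A) + card (Minus ` A) + card (\<Union>f\<in>A. Orient f ` f)"
    unfolding labels_def using finite_A fN fO
    by (subst card_Un_disjoint, simp, simp, force)+ simp
  ultimately show ?thesis using O by simp
qed

lemma lookup_label_vec:
  assumes "a \<in> labels"
  shows "lookup (label_vec a) (Inl v) = of_int (node_coord a v)"
    and "lookup (label_vec a) (Inr f) = of_int (arc_coord a f)"
proof -
  have s: "(\<Sum>v\<in>F. lookup (node_vec v) (Inl u)) = of_bool (u \<in> F)"
     "(\<Sum>v\<in>F. lookup (node_vec v) (Inr h)) = 0" if "finite F" for F and u :: 'v and h
    using that by (auto simp: node_vec_def lookup_single when_def)
  have "finite g" if "a = Minus g \<or> a = Orient g u" for g u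
    using assms that finite_arc by (auto simp: labels_def)
  moreover have "lookup (node_vec w) (Inl u) = of_bool (w = u)"
    "lookup (node_vec w) (Inr h) = 0"
    "lookup (arc_vec g) (Inl u) = 0"
    "lookup (arc_vec g) (Inr h) = of_bool (g = h)" for w u :: 'v and g h
    by (simp_all add: node_vec_def arc_vec_def lookup_single when_def)
  ultimately show "lookup (label_vec a) (Inl v) = of_int (node_coord a v)"
    "lookup (label_vec a) (Inr f) = of_int (arc_coord a f)"
    by (cases a; simp add: lookup_add lookup_minus lookup_sum s)+
qed

lemma cosmological_polytope_eq:
  assumes "arcs G = A"
  shows "cosmological_polytope G = convex hull (label_vec ` (Minus ` A \<union> (\<Union>f\<in>A. Orient f ` f)))"
proof -
  have vec: "label_vec (Minus {i, j}) = node_vec i + node_vec j - arc_vec {i, j}"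
    "label_vec (Orient {i, j} i) = node_vec i - node_vec j + arc_vec {i, j}"
    "label_vec (Orient {i, j} j) = - node_vec i + node_vec j + arc_vec {i, j}" if "i \<noteq> j" for i j :: 'v
    using that by (simp_all add: insert_Diff_if)
  have ne: "i \<noteq> j" if "{i, j} \<in> A" for i j
    using card_arc[OF that] by auto
  have "(\<Union>{{node_vec i + node_vec j - arc_vec f, node_vec i - node_vec j + arc_vec f,
       - node_vec i + node_vec j + arc_vec f} |i j f. f \<in> A \<and> f = {i, j}})
     = (\<Union>{{label_vec (Minus f), label_vec (Orient f i), label_vec (Orient f j)} |i j f. f \<in> A \<and> f = {i, j}})"
    (is "\<Union>?X = \<Union>?Y")
  proof -
    have "?X = ?Y" using vec ne by (smt (verit, best) Collect_cong)
    then show ?thesis by simp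
  qed
  also have "\<dots> = label_vec ` (Minus ` A \<union> (\<Union>f\<in>A. Orient f ` f))"
  proof (intro equalityI subsetI)
    fix x assume "x \<in> label_vec ` (Minus ` A \<union> (\<Union>f\<in>A. Orient f ` f))"
    then obtain f where f: "f \<in> A" and x: "x = label_vec (Minus f) \<or> (\<exists>v\<in>f. x = label_vec (Orient f v))"
      by blast
    obtain i j where ij: "f = {i, j}" using card_arc[OF f] unfolding card_2_iff by blast
    have "{label_vec (Minus f), label_vec (Orient f i), label_vec (Orient f j)} \<in> ?Y"
      using f ij by blast
    moreover have "x \<in> {label_vec (Minus f), label_vec (Orient f i), label_vec (Orient f j)}"
      using x ij by auto
    ultimately show "x \<in> \<Union>?Y" by blast
  next
    fix x assume "x \<in> \<Union>?Y"
    then obtain i j f where f: "f \<in> A" "f = {i, j}"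
      and x: "x \<in> {label_vec (Minus f), label_vec (Orient f i), label_vec (Orient f j)}" by blast
    then have "i \<in> f" "j \<in> f" by simp_all
    then show "x \<in> label_vec ` (Minus ` A \<union> (\<Union>f\<in>A. Orient f ` f))" using f(1) x by blast
  qed
  finally show ?thesis unfolding cosmological_polytope_def assms by simp
qed

end

section \<open>Valid inequalities for the polytope and its lattice points\<close>

lemma convex_hull_superlinear_nonneg:
  fixes \<phi> :: "'a::real_vector \<Rightarrow> real"
  assumes "x \<in> convex hull S" "\<And>x. x \<in> S \<Longrightarrow> 0 \<le> \<phi> x"
    and lin: "\<And>x y u v. 0 \<le> u \<Longrightarrow> 0 \<le> v \<Longrightarrow> u + v = 1 \<Longrightarrow> u * \<phi> x + v * \<phi> y \<le> \<phi> (u *\<^sub>R x + v *\<^sub>R y)"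
  shows "0 \<le> \<phi> x"
proof -
  have "convex {x. 0 \<le> \<phi> x}"
  proof (rule convexI)
    fix x y and u v :: real
    assume "x \<in> {x. 0 \<le> \<phi> x}" "y \<in> {x. 0 \<le> \<phi> x}" and uv: "0 \<le> u" "0 \<le> v" "u + v = 1"
    then have "0 \<le> u * \<phi> x + v * \<phi> y" by simp
    with lin[OF uv, of x y] show "u *\<^sub>R x + v *\<^sub>R y \<in> {x. 0 \<le> \<phi> x}" by simp
  qed
  then have "convex hull S \<subseteq> {x. 0 \<le> \<phi> x}" using assms(2) by (intro hull_minimal) auto
  then show ?thesis using assms(1) by blast
qed

lemma sum_Ints_eq_1:
  fixes f :: "'a \<Rightarrow> real"
  assumes "finite A" "\<And>a. a \<in> A \<Longrightarrow> f a \<in> \<int>" "\<And>a. a \<in> A \<Longrightarrow> 0 \<le> f a" "sum f A = 1"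
  obtains a where "a \<in> A" "f a = 1" "\<And>b. b \<in> A \<Longrightarrow> b \<noteq> a \<Longrightarrow> f b = 0"
proof -
  obtain a where a: "a \<in> A" "f a \<noteq> 0" using assms(4) by (metis sum.neutral zero_neq_one)
  then have "1 \<le> f a" using assms(2,3)[of a] by (metis Ints_nonzero_abs_ge1 abs_of_nonneg)
  moreover have "sum f A = f a + sum f (A - {a})" using a(1) assms(1) by (simp add: sum.remove)
  moreover have "0 \<le> sum f (A - {a})" using assms(3) by (intro sum_nonneg) auto
  ultimately have "f a = 1" "sum f (A - {a}) = 0" using assms(4) by linarith+
  moreover have "f b = 0" if "b \<in> A - {a}" for b
    using sum_nonneg_0[of "A - {a}" f b] assms(1,3) that \<open>sum f (A - {a}) = 0\<close> by auto
  ultimately show thesis using that[of a] a(1) by blast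
qed

declare label_vec.simps [simp del]

context arc_set
begin

definition "V = \<Union>A"
definition "Q = convex hull (label_vec ` (Minus ` A \<union> (\<Union>f\<in>A. Orient f ` f)))"

lemma finite_V: "finite V" unfolding V_def using finite_A finite_arc by auto

lemma generator_cases:
  assumes "x \<in> label_vec ` (Minus ` A \<union> (\<Union>f\<in>A. Orient f ` f))"
  obtains f where "f \<in> A" "x = label_vec (Minus f)"
  | f u w where "f \<in> A" "f = {u, w}" "u \<noteq> w" "x = label_vec (Orient f u)"
proof -
  from assms consider f where "f \<in> A" "x = label_vec (Minus f)" | f u where "f \<in> A" "u \<in> f" "x = label_vec (Orient f u)"
    by blast
  then show thesis
  proof cases
    case 1 then show thesis by (rule that(1))
  next
    case (2 f u)
    obtain w where "f = {u, w}" "u \<noteq> w" using 2(1,2) by (rule arcE)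
    then show thesis using that(2) 2 by blast
  qed
qed

lemma lookup_gen:
  assumes "f \<in> A"
  shows "lookup (label_vec (Minus f)) (Inl v) = of_bool (v \<in> f)"
    "lookup (label_vec (Minus f)) (Inr g) = - of_bool (g = f)"
    "u \<in> f \<Longrightarrow> lookup (label_vec (Orient f u)) (Inl v) = (if v = u then 1 else - of_bool (v \<in> f))"
    "u \<in> f \<Longrightarrow> lookup (label_vec (Orient f u)) (Inr g) = of_bool (g = f)"
proof -
  have "Minus f \<in> labels" "u \<in> f \<Longrightarrow> Orient f u \<in> labels"
    unfolding labels_def using assms by blast+
  then show "lookup (label_vec (Minus f)) (Inl v) = of_bool (v \<in> f)"
    "lookup (label_vec (Minus f)) (Inr g) = - of_bool (g = f)"
    "u \<in> f \<Longrightarrow> lookup (label_vec (Orient f u)) (Inl v) = (if v = u then 1 else - of_bool (v \<in> f))"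
    "u \<in> f \<Longrightarrow> lookup (label_vec (Orient f u)) (Inr g) = of_bool (g = f)"
    by (simp_all add: lookup_label_vec)
qed

lemma Q_nonneg:
  fixes \<phi> :: "(('v + 'v set) \<Rightarrow>\<^sub>0 real) \<Rightarrow> real"
  assumes "x \<in> Q" "\<And>f. f \<in> A \<Longrightarrow> 0 \<le> \<phi> (label_vec (Minus f))"
    "\<And>f u w. f \<in> A \<Longrightarrow> f = {u, w} \<Longrightarrow> u \<noteq> w \<Longrightarrow> 0 \<le> \<phi> (label_vec (Orient f u))"
    "\<And>x y u v. 0 \<le> u \<Longrightarrow> 0 \<le> v \<Longrightarrow> u + v = 1 \<Longrightarrow> u * \<phi> x + v * \<phi> y \<le> \<phi> (u *\<^sub>R x + v *\<^sub>R y)"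
  shows "0 \<le> \<phi> x"
proof (rule convex_hull_superlinear_nonneg[where S = "label_vec ` (Minus ` A \<union> (\<Union>f\<in>A. Orient f ` f))"])
  show "x \<in> convex hull (label_vec ` (Minus ` A \<union> (\<Union>f\<in>A. Orient f ` f)))"
    using assms(1) by (simp add: Q_def)
  fix x assume "x \<in> label_vec ` (Minus ` A \<union> (\<Union>f\<in>A. Orient f ` f))"
  then show "0 \<le> \<phi> x" by (cases rule: generator_cases) (use assms(2,3) in auto)
qed (rule assms(4))

text \<open>Over both orders of the end points of an arc, the two conditions are the values of the
  affine function at the three generators of its triangle.\<close>

lemma Q_linear:
  fixes a :: "'v \<Rightarrow> real" and b :: "'v set \<Rightarrow> real"
  assumes "x \<in> Q"
    and gen: "\<And>u w. {u, w} \<in> A \<Longrightarrow> u \<noteq> w \<Longrightarrow> 0 \<le> c + a u + a w - b {u, w} \<and> 0 \<le> c + a u - a w + b {u, w}"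
  shows "0 \<le> c + (\<Sum>v\<in>V. a v * lookup x (Inl v)) + (\<Sum>f\<in>A. b f * lookup x (Inr f))"
proof (rule Q_nonneg[OF assms(1)])
  have sumV: "(\<Sum>v\<in>V. a v * of_bool (v = u)) = a u" if "f \<in> A" "u \<in> f" for u f
  proof -
    have "u \<in> V" using that by (auto simp: V_def)
    then show ?thesis using finite_V by (simp add: of_bool_def if_distrib cong: if_cong)
  qed
  have sumA: "(\<Sum>g\<in>A. b g * of_bool (g = f)) = b f" if "f \<in> A" for f
    using that finite_A by (simp add: of_bool_def if_distrib cong: if_cong)
  {
    fix f assume f: "f \<in> A"
    then obtain u w where uw: "f = {u, w}" "u \<noteq> w" using card_arc unfolding card_2_iff by blast
    have "(\<Sum>v\<in>V. a v * of_bool (v \<in> f)) = (\<Sum>v\<in>V. a v * of_bool (v = u) + a v * of_bool (v = w))"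
      using uw by (intro sum.cong) auto
    also have "\<dots> = a u + a w" using sumV[OF f] uw by (simp add: sum.distrib)
    finally show "0 \<le> c + (\<Sum>v\<in>V. a v * lookup (label_vec (Minus f)) (Inl v))
      + (\<Sum>g\<in>A. b g * lookup (label_vec (Minus f)) (Inr g))"
      using gen[of u w] f uw by (simp add: lookup_gen sumA sum_negf)
  next
    fix f u w assume f: "f \<in> A" "f = {u, w}" "u \<noteq> w"
    have uf: "u \<in> f" using f by simp
    have "(\<Sum>v\<in>V. a v * (if v = u then 1 else - of_bool (v \<in> f))) = (\<Sum>v\<in>V. a v * of_bool (v = u) - a v * of_bool (v = w))"
      using f by (intro sum.cong) auto
    also have "\<dots> = a u - a w" using sumV[OF f(1)] f by (simp add: sum_subtractf)
    finally show "0 \<le> c + (\<Sum>v\<in>V. a v * lookup (label_vec (Orient f u)) (Inl v))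
      + (\<Sum>g\<in>A. b g * lookup (label_vec (Orient f u)) (Inr g))"
      using gen[of u w, folded f(2)] f(1,3) by (simp add: lookup_gen(3,4)[OF f(1) uf] sumA[OF f(1)])
  }
  fix x y :: "('v + 'v set) \<Rightarrow>\<^sub>0 real" and u v :: real assume "u + v = 1"
  then have "c = u * c + v * c" by (simp flip: distrib_right)
  then show "u * (c + (\<Sum>v\<in>V. a v * lookup x (Inl v)) + (\<Sum>f\<in>A. b f * lookup x (Inr f)))
    + v * (c + (\<Sum>v\<in>V. a v * lookup y (Inl v)) + (\<Sum>f\<in>A. b f * lookup y (Inr f)))
    \<le> c + (\<Sum>w\<in>V. a w * lookup (u *\<^sub>R x + v *\<^sub>R y) (Inl w))
      + (\<Sum>f\<in>A. b f * lookup (u *\<^sub>R x + v *\<^sub>R y) (Inr f))"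
    by (simp add: lookup_add lookup_scaleR algebra_simps sum.distrib sum_distrib_left)
qed

lemma Q_sum_eq_1:
  assumes "x \<in> Q"
  shows "(\<Sum>v\<in>V. lookup x (Inl v)) + (\<Sum>f\<in>A. lookup x (Inr f)) = 1"
  using Q_linear[OF assms, of "-1" "\<lambda>_. 1" "\<lambda>_. 1"] Q_linear[OF assms, of 1 "\<lambda>_. -1" "\<lambda>_. -1"]
  by (simp add: sum_negf)

text \<open>Every generator has a single nonzero arc coordinate, 1 or -1, so testing against the
  signs of the arc coordinates of \<open>x\<close> suffices. An integer point is left with at most
  one nonzero arc coordinate.\<close>

lemma Q_sum_abs_arcs_le_1:
  assumes "x \<in> Q"
  shows "(\<Sum>f\<in>A. \<bar>lookup x (Inr f)\<bar>) \<le> 1"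
proof -
  have "0 \<le> 1 + (\<Sum>v\<in>V. 0 * lookup x (Inl v))
    + (\<Sum>f\<in>A. - sgn (lookup x (Inr f)) * lookup x (Inr f))"
    by (rule Q_linear[OF assms]) (auto simp: sgn_if)
  then show ?thesis by (simp add: sum_negf abs_sgn mult.commute)
qed

lemma Q_support:
  assumes "x \<in> Q"
  shows "v \<notin> V \<Longrightarrow> lookup x (Inl v) = 0" "f \<notin> A \<Longrightarrow> lookup x (Inr f) = 0"
proof -
  have "0 \<le> s * lookup x (Inl v)" if "v \<notin> V" for s
    by (rule Q_nonneg[OF assms]) (use that in \<open>auto simp: lookup_gen V_def lookup_add lookup_scaleR algebra_simps\<close>)
  from this[of 1] this[of "-1"] show "v \<notin> V \<Longrightarrow> lookup x (Inl v) = 0" by simp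
  have "0 \<le> s * lookup x (Inr f)" if "f \<notin> A" for s
    by (rule Q_nonneg[OF assms]) (use that in \<open>auto simp: lookup_gen lookup_add lookup_scaleR algebra_simps\<close>)
  from this[of 1] this[of "-1"] show "f \<notin> A \<Longrightarrow> lookup x (Inr f) = 0" by simp
qed

text \<open>At a generator of an arc through \<open>v\<close> the node term and the arc term cancel
  or add up to 2; all other generators give 0.\<close>

lemma Q_node_ge:
  assumes "x \<in> Q" "v \<in> V"
  shows "0 \<le> lookup x (Inl v) + (\<Sum>f\<in>A. of_bool (v \<in> f) * lookup x (Inr f))"
proof -
  have "0 \<le> 0 + (\<Sum>w\<in>V. of_bool (w = v) * lookup x (Inl w)) + (\<Sum>f\<in>A. of_bool (v \<in> f) * lookup x (Inr f))"
    by (rule Q_linear[OF assms(1)]) auto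
  moreover have "(\<Sum>w\<in>V. of_bool (w = v) * lookup x (Inl w)) = lookup x (Inl v)"
    using assms(2) finite_V by (simp add: of_bool_def if_distrib[of "\<lambda>k. k * _"] cong: if_cong)
  ultimately show ?thesis by simp
qed

text \<open>For an arc that meets \<open>f\<close> in one node, the coordinate at this node and the
  arc coordinate cancel or add up to 2; for \<open>f\<close> itself the node coordinates sum to 2 or
  0.\<close>

lemma Q_arc_ge:
  assumes "x \<in> Q" "f \<in> A"
  shows "0 \<le> (\<Sum>v\<in>f. lookup x (Inl v)) + (\<Sum>g\<in>A. of_bool (card (g \<inter> f) = 1) * lookup x (Inr g))"
proof -
  have "0 \<le> 0 + (\<Sum>w\<in>V. of_bool (w \<in> f) * lookup x (Inl w)) + (\<Sum>g\<in>A. of_bool (card (g \<inter> f) = 1) * lookup x (Inr g))"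
    by (rule Q_linear[OF assms(1)]) (auto simp: Int_insert_left)
  moreover have "(\<Sum>w\<in>V. of_bool (w \<in> f) * lookup x (Inl w)) = (\<Sum>w\<in>f. lookup x (Inl w))"
    using assms(2) finite_V by (intro sum.mono_neutral_cong_right) (auto simp: V_def)
  ultimately show ?thesis by simp
qed

text \<open>At most one arc coordinate is nonzero, and it is 1 or -1. Node coordinates off this arc
  are nonnegative, so the coordinate sum 1 leaves only \<open>Minus\<close>, \<open>Arc\<close> and
  the two \<open>Orient\<close> of the arc; without an arc coordinate a single node remains.\<close>

lemma Q_lattice_point_is_label_vec:
  assumes x: "x \<in> Q" "x \<in> integer_points"
  shows "x \<in> label_vec ` labels"
proof -
  define X where "X v = lookup x (Inl v)" for v
  define Y where "Y f = lookup x (Inr f)" for f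
  have Xi: "X v \<in> \<int>" and Yi: "Y f \<in> \<int>" for v f
    using x(2) by (simp_all add: integer_points_def X_def Y_def)
  have total: "sum X V + sum Y A = 1" using Q_sum_eq_1[OF x(1)] by (simp add: X_def Y_def)
  have X0: "X v = 0" if "v \<notin> V" for v using Q_support(1)[OF x(1) that] by (simp add: X_def)
  have Y0: "Y f = 0" if "f \<notin> A" for f using Q_support(2)[OF x(1) that] by (simp add: Y_def)
  have node: "0 \<le> X v + (\<Sum>f\<in>A. of_bool (v \<in> f) * Y f)" if "v \<in> V" for v
    using Q_node_ge[OF x(1) that] by (simp add: X_def Y_def)
  have label: "x = label_vec a" if "a \<in> labels" "\<And>v. X v = node_coord a v" "\<And>f. Y f = arc_coord a f" for a
  proof (rule poly_mapping_eqI)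
    fix k show "lookup x k = lookup (label_vec a) k"
      using that by (cases k) (simp_all add: lookup_label_vec X_def Y_def)
  qed
  show ?thesis
  proof (cases "\<forall>f\<in>A. Y f = 0")
    case True
    then have Y: "Y f = 0" for f using Y0 by blast
    have "sum X V = 1" "\<And>v. v \<in> V \<Longrightarrow> 0 \<le> X v" using total node Y by simp_all
    then obtain v where v: "v \<in> V" "X v = 1" "\<And>w. w \<in> V \<Longrightarrow> w \<noteq> v \<Longrightarrow> X w = 0"
      using sum_Ints_eq_1[OF finite_V, of X] Xi by blast
    have "x = label_vec (Node v)"
    proof (rule label)
      show "Node v \<in> labels" using v(1) by (simp add: labels_def V_def)
      show "X w = node_coord (Node v) w" for w using v(2) v(3)[of w] X0[of w] by auto
    qed (simp add: Y)
    then show ?thesis using v(1) by (simp add: labels_def V_def)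
  next
    case False
    then obtain f where f: "f \<in> A" "Y f \<noteq> 0" by blast
    obtain i j where ij: "f = {i, j}" "i \<noteq> j" using card_arc[OF f(1)] unfolding card_2_iff by blast
    have inV: "i \<in> V" "j \<in> V" using f ij by (auto simp: V_def)
    have "1 \<le> \<bar>Y f\<bar>" using f(2) Yi by (metis Ints_nonzero_abs_ge1)
    moreover have "\<bar>Y f\<bar> + (\<Sum>g\<in>A - {f}. \<bar>Y g\<bar>) \<le> 1"
      using Q_sum_abs_arcs_le_1[OF x(1)] finite_A f(1) by (simp add: Y_def sum.remove)
    moreover have "0 \<le> (\<Sum>g\<in>A - {f}. \<bar>Y g\<bar>)" by (intro sum_nonneg) simp
    ultimately have Yf: "\<bar>Y f\<bar> = 1" and "(\<Sum>g\<in>A - {f}. \<bar>Y g\<bar>) = 0" by linarith+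
    then have "\<forall>g\<in>A - {f}. \<bar>Y g\<bar> = 0" using finite_A by (subst (asm) sum_nonneg_eq_0_iff) auto
    then have Yg: "Y g = 0" if "g \<noteq> f" for g using Y0 that by auto
    have sumY: "(\<Sum>g\<in>A. h g * Y g) = h f * Y f" for h
    proof -
      have "(\<Sum>g\<in>A. h g * Y g) = h f * Y f + (\<Sum>g\<in>A - {f}. h g * Y g)"
        using finite_A f(1) by (simp add: sum.remove)
      then show ?thesis using Yg by simp
    qed
    have sumX: "sum X V = X i + X j + sum X (V - f)"
      using inV ij finite_V by (simp add: sum.subset_diff[of f V])
    have tot: "X i + X j + sum X (V - f) + Y f = 1" using total sumX sumY[of "\<lambda>_. 1"] by simp
    have out: "0 \<le> X v" if "v \<in> V - f" for v using node[of v] sumY that by simp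
    have out_sum: "0 \<le> sum X (V - f)" using out by (rule sum_nonneg)
    have i: "0 \<le> X i + Y f" "0 \<le> X j + Y f" using node[OF inV(1)] node[OF inV(2)] sumY ij by simp_all
    have zero: "X v = 0" if "v \<notin> f" "sum X (V - f) = 0" for v
      using sum_nonneg_0[of "V - f" X v] finite_V out that X0 by blast
    have eqs: "X i + X j + Y f = 1 \<and> sum X (V - f) = 0 \<and>
      (Y f = -1 \<and> X i = 1 \<and> X j = 1 \<or> Y f = 1 \<and> (X i = 0 \<and> X j = 0 \<or> X i = 1 \<and> X j = -1 \<or> X i = -1 \<and> X j = 1))"
    proof (cases "Y f = 1")
      case True
      \<comment> \<open>The node inequalities alone would admit \<open>X i = -1\<close>,
        \<open>X j = 0\<close> balanced by a node outside \<open>f\<close>.\<close>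
      have "0 \<le> X i + X j"
        using Q_arc_ge[OF x(1) f(1)] sumY[of "\<lambda>g. of_bool (card (g \<inter> f) = 1)"] card_arc[OF f(1)] ij
        by (simp add: X_def Y_def)
      then have X: "X i + X j = 0" "sum X (V - f) = 0" using tot True out_sum by linarith+
      have "\<bar>X i\<bar> \<le> 1" using i X True by simp
      moreover have "X i = 0 \<or> 1 \<le> \<bar>X i\<bar>" using Xi by (metis Ints_nonzero_abs_ge1)
      ultimately have "X i = 0 \<or> X i = 1 \<or> X i = -1" by linarith
      then show ?thesis using X True by auto
    next
      case False
      then have "Y f = -1" using Yf by linarith
      then show ?thesis using tot i out_sum by auto
    qed
    have V0: "X v = 0" if "v \<notin> f" for v using zero[OF that] eqs by blast
    consider "Y f = -1" "X i = 1" "X j = 1" | "Y f = 1" "X i = 0" "X j = 0"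
      | "Y f = 1" "X i = 1" "X j = -1" | "Y f = 1" "X i = -1" "X j = 1"
      using eqs by blast
    then obtain a where a: "a \<in> {Minus f, Arc f, Orient f i, Orient f j}"
      "Y f = arc_coord a f" "X i = node_coord a i" "X j = node_coord a j"
    proof cases
      case 1 then show thesis using that[of "Minus f"] ij by simp
    next
      case 2 then show thesis using that[of "Arc f"] ij by simp
    next
      case 3 then show thesis using that[of "Orient f i"] ij by simp
    next
      case 4 then show thesis using that[of "Orient f j"] ij by simp
    qed
    have al: "a \<in> labels" using a(1) f(1) ij unfolding labels_def by blast
    have "x = label_vec a"
    proof (rule label[OF al])
      show "X v = node_coord a v" for v
      proof (cases "v \<in> f")
        case True then show ?thesis using a ij by blast
      next
        case False then show ?thesis using V0[OF False] a(1) ij by auto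
      qed
      show "Y g = arc_coord a g" for g
      proof (cases "g = f")
        case True then show ?thesis using a by simp
      next
        case False then show ?thesis using Yg[OF False] a(1) by auto
      qed
    qed
    then show ?thesis using al by blast
  qed
qed

lemma label_vec_in_Q:
  assumes "a \<in> labels"
  shows "label_vec a \<in> Q"
proof -
  have gen: "label_vec (Minus f) \<in> Q" "u \<in> f \<Longrightarrow> label_vec (Orient f u) \<in> Q" if "f \<in> A" for f u
    using that unfolding Q_def by (intro hull_inc; blast)+
  have convex: "convex Q" unfolding Q_def by (rule convex_convex_hull)
  have mid: "(1/2) *\<^sub>R (x + y) \<in> Q" if "x \<in> Q" "y \<in> Q" for x y
    using convexD[OF convex that, of "1/2" "1/2"] by (simp add: scaleR_right_distrib)
  consider u where "u \<in> V" "a = Node u" | f where "f \<in> A" "a = Arc f" | f where "f \<in> A" "a = Minus f"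
    | f u where "f \<in> A" "u \<in> f" "a = Orient f u"
    using assms unfolding labels_def V_def by blast
  then show ?thesis
  proof cases
    case 1
    then obtain f where f: "f \<in> A" "u \<in> f" by (auto simp: V_def)
    have "finite f" using finite_arc f(1) .
    then have "label_vec (Minus f) + label_vec (Orient f u) = 2 *\<^sub>R label_vec (Node u)"
      using f(2) by (simp add: label_vec.simps sum.remove[of f u] scaleR_2)
    then have "label_vec (Node u) = (1/2) *\<^sub>R (label_vec (Minus f) + label_vec (Orient f u))" by simp
    then show ?thesis using mid gen f 1 by simp
  next
    case 2
    obtain u w where uw: "f = {u, w}" "u \<noteq> w" using card_arc[OF 2(1)] unfolding card_2_iff by blast
    then have "label_vec (Orient f w) + label_vec (Orient f u) = 2 *\<^sub>R label_vec (Arc f)"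
      by (simp add: label_vec.simps insert_Diff_if scaleR_2)
    then have "label_vec (Arc f) = (1/2) *\<^sub>R (label_vec (Orient f w) + label_vec (Orient f u))" by simp
    then show ?thesis using mid gen(2)[OF 2(1), of u] gen(2)[OF 2(1), of w] 2 uw by simp
  qed (use gen in auto)
qed

lemma Q_lattice_points: "Q \<inter> integer_points = label_vec ` labels"
proof
  show "label_vec ` labels \<subseteq> Q \<inter> integer_points"
  proof clarify
    fix a assume "a \<in> labels"
    moreover have "lookup (label_vec a) k \<in> \<int>" for k
      using \<open>a \<in> labels\<close> by (cases k) (simp_all add: lookup_label_vec)
    ultimately show "label_vec a \<in> Q \<inter> integer_points" using label_vec_in_Q by (simp add: integer_points_def)
  qed
qed (use Q_lattice_point_is_label_vec in blast)

end

section \<open>The number of edges as a function of the graph\<close>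

text \<open>The sign and position of the only arc coordinate. A node has sign 0 at the dummy
  position \<open>{}\<close>, which is no arc, so that equal arc coordinates give equal
  skeletons.\<close>

fun skeleton :: "'v label \<Rightarrow> int \<times> 'v set" where
  "skeleton (Node u) = (0, {})"
| "skeleton (Arc f) = (1, f)"
| "skeleton (Minus f) = (-1, f)"
| "skeleton (Orient f u) = (1, f)"

lemma arc_coord_skeleton: "arc_coord a g = (if g = snd (skeleton a) then fst (skeleton a) else 0)"
  by (cases a) auto

text \<open>
  The lattice points of the triangle of an arc \<open>f = {i, j}\<close> satisfy six relations between sums of two
  of them; from each relation one of the two pairs is discarded. The choice is such that in the
  remaining pairs no coordinate of an arc cancels.
\<close>

definition bad_pairs :: "'v set \<Rightarrow> 'v label set set" where
  "bad_pairs f = {{Minus f, Arc f}, Orient f ` f} \<union> (\<lambda>v. {Minus f, Orient f v}) ` f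
     \<union> (\<lambda>v. insert (Orient f v) (Node ` (f - {v}))) ` f"

lemma bad_pairs_doubleton:
  assumes "i \<noteq> j"
  shows "bad_pairs {i, j} = {{Minus {i, j}, Arc {i, j}}, {Minus {i, j}, Orient {i, j} i}, {Minus {i, j}, Orient {i, j} j},
    {Orient {i, j} i, Orient {i, j} j}, {Orient {i, j} i, Node j}, {Orient {i, j} j, Node i}}"
proof -
  have "{i, j} - {i} = {j}" "{i, j} - {j} = {i}" using assms by auto
  then show ?thesis unfolding bad_pairs_def by auto
qed

text \<open>If nothing cancels, the sum of two signed point masses determines them up to order. Sign
  0 is tied to the dummy position because a zero mass would leave its position free.\<close>

lemma signed_pair_eq:
  fixes s t s' t' :: int
  assumes "s \<in> {-1, 0, 1}" "t \<in> {-1, 0, 1}" "s' \<in> {-1, 0, 1}" "t' \<in> {-1, 0, 1}"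
    and "f = g \<Longrightarrow> s = - t \<Longrightarrow> s = 0" "f' = g' \<Longrightarrow> s' = - t' \<Longrightarrow> s' = 0"
    and "s = 0 \<Longrightarrow> f = {}" "t = 0 \<Longrightarrow> g = {}" "s' = 0 \<Longrightarrow> f' = {}" "t' = 0 \<Longrightarrow> g' = {}"
    and eq: "\<And>h. (if h = f then s else 0) + (if h = g then t else 0) = (if h = f' then s' else 0) + (if h = g' then t' else 0)"
  shows "s = s' \<and> f = f' \<and> t = t' \<and> g = g' \<or> s = t' \<and> f = g' \<and> t = s' \<and> g = f'"
  using assms(1-10) eq[of f] eq[of g] eq[of f'] eq[of g'] by (smt (verit) insertE singletonD)

context arc_set
begin

definition "allowed a b \<longleftrightarrow> (\<forall>f\<in>A. {a, b} \<notin> bad_pairs f)"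

lemma allowed_commute: "allowed a b = allowed b a"
  by (simp add: allowed_def insert_commute)

lemma skeleton_label:
  assumes "a \<in> labels"
  obtains u where "a = Node u" "skeleton a = (0, {})"
  | f where "f \<in> A" "a = Minus f" "skeleton a = (-1, f)"
  | f where "f \<in> A" "a = Arc f" "skeleton a = (1, f)"
  | f u where "f \<in> A" "u \<in> f" "a = Orient f u" "skeleton a = (1, f)"
  using assms unfolding labels_def by (elim UnE imageE UN_E) simp_all

lemma positive_label:
  assumes "a \<in> labels" "skeleton a = (1, f)" "f = {i, j}"
  shows "f \<in> A" "a = Arc f \<or> a = Orient f i \<or> a = Orient f j"
  using assms(1) by (cases rule: skeleton_label; use assms(2,3) in auto)+

lemma zero_label: "skeleton a = (0, {}) \<Longrightarrow> \<exists>u. a = Node u"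
  and negative_label: "skeleton a = (-1, f) \<Longrightarrow> a = Minus f"
  by (cases a; simp)+

lemma label_eqI:
  assumes "b \<in> labels" "d \<in> labels" "skeleton b = skeleton d" "\<And>v. node_coord b v = node_coord d v"
  shows "b = d"
  using assms(1)
proof (cases rule: skeleton_label)
  case (1 u)
  then obtain w where "d = Node w" using assms(3) zero_label[of d] by auto
  then show ?thesis using assms(4)[of u] 1 by (simp split: if_splits)
next
  case (2 f)
  then show ?thesis using assms(3) negative_label[of d f] by simp
next
  case (3 f)
  note b = 3
  show ?thesis using assms(2)
  proof (cases rule: skeleton_label)
    case (4 g u)
    then show ?thesis using assms(4)[of u] b by simp
  qed (use b assms(3) in auto)
next
  case (4 f u)
  show ?thesis using assms(2)
    by (cases rule: skeleton_label) (use 4 assms(3) assms(4)[of u] in \<open>auto split: if_splits\<close>)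
qed

text \<open>Opposite signs on one arc occur only for \<open>Minus f\<close> with
  \<open>Arc f\<close> or with an \<open>Orient f v\<close>, and these three pairs are bad.\<close>

lemma allowed_skeleton:
  assumes "a \<in> labels" "b \<in> labels" "allowed a b" "snd (skeleton a) = snd (skeleton b)"
    "fst (skeleton a) = - fst (skeleton b)"
  shows "fst (skeleton a) = 0"
proof (rule ccontr)
  assume n: "fst (skeleton a) \<noteq> 0"
  have bad: "{Minus f, b} \<in> bad_pairs f" if b: "f \<in> A" "skeleton b = (1, f)" "b \<in> labels" for b f
  proof -
    obtain i j where ij: "f = {i, j}" "i \<noteq> j" using card_arc[OF b(1)] unfolding card_2_iff by blast
    show ?thesis using positive_label(2)[OF b(3,2) ij(1)] unfolding ij(1) bad_pairs_doubleton[OF ij(2)] by blast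
  qed
  from assms(1) show False
  proof (cases rule: skeleton_label)
    case (2 f)
    then have "skeleton b = (1, f)" using assms(4,5) by (cases "skeleton b") simp
    then show False using bad[of f b] 2 assms(2,3) by (auto simp: allowed_def)
  next
    case (3 f)
    then have "skeleton b = (-1, f)" using assms(4,5) by (cases "skeleton b") simp
    then have "b = Minus f" by (rule negative_label)
    then show False using bad[of f a] 3 assms(1,3) by (auto simp: allowed_def insert_commute)
  next
    case (4 f u)
    then have "skeleton b = (-1, f)" using assms(4,5) by (cases "skeleton b") simp
    then have "b = Minus f" by (rule negative_label)
    then show False using bad[of f a] 4 assms(1,3) by (auto simp: allowed_def insert_commute)
  qed (use n in simp)
qed

text \<open>With the skeletons matched, the node coordinates have to separate what is left.
  \<open>Minus\<close> is fixed by its skeleton. Among the rest, the only coincidences are a node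
  plus an orientation against the other node plus \<open>Arc\<close>, and the two orientations
  against twice \<open>Arc\<close>; one side of each is bad.\<close>

lemma aligned_pair_eq:
  assumes lab: "a \<in> labels" "b \<in> labels" "c \<in> labels" "d \<in> labels" and al: "allowed a b" "allowed c d"
    and sk: "skeleton a = skeleton c" "skeleton b = skeleton d"
    and N: "\<And>v. node_coord a v + node_coord b v = node_coord c v + node_coord d v"
  shows "{a, b} = {c, d}"
proof -
  have ac: "{a, b} = {c, d}" if "a = c"
    using label_eqI[OF lab(2,4) sk(2)] N that by simp
  have bd: "{a, b} = {c, d}" if "b = d"
    using label_eqI[OF lab(1,3) sk(1)] N that by simp
  have mixed: "{a, b} = {c, d}"
    if lab: "a \<in> labels" "b \<in> labels" "c \<in> labels" "d \<in> labels" and al: "allowed a b" "allowed c d"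
    and sk: "skeleton a = (0, {})" "skeleton c = (0, {})" "skeleton b = (1, f)" "skeleton d = (1, f)" "f \<in> A"
    and N: "\<And>v. node_coord a v + node_coord b v = node_coord c v + node_coord d v" for a b c d :: "'v label" and f
  proof -
    obtain u where u: "a = Node u" using zero_label[OF sk(1)] by blast
    obtain w where w: "c = Node w" using zero_label[OF sk(2)] by blast
    note uw = u w
    obtain i j where ij: "f = {i, j}" "i \<noteq> j" using card_arc[OF sk(5)] unfolding card_2_iff by blast
    have B: "b = Arc f \<or> b = Orient f i \<or> b = Orient f j" by (rule positive_label(2)[OF lab(2) sk(3) ij(1)])
    have D: "d = Arc f \<or> d = Orient f i \<or> d = Orient f j" by (rule positive_label(2)[OF lab(4) sk(4) ij(1)])
    have bad: "{Orient f i, Node j} \<in> bad_pairs f" "{Orient f j, Node i} \<in> bad_pairs f"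
      unfolding ij(1) bad_pairs_doubleton[OF ij(2)] by simp_all
    have nb: "{a, b} \<notin> bad_pairs f" "{c, d} \<notin> bad_pairs f" using al sk(5) by (simp_all add: allowed_def)
    have al': "{a, b} \<noteq> {Orient f i, Node j}" "{a, b} \<noteq> {Orient f j, Node i}"
      "{c, d} \<noteq> {Orient f i, Node j}" "{c, d} \<noteq> {Orient f j, Node i}"
      using bad nb by metis+
    \<comment> \<open>For distinct u, w the coordinates leave only
      \<open>Node i + Arc f = Node j + Orient f i\<close> and its mirror image, each with a bad
      side.\<close>
    have "u = w"
      using B D al' N[of i] N[of j] N[of u] N[of w] ij(2) unfolding uw
      by (elim disjE; simp add: ij(1) doubleton_eq_iff split: if_splits)
    then have "a = c" using uw by simp
    then show ?thesis using label_eqI[OF lab(2,4)] sk N by simp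
  qed
  have both: ?thesis if sk': "skeleton a = (1, f)" "f \<in> A" "skeleton b = (1, g)" "g \<in> A" for f g
  proof (cases "f = g")
    case False
    \<comment> \<open>An end point of \<open>f\<close> outside \<open>g\<close> sees only
      \<open>a\<close> and \<open>c\<close>, and its coordinate 0, 1 or -1 tells
      \<open>Arc f\<close> and the two orientations apart.\<close>
    have "\<not> f \<subseteq> g"
      using False card_seteq[OF finite_arc[OF sk'(4)], of f] card_arc[OF sk'(2)] card_arc[OF sk'(4)] by linarith
    then obtain i where i: "i \<in> f" "i \<notin> g" by blast
    obtain j where ij: "f = {i, j}" "i \<noteq> j" using sk'(2) i(1) by (rule arcE)
    have A: "a = Arc f \<or> a = Orient f i \<or> a = Orient f j" by (rule positive_label(2)[OF lab(1) sk'(1) ij(1)])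
    have C: "c = Arc f \<or> c = Orient f i \<or> c = Orient f j"
      using sk sk' by (intro positive_label(2)[OF lab(3) _ ij(1)]) simp
    obtain k l where kl: "g = {k, l}" "k \<noteq> l" using card_arc[OF sk'(4)] unfolding card_2_iff by blast
    have "node_coord b i = 0"
      using positive_label(2)[OF lab(2) sk'(3) kl(1)] i(2) kl by auto
    moreover have "node_coord d i = 0"
      using positive_label(2)[OF lab(4) _ kl(1)] sk sk' i(2) kl by auto
    ultimately have "node_coord a i = node_coord c i" using N[of i] by simp
    then have "a = c" using A C ij by auto
    then show ?thesis by (rule ac)
  next
    case True
    obtain i j where ij: "f = {i, j}" "i \<noteq> j" using card_arc[OF sk'(2)] unfolding card_2_iff by blast
    have A: "a = Arc f \<or> a = Orient f i \<or> a = Orient f j" by (rule positive_label(2)[OF lab(1) sk'(1) ij(1)])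
    have B: "b = Arc f \<or> b = Orient f i \<or> b = Orient f j"
      using True sk' by (intro positive_label(2)[OF lab(2) _ ij(1)]) simp
    have C: "c = Arc f \<or> c = Orient f i \<or> c = Orient f j"
      using sk sk' by (intro positive_label(2)[OF lab(3) _ ij(1)]) simp
    have D: "d = Arc f \<or> d = Orient f i \<or> d = Orient f j"
      using True sk sk' by (intro positive_label(2)[OF lab(4) _ ij(1)]) simp
    have bad: "{Orient f i, Orient f j} \<in> bad_pairs f"
      unfolding ij(1) bad_pairs_doubleton[OF ij(2)] by simp
    have nb: "{a, b} \<notin> bad_pairs f" "{c, d} \<notin> bad_pairs f" using al sk'(2) by (simp_all add: allowed_def)
    have al': "{a, b} \<noteq> {Orient f i, Orient f j}" "{c, d} \<noteq> {Orient f i, Orient f j}"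
      using bad nb by metis+
    \<comment> \<open>The coordinate at i fixes the pair unless it is 0, which arises from twice
      \<open>Arc f\<close> and from the two opposite orientations; the latter are bad.\<close>
    show ?thesis
      using A B C D al' N[of i] ij(2)
      by (elim disjE; simp add: ij(1) doubleton_eq_iff)
  qed
  have pos: ?thesis if sk': "skeleton a = (1, f)" "f \<in> A" for f
    using lab(2)
  proof (cases rule: skeleton_label)
    case (1 u)
    have "{b, a} = {d, c}"
      by (rule mixed[OF lab(2,1,4,3) _ _ _ _ _ _ sk'(2)])
        (use al N sk sk' 1 in \<open>simp_all add: allowed_commute add.commute\<close>)
    then show ?thesis by (simp add: insert_commute)
  next
    case (2 f)
    then have "d = Minus f" using sk(2) negative_label[of d f] by simp
    then show ?thesis using 2 bd by simp
  qed (use both[OF sk'] in auto)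
  from lab(1) show ?thesis
  proof (cases rule: skeleton_label)
    case (2 f)
    then have "c = Minus f" using sk(1) negative_label[of c f] by simp
    then show ?thesis using 2 ac by simp
  next
    case (1 u)
    note a = 1
    from lab(2) show ?thesis
    proof (cases rule: skeleton_label)
      case (1 w)
      obtain u' where u': "c = Node u'" using zero_label[of c] sk a by auto
      obtain w' where w': "d = Node w'" using zero_label[of d] sk 1 by auto
      note u' w'
      then show ?thesis using N[of u] N[of w] N[of u'] N[of w'] a 1
        by (auto simp: doubleton_eq_iff of_bool_def split: if_splits)
    next
      case (2 f)
      then have "d = Minus f" using sk(2) negative_label[of d f] by simp
      then show ?thesis using 2 bd by simp
    qed (use mixed[OF lab al] a sk N in auto)
  qed (use pos in auto)
qed

lemma allowed_pair_eq:
  assumes lab: "a \<in> labels" "b \<in> labels" "c \<in> labels" "d \<in> labels" and al: "allowed a b" "allowed c d"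
    and eq: "label_vec a + label_vec b = label_vec c + label_vec d"
  shows "{a, b} = {c, d}"
proof -
  have N: "node_coord a v + node_coord b v = node_coord c v + node_coord d v" for v
  proof -
    have "real_of_int (node_coord a v + node_coord b v) = real_of_int (node_coord c v + node_coord d v)"
      using arg_cong[OF eq, of "\<lambda>x. lookup x (Inl v)"] lab by (simp add: lookup_add lookup_label_vec)
    then show ?thesis by (simp only: of_int_eq_iff)
  qed
  have R: "arc_coord a g + arc_coord b g = arc_coord c g + arc_coord d g" for g
  proof -
    have "real_of_int (arc_coord a g + arc_coord b g) = real_of_int (arc_coord c g + arc_coord d g)"
      using arg_cong[OF eq, of "\<lambda>x. lookup x (Inr g)"] lab by (simp add: lookup_add lookup_label_vec)
    then show ?thesis by (simp only: of_int_eq_iff)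
  qed
  have sgn: "fst (skeleton a) \<in> {-1, 0, 1}" "fst (skeleton a) = 0 \<Longrightarrow> snd (skeleton a) = {}" for a :: "'v label"
    by (cases a; simp)+
  have "skeleton a = skeleton c \<and> skeleton b = skeleton d \<or> skeleton a = skeleton d \<and> skeleton b = skeleton c"
    unfolding prod_eq_iff
    using signed_pair_eq[OF sgn(1)[of a] sgn(1)[of b] sgn(1)[of c] sgn(1)[of d],
        of "snd (skeleton a)" "snd (skeleton b)" "snd (skeleton c)" "snd (skeleton d)"]
      allowed_skeleton[OF lab(1,2) al(1)] allowed_skeleton[OF lab(3,4) al(2)] sgn(2) R
    unfolding arc_coord_skeleton by blast
  then show ?thesis
  proof
    assume "skeleton a = skeleton c \<and> skeleton b = skeleton d"
    then show ?thesis using aligned_pair_eq[OF lab al] N by blast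
  next
    assume "skeleton a = skeleton d \<and> skeleton b = skeleton c"
    then have "{a, b} = {d, c}"
      using al N by (intro aligned_pair_eq lab) (simp_all add: allowed_commute add.commute)
    then show ?thesis by (simp add: insert_commute)
  qed
qed

end

section \<open>Counting the sums of two distinct lattice points\<close>

lemma real_choose_two: "real (n choose 2) = real n * (real n - 1) / 2"
proof (induction n)
  case (Suc n)
  have "Suc n choose 2 = n + (n choose 2)" by (simp add: numeral_2_eq_2)
  then show ?case using Suc by (simp add: algebra_simps add_divide_distrib)
qed simp

context arc_set
begin

lemma arc_bad_pairs:
  assumes "f \<in> A"
  obtains i j where "f = {i, j}" "i \<noteq> j" "i \<in> V" "j \<in> V"
    "bad_pairs f = {{Minus f, Arc f}, {Minus f, Orient f i}, {Minus f, Orient f j},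
      {Orient f i, Orient f j}, {Orient f i, Node j}, {Orient f j, Node i}}"
proof -
  obtain i j where ij: "f = {i, j}" "i \<noteq> j" using card_arc[OF assms] unfolding card_2_iff by blast
  have "i \<in> V" "j \<in> V" using ij assms by (auto simp: V_def)
  then show thesis using that[OF ij] bad_pairs_doubleton[OF ij(2)] ij(1) by simp
qed

lemma labels_mem:
  "u \<in> V \<Longrightarrow> Node u \<in> labels" "f \<in> A \<Longrightarrow> Arc f \<in> labels" "f \<in> A \<Longrightarrow> Minus f \<in> labels"
  "f \<in> A \<Longrightarrow> v \<in> f \<Longrightarrow> Orient f v \<in> labels"
  by (auto simp: labels_def V_def)

lemma card_bad_pairs: "f \<in> A \<Longrightarrow> card (bad_pairs f) = 6"
  by (erule arc_bad_pairs) (simp add: doubleton_eq_iff card_insert_if)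

lemma bad_pairs_subset:
  assumes "f \<in> A"
  shows "bad_pairs f \<subseteq> {X. X \<subseteq> labels \<and> card X = 2}"
proof -
  obtain i j where "f = {i, j}" "i \<noteq> j" "i \<in> V" "j \<in> V" and
    bad: "bad_pairs f = {{Minus f, Arc f}, {Minus f, Orient f i}, {Minus f, Orient f j},
      {Orient f i, Orient f j}, {Orient f i, Node j}, {Orient f j, Node i}}"
    using assms by (rule arc_bad_pairs)
  then have "{Minus f, Arc f, Orient f i, Orient f j, Node i, Node j} \<subseteq> labels" "i \<noteq> j"
    using assms labels_mem by auto
  then show ?thesis unfolding bad by auto
qed

text \<open>Every bad pair contains a \<open>Minus\<close> or an \<open>Orient\<close>, from which
  its arc can be read off. This makes the families \<open>bad_pairs f\<close> of different arcs
  disjoint.\<close>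

fun signed_arc :: "'v label \<Rightarrow> 'v set" where
  "signed_arc (Minus f) = f" | "signed_arc (Orient f u) = f" | "signed_arc _ = {}"

lemma signed_arc_bad_pairs:
  assumes "f \<in> A" "X \<in> bad_pairs f"
  shows "\<Union>(signed_arc ` X) = f"
proof -
  obtain i j where bad: "bad_pairs f = {{Minus f, Arc f}, {Minus f, Orient f i}, {Minus f, Orient f j},
      {Orient f i, Orient f j}, {Orient f i, Node j}, {Orient f j, Node i}}"
    using assms(1) by (rule arc_bad_pairs)
  from assms(2)[unfolded bad] show ?thesis by (elim insertE emptyE) simp_all
qed

lemma card_UN_bad_pairs: "card (\<Union>f\<in>A. bad_pairs f) = 6 * card A"
proof -
  have "finite (bad_pairs f)" if "f \<in> A" for f
    using card_bad_pairs[OF that] by (metis card.infinite zero_neq_numeral)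
  moreover have "bad_pairs f \<inter> bad_pairs g = {}" if "f \<in> A" "g \<in> A" "f \<noteq> g" for f g
    using signed_arc_bad_pairs that by blast
  ultimately have "card (\<Union>f\<in>A. bad_pairs f) = (\<Sum>f\<in>A. card (bad_pairs f))"
    using finite_A by (intro card_UN_disjoint) auto
  then show ?thesis using card_bad_pairs by simp
qed

lemma allowed_self: "allowed a a"
proof -
  have "{a, a} \<notin> bad_pairs f" if "f \<in> A" for f
  proof
    assume "{a, a} \<in> bad_pairs f"
    then have "card {a, a} = 2" using bad_pairs_subset[OF that] by blast
    then show False by simp
  qed
  then show ?thesis by (simp add: allowed_def)
qed

text \<open>These are the six relations of the triangle: three bad pairs sum to a double, three to
  the sum of an allowed pair. Discarding bad pairs therefore loses no sum that is not a
  double.\<close>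

lemma bad_pair_sum:
  assumes "f \<in> A" "{a, b} \<in> bad_pairs f" "a \<noteq> b"
  obtains c where "c \<in> labels" "label_vec a + label_vec b = label_vec c + label_vec c"
  | c d where "c \<in> labels" "d \<in> labels" "c \<noteq> d" "allowed c d" "label_vec a + label_vec b = label_vec c + label_vec d"
proof -
  obtain i j where ij: "f = {i, j}" "i \<noteq> j" "i \<in> V" "j \<in> V" and
    bad: "bad_pairs f = {{Minus f, Arc f}, {Minus f, Orient f i}, {Minus f, Orient f j},
      {Orient f i, Orient f j}, {Orient f i, Node j}, {Orient f j, Node i}}"
    using assms(1) by (rule arc_bad_pairs)
  have lab: "Node i \<in> labels" "Node j \<in> labels" "Arc f \<in> labels" using labels_mem ij assms(1) by auto
  have al: "allowed (Node i) (Node j)" "allowed (Node i) (Arc f)" "allowed (Node j) (Arc f)"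
  proof -
    have "{Node i, Node j} \<notin> bad_pairs g" "{Node u, Arc f} \<notin> bad_pairs g" if "g \<in> A" for g u
      by (rule arc_bad_pairs[OF that]; simp add: doubleton_eq_iff)+
    then show "allowed (Node i) (Node j)" "allowed (Node i) (Arc f)" "allowed (Node j) (Arc f)"
      by (simp_all add: allowed_def)
  qed
  have rel: "label_vec (Minus f) + label_vec (Arc f) = label_vec (Node i) + label_vec (Node j)"
    "label_vec (Minus f) + label_vec (Orient f i) = label_vec (Node i) + label_vec (Node i)"
    "label_vec (Minus f) + label_vec (Orient f j) = label_vec (Node j) + label_vec (Node j)"
    "label_vec (Orient f i) + label_vec (Orient f j) = label_vec (Arc f) + label_vec (Arc f)"
    "label_vec (Orient f i) + label_vec (Node j) = label_vec (Node i) + label_vec (Arc f)"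
    "label_vec (Orient f j) + label_vec (Node i) = label_vec (Node j) + label_vec (Arc f)"
    using ij(2) unfolding ij(1) by (simp_all add: label_vec.simps insert_Diff_if)
  have sym: "label_vec a + label_vec b = label_vec c + label_vec d" if "{a, b} = {c, d}" for c d
    using that by (auto simp: doubleton_eq_iff add.commute)
  have "{a, b} = {Minus f, Arc f} \<or> {a, b} = {Minus f, Orient f i} \<or> {a, b} = {Minus f, Orient f j}
    \<or> {a, b} = {Orient f i, Orient f j} \<or> {a, b} = {Orient f i, Node j} \<or> {a, b} = {Orient f j, Node i}"
    using assms(2) unfolding bad by (simp only: insert_iff empty_iff simp_thms)
  then show thesis
  proof (elim disjE)
    assume "{a, b} = {Minus f, Arc f}"
    from sym[OF this] show thesis by (intro that(2)[OF lab(1,2) _ al(1)]) (use rel(1) ij(2) in simp_all)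
  next
    assume "{a, b} = {Minus f, Orient f i}"
    from sym[OF this] show thesis by (intro that(1)[OF lab(1)]) (use rel in simp)
  next
    assume "{a, b} = {Minus f, Orient f j}"
    from sym[OF this] show thesis by (intro that(1)[OF lab(2)]) (use rel in simp)
  next
    assume "{a, b} = {Orient f i, Orient f j}"
    from sym[OF this] show thesis by (intro that(1)[OF lab(3)]) (use rel in simp)
  next
    assume "{a, b} = {Orient f i, Node j}"
    from sym[OF this] show thesis by (intro that(2)[OF lab(1,3) _ al(2)]) (use rel in simp_all)
  next
    assume "{a, b} = {Orient f j, Node i}"
    from sym[OF this] show thesis by (intro that(2)[OF lab(2,3) _ al(3)]) (use rel in simp_all)
  qed
qed

text \<open>The pairs of distinct labels that are not bad correspond bijectively to the sums that
  are not doubles. By \<open>allowed_self\<close>, a double falls under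
  \<open>allowed_pair_eq\<close> too, so it never equals the sum of an allowed pair of distinct
  labels.\<close>

lemma card_sums_distinct_labels:
  defines "L \<equiv> label_vec ` labels"
  shows "real (card ({a + b |a b. a \<in> L \<and> b \<in> L} - {a + a |a. a \<in> L}))
    = real (card labels) * (real (card labels) - 1) / 2 - 6 * real (card A)"
proof -
  define P where "P = {X. X \<subseteq> labels \<and> card X = 2} - (\<Union>f\<in>A. bad_pairs f)"
  have PE: "\<exists>a b. X = {a, b} \<and> a \<noteq> b \<and> a \<in> labels \<and> b \<in> labels \<and> allowed a b \<and> sum label_vec X = label_vec a + label_vec b"
    if "X \<in> P" for X
  proof -
    have X: "card X = 2" "X \<subseteq> labels" "\<forall>f\<in>A. X \<notin> bad_pairs f" using that by (simp_all add: P_def)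
    obtain a b where ab: "X = {a, b}" "a \<noteq> b" using X(1) unfolding card_2_iff by blast
    then show ?thesis using X(2,3) by (intro exI[of _ a] exI[of _ b]) (simp add: allowed_def)
  qed
  have PI: "{a, b} \<in> P" if "a \<in> labels" "b \<in> labels" "a \<noteq> b" "allowed a b" for a b
    using that by (simp add: P_def allowed_def)
  have "bij_betw (sum label_vec) P ({a + b |a b. a \<in> L \<and> b \<in> L} - {a + a |a. a \<in> L})"
    unfolding bij_betw_def
  proof
    show "inj_on (sum label_vec) P"
    proof (rule inj_onI)
      fix X Y assume X: "X \<in> P" and Y: "Y \<in> P" and eq: "sum label_vec X = sum label_vec Y"
      obtain a b where a: "X = {a, b}" "a \<in> labels" "b \<in> labels" "allowed a b" "sum label_vec X = label_vec a + label_vec b"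
        using PE[OF X] by blast
      obtain c d where c: "Y = {c, d}" "c \<in> labels" "d \<in> labels" "allowed c d" "sum label_vec Y = label_vec c + label_vec d"
        using PE[OF Y] by blast
      show "X = Y" unfolding a(1) c(1)
        by (rule allowed_pair_eq[OF a(2,3) c(2,3) a(4) c(4)]) (use a(5) c(5) eq in simp)
    qed
    show "sum label_vec ` P = {a + b |a b. a \<in> L \<and> b \<in> L} - {a + a |a. a \<in> L}"
    proof (intro equalityI subsetI)
      fix y assume "y \<in> sum label_vec ` P"
      then obtain X where X: "X \<in> P" "y = sum label_vec X" by blast
      obtain a b where a: "a \<noteq> b" "a \<in> labels" "b \<in> labels" "allowed a b" "sum label_vec X = label_vec a + label_vec b"
        using PE[OF X(1)] by blast
      have "y \<noteq> label_vec c + label_vec c" if "c \<in> labels" for c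
      proof
        assume "y = label_vec c + label_vec c"
        then have "{a, b} = {c, c}"
          using X(2) a(5) by (intro allowed_pair_eq[OF a(2,3) that that a(4) allowed_self]) simp
        then show False using a(1) by auto
      qed
      then have "y \<notin> {a + a |a. a \<in> L}" unfolding L_def by blast
      moreover have "y \<in> {a + b |a b. a \<in> L \<and> b \<in> L}"
        unfolding L_def using a X(2) by blast
      ultimately show "y \<in> {a + b |a b. a \<in> L \<and> b \<in> L} - {a + a |a. a \<in> L}" by blast
    next
      fix y assume "y \<in> {a + b |a b. a \<in> L \<and> b \<in> L} - {a + a |a. a \<in> L}"
      then obtain a b where a: "y = label_vec a + label_vec b" "a \<in> labels" "b \<in> labels"
        and ny: "\<And>c. c \<in> labels \<Longrightarrow> y \<noteq> label_vec c + label_vec c"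
        unfolding L_def by blast
      have ab: "a \<noteq> b" using ny[OF a(2)] a(1) by auto
      have mem: "label_vec c + label_vec d \<in> sum label_vec ` P"
        if "c \<in> labels" "d \<in> labels" "c \<noteq> d" "allowed c d" for c d
        using PI[OF that] that(3) by (intro image_eqI[of _ _ "{c, d}"]) simp_all
      show "y \<in> sum label_vec ` P"
      proof (cases "allowed a b")
        case True then show ?thesis using mem[OF a(2,3) ab] a(1) by simp
      next
        case False
        then obtain f where "f \<in> A" "{a, b} \<in> bad_pairs f" by (auto simp: allowed_def)
        then show ?thesis
          by (rule bad_pair_sum[OF _ _ ab]) (use ny mem a(1) in auto)
      qed
    qed
  qed
  then have "card ({a + b |a b. a \<in> L \<and> b \<in> L} - {a + a |a. a \<in> L}) = card P"
    by (simp add: bij_betw_same_card)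
  moreover have "real (card P) = real (card labels) * (real (card labels) - 1) / 2 - 6 * real (card A)"
  proof -
    have fin: "finite {X. X \<subseteq> labels \<and> card X = 2}" using finite_labels by simp
    have sub: "(\<Union>f\<in>A. bad_pairs f) \<subseteq> {X. X \<subseteq> labels \<and> card X = 2}" using bad_pairs_subset by blast
    have "card P = card {X. X \<subseteq> labels \<and> card X = 2} - card (\<Union>f\<in>A. bad_pairs f)"
      unfolding P_def by (rule card_Diff_subset[OF finite_subset[OF sub fin] sub])
    moreover have "card (\<Union>f\<in>A. bad_pairs f) \<le> card {X. X \<subseteq> labels \<and> card X = 2}"
      by (rule card_mono[OF fin sub])
    ultimately have "real (card P) = real (card {X. X \<subseteq> labels \<and> card X = 2}) - real (card (\<Union>f\<in>A. bad_pairs f))"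
      by simp
    also have "card {X. X \<subseteq> labels \<and> card X = 2} = card labels choose 2"
      by (rule n_subsets[OF finite_labels])
    also have "real (card labels choose 2) = real (card labels) * (real (card labels) - 1) / 2"
      by (rule real_choose_two)
    finally show ?thesis by (simp add: card_UN_bad_pairs)
  qed
  ultimately show ?thesis by simp
qed

end

lemma face_number_1_cosmological_polytope:
  assumes G: "finite_simple_graph G" and T: "unimodular_triangulation T (cosmological_polytope G)"
  defines "S \<equiv> real (card (\<Union>(arcs G)) + 4 * card (arcs G))"
  shows "real (face_number 1 T) = S * (S - 1) / 2 - 6 * real (card (arcs G))"
proof -
  have arcs: "finite (arcs G)"
    by (rule finite_subset[of _ "Pow (nodes G)"]) (use G in \<open>auto simp: finite_simple_graph_def\<close>)
  interpret arc_set "arcs G"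
    by unfold_locales (use G arcs in \<open>auto simp: finite_simple_graph_def\<close>)
  have eq: "cosmological_polytope G = Q" unfolding Q_def by (rule cosmological_polytope_eq) simp
  interpret unimodular T Q
    by unfold_locales (use T eq in \<open>auto simp: Q_def convex_convex_hull\<close>)
  show ?thesis
    unfolding face_number_1 Q_lattice_points card_sums_distinct_labels card_labels S_def ..
qed

section \<open>Functions of a random subset\<close>

text \<open>The expectation over the random subset of \<open>P\<close> that contains each element
  independently with probability \<open>p\<close>. As a finite sum it raises no questions of
  measurability or integrability.\<close>

definition bexp :: "real \<Rightarrow> 'a set \<Rightarrow> ('a set \<Rightarrow> real) \<Rightarrow> real" where
  "bexp p P F = (\<Sum>A\<in>Pow P. p ^ card A * (1 - p) ^ card (P - A) * F A)"

text \<open>The discrete derivative in direction \<open>e\<close>. Deleting \<open>e\<close> in the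
  second term makes it independent of whether \<open>e\<close> belongs to \<open>A\<close>.\<close>

definition add_one_cost :: "'a \<Rightarrow> ('a set \<Rightarrow> real) \<Rightarrow> 'a set \<Rightarrow> real" where
  "add_one_cost e F A = F (insert e A) - F (A - {e})"

lemma bexp_cong: "(\<And>A. A \<subseteq> P \<Longrightarrow> F A = G A) \<Longrightarrow> bexp p P F = bexp p P G"
  unfolding bexp_def by (intro sum.cong) auto

lemma bexp_add: "bexp p P (\<lambda>A. F A + G A) = bexp p P F + bexp p P G"
  by (simp add: bexp_def distrib_left sum.distrib)

lemma bexp_diff: "bexp p P (\<lambda>A. F A - G A) = bexp p P F - bexp p P G"
  by (simp add: bexp_def right_diff_distrib sum_subtractf)

lemma bexp_cmult: "bexp p P (\<lambda>A. c * F A) = c * bexp p P F"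
  by (simp add: bexp_def sum_distrib_left mult.left_commute)

lemma bexp_minus: "bexp p P (\<lambda>A. - F A) = - bexp p P F"
  using bexp_cmult[of p P "-1" F] by simp

lemma bexp_sum: "bexp p P (\<lambda>A. \<Sum>i\<in>I. F i A) = (\<Sum>i\<in>I. bexp p P (F i))"
  unfolding bexp_def sum_distrib_left by (rule sum.swap)

lemma bexp_insert:
  assumes "finite P" "e \<notin> P"
  shows "bexp p (insert e P) F = p * bexp p P (\<lambda>A. F (insert e A)) + (1 - p) * bexp p P F"
proof -
  have disj: "Pow P \<inter> insert e ` Pow P = {}" using assms(2) by auto
  have inj: "inj_on (insert e) (Pow P)" using assms(2) by (auto intro!: inj_onI)
  have "bexp p (insert e P) F = (\<Sum>A\<in>Pow P. p ^ card A * (1 - p) ^ card (insert e P - A) * F A)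
    + (\<Sum>A\<in>Pow P. p ^ card (insert e A) * (1 - p) ^ card (insert e P - insert e A) * F (insert e A))"
    unfolding bexp_def Pow_insert
    by (subst sum.union_disjoint[OF _ _ disj]) (simp_all add: assms(1) sum.reindex[OF inj] o_def)
  also have "(\<Sum>A\<in>Pow P. p ^ card A * (1 - p) ^ card (insert e P - A) * F A) = (1 - p) * bexp p P F"
    unfolding bexp_def sum_distrib_left
  proof (intro sum.cong refl)
    fix A assume "A \<in> Pow P"
    then have "e \<notin> A" "finite (P - A)" "e \<notin> P - A" using assms by auto
    then have "card (insert e P - A) = Suc (card (P - A))" by (simp add: insert_Diff_if)
    then show "p ^ card A * (1 - p) ^ card (insert e P - A) * F A = (1 - p) * (p ^ card A * (1 - p) ^ card (P - A) * F A)"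
      by simp
  qed
  also have "(\<Sum>A\<in>Pow P. p ^ card (insert e A) * (1 - p) ^ card (insert e P - insert e A) * F (insert e A))
    = p * bexp p P (\<lambda>A. F (insert e A))"
    unfolding bexp_def sum_distrib_left
  proof (intro sum.cong refl)
    fix A assume "A \<in> Pow P"
    then have "e \<notin> A" "finite A" "insert e P - insert e A = P - A" using assms finite_subset by auto
    then show "p ^ card (insert e A) * (1 - p) ^ card (insert e P - insert e A) * F (insert e A)
      = p * (p ^ card A * (1 - p) ^ card (P - A) * F (insert e A))" by simp
  qed
  finally show ?thesis by simp
qed

lemma bexp_empty [simp]: "bexp p {} F = F {}"
  by (simp add: bexp_def)

locale random_subset =
  fixes p :: real and P :: "'a set"
  assumes p: "0 < p" "p < 1" and finite_P: "finite P"
begin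

abbreviation "\<EE> \<equiv> bexp p P"

lemma const [simp]: "\<EE> (\<lambda>_. c) = c"
proof -
  have "bexp p P (\<lambda>_. 1) = 1"
    using finite_P by (induction P rule: finite_induct) (simp_all add: bexp_insert)
  then show ?thesis using bexp_cmult[of p P c "\<lambda>_. 1"] by simp
qed

lemma mono: "(\<And>A. A \<subseteq> P \<Longrightarrow> F A \<le> G A) \<Longrightarrow> \<EE> F \<le> \<EE> G"
  unfolding bexp_def using p by (intro sum_mono mult_left_mono) auto

lemma nonneg: "(\<And>A. A \<subseteq> P \<Longrightarrow> 0 \<le> F A) \<Longrightarrow> 0 \<le> \<EE> F"
  using mono[of "\<lambda>_. 0" F] by simp

lemma abs_le: "\<bar>\<EE> F\<bar> \<le> \<EE> (\<lambda>A. \<bar>F A\<bar>)"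
proof -
  have "\<EE> F \<le> \<EE> (\<lambda>A. \<bar>F A\<bar>)" "\<EE> (\<lambda>A. - F A) \<le> \<EE> (\<lambda>A. \<bar>F A\<bar>)" by (intro mono; simp)+
  then show ?thesis by (simp add: bexp_minus)
qed

lemma Cauchy_Schwarz: "(\<EE> (\<lambda>A. F A * G A))\<^sup>2 \<le> \<EE> (\<lambda>A. (F A)\<^sup>2) * \<EE> (\<lambda>A. (G A)\<^sup>2)"
proof -
  define w where "w A = sqrt (p ^ card A * (1 - p) ^ card (P - A))" for A
  have w: "p ^ card A * (1 - p) ^ card (P - A) = w A * w A" for A
    using p by (simp add: w_def)
  show ?thesis
    using Cauchy_Schwarz_ineq_sum[of "\<lambda>A. w A * F A" "\<lambda>A. w A * G A" "Pow P"]
    unfolding bexp_def w by (simp add: power2_eq_square mult_ac)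
qed

lemma Jensen_sq: "(\<EE> F)\<^sup>2 \<le> \<EE> (\<lambda>A. (F A)\<^sup>2)"
  using Cauchy_Schwarz[of F "\<lambda>_. 1"] by simp

lemma abs_le_sqrt: "\<EE> (\<lambda>A. \<bar>F A\<bar>) \<le> sqrt (\<EE> (\<lambda>A. (F A)\<^sup>2))"
  using Jensen_sq[of "\<lambda>A. \<bar>F A\<bar>"] by (intro real_le_rsqrt) simp

definition "Var F = \<EE> (\<lambda>A. (F A - \<EE> F)\<^sup>2)"

lemma Var_eq: "Var F = \<EE> (\<lambda>A. (F A)\<^sup>2) - (\<EE> F)\<^sup>2"
proof -
  have "Var F = \<EE> (\<lambda>A. (F A)\<^sup>2 - 2 * \<EE> F * F A + (\<EE> F)\<^sup>2)"
    unfolding Var_def by (intro bexp_cong) (simp add: power2_diff)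
  then show ?thesis by (simp add: bexp_add bexp_diff bexp_cmult power2_eq_square)
qed

lemma Var_nonneg: "0 \<le> Var F"
  unfolding Var_def by (rule nonneg) simp

lemma Chebyshev:
  assumes "0 < t"
  shows "\<EE> (\<lambda>A. of_bool (t \<le> \<bar>F A\<bar>)) \<le> \<EE> (\<lambda>A. (F A)\<^sup>2) / t\<^sup>2"
proof -
  have "\<EE> (\<lambda>A. of_bool (t \<le> \<bar>F A\<bar>)) \<le> \<EE> (\<lambda>A. (1 / t\<^sup>2) * (F A)\<^sup>2)"
  proof (rule mono)
    fix A
    show "of_bool (t \<le> \<bar>F A\<bar>) \<le> 1 / t\<^sup>2 * (F A)\<^sup>2"
    proof (cases "t \<le> \<bar>F A\<bar>")
      case True
      then have "t\<^sup>2 \<le> (F A)\<^sup>2" using assms abs_le_square_iff[of t "F A"] by simp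
      then show ?thesis using True assms by simp
    qed simp
  qed
  then show ?thesis unfolding bexp_cmult by simp
qed

lemma split:
  assumes "e \<in> P"
  shows "\<EE> F = p * bexp p (P - {e}) (\<lambda>A. F (insert e A)) + (1 - p) * bexp p (P - {e}) F"
  using bexp_insert[of "P - {e}" e p F] finite_P assms by (simp add: insert_absorb)

text \<open>Integration by parts in one coordinate: conditioning on the presence of \<open>e\<close>
  gives the weight \<open>p (1 - p)\<close> to \<open>F\<close> with \<open>e\<close> and its
  negative to \<open>F\<close> without \<open>e\<close>.\<close>

lemma covariance_formula:
  assumes "e \<in> P"
  shows "\<EE> (\<lambda>A. (of_bool (e \<in> A) - p) * F A) = p * (1 - p) * \<EE> (add_one_cost e F)"
proof -
  let ?B = "bexp p (P - {e})"
  have "?B (\<lambda>A. (of_bool (e \<in> A) - p) * F A) = ?B (\<lambda>A. (- p) * F A)"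
  proof (rule bexp_cong)
    fix A assume "A \<subseteq> P - {e}"
    then have "e \<notin> A" by blast
    then show "(of_bool (e \<in> A) - p) * F A = (- p) * F A" by simp
  qed
  then have L: "\<EE> (\<lambda>A. (of_bool (e \<in> A) - p) * F A) = p * ((1 - p) * ?B (\<lambda>A. F (insert e A))) + (1 - p) * ((- p) * ?B F)"
    unfolding split[OF assms] by (simp only: bexp_cmult insertI1 of_bool_eq)
  have e: "add_one_cost e F (insert e A) = F (insert e A) - F A \<and> add_one_cost e F A = F (insert e A) - F A"
    if "A \<subseteq> P - {e}" for A
  proof -
    have "A - {e} = A" "insert e A - {e} = A" using that by blast+
    then show ?thesis by (simp add: add_one_cost_def)
  qed
  have D: "?B (\<lambda>A. add_one_cost e F (insert e A)) = ?B (\<lambda>A. F (insert e A) - F A)"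
       "?B (add_one_cost e F) = ?B (\<lambda>A. F (insert e A) - F A)"
    by (rule bexp_cong; use e in blast)+
  show ?thesis unfolding L split[OF assms, of "add_one_cost e F"] D bexp_diff
    by (simp add: algebra_simps)
qed

lemma disjoint_prob:
  assumes "B \<subseteq> P"
  shows "\<EE> (\<lambda>A. of_bool (A \<inter> B = {})) = (1 - p) ^ card B"
proof -
  have "bexp p P (\<lambda>A. of_bool (A \<inter> B = {})) = (1 - p) ^ card (B \<inter> P)"
    using finite_P
  proof (induction P rule: finite_induct)
    case (insert e P)
    show ?case
    proof (cases "e \<in> B")
      case True
      then have "bexp p P (\<lambda>A. of_bool (insert e A \<inter> B = {})) = 0" by (simp add: bexp_def)
      moreover have "card (B \<inter> insert e P) = Suc (card (B \<inter> P))" using True insert by simp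
      ultimately show ?thesis using insert by (simp add: bexp_insert)
    next
      case False
      then have "bexp p P (\<lambda>A. of_bool (insert e A \<inter> B = {})) = bexp p P (\<lambda>A. of_bool (A \<inter> B = {}))"
        by (intro bexp_cong) auto
      then show ?thesis using insert False by (simp add: bexp_insert algebra_simps)
    qed
  qed simp
  then show ?thesis using assms by (simp add: Int_absorb2)
qed

end

text \<open>Conditioning on one element splits the variance into the mean conditional variance and
  \<open>p (1 - p)\<close> times the squared difference of the conditional means. Jensen bounds that
  square by the mean square of the add-one cost.\<close>

lemma Efron_Stein:
  assumes "0 < p" "p < 1" "finite P"
  shows "bexp p P (\<lambda>A. (F A)\<^sup>2) - (bexp p P F)\<^sup>2 \<le> p * (1 - p) * (\<Sum>e\<in>P. bexp p P (\<lambda>A. (add_one_cost e F A)\<^sup>2))"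
  using assms(3)
proof (induction P arbitrary: F rule: finite_induct)
  case (insert e P)
  interpret random_subset p P using assms insert by unfold_locales
  let ?F1 = "\<lambda>A. F (insert e A)"
  let ?q = "1 - p"
  let ?S = "\<lambda>F. \<Sum>f\<in>P. \<EE> (\<lambda>A. (add_one_cost f F A)\<^sup>2)"
  have ne: "f \<noteq> e" if "f \<in> P" for f using that insert by auto
  have swap: "add_one_cost f F (insert e A) = add_one_cost f ?F1 A" if "f \<in> P" for f A
    using ne[OF that] by (simp add: add_one_cost_def insert_commute insert_Diff_if)
  have S: "(\<Sum>f\<in>P. bexp p (insert e P) (\<lambda>A. (add_one_cost f F A)\<^sup>2)) = p * ?S ?F1 + ?q * ?S F"
    unfolding bexp_insert[OF insert(1,2)] sum.distrib sum_distrib_left using swap by simp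
  have eD: "\<EE> (\<lambda>A. (add_one_cost e F A)\<^sup>2) = \<EE> (\<lambda>A. (?F1 A - F A)\<^sup>2)"
    "\<EE> (\<lambda>A. (add_one_cost e F (insert e A))\<^sup>2) = \<EE> (\<lambda>A. (?F1 A - F A)\<^sup>2)"
  proof -
    have "add_one_cost e F A = ?F1 A - F A \<and> add_one_cost e F (insert e A) = ?F1 A - F A" if "A \<subseteq> P" for A
    proof -
      have "A - {e} = A" "insert e A - {e} = A" using that insert(2) by blast+
      then show ?thesis by (simp add: add_one_cost_def)
    qed
    then show "\<EE> (\<lambda>A. (add_one_cost e F A)\<^sup>2) = \<EE> (\<lambda>A. (?F1 A - F A)\<^sup>2)"
      "\<EE> (\<lambda>A. (add_one_cost e F (insert e A))\<^sup>2) = \<EE> (\<lambda>A. (?F1 A - F A)\<^sup>2)"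
      by (intro bexp_cong; simp)+
  qed
  have "bexp p (insert e P) (\<lambda>A. (F A)\<^sup>2) - (bexp p (insert e P) F)\<^sup>2
    = p * (\<EE> (\<lambda>A. (?F1 A)\<^sup>2) - (\<EE> ?F1)\<^sup>2) + ?q * (\<EE> (\<lambda>A. (F A)\<^sup>2) - (\<EE> F)\<^sup>2) + p * ?q * (\<EE> ?F1 - \<EE> F)\<^sup>2"
    unfolding bexp_insert[OF insert(1,2)] by (simp add: power2_eq_square algebra_simps)
  also have "\<dots> \<le> p * (p * ?q * ?S ?F1) + ?q * (p * ?q * ?S F) + p * ?q * \<EE> (\<lambda>A. (?F1 A - F A)\<^sup>2)"
    using insert.IH[of ?F1] insert.IH[of F] assms Jensen_sq[of "\<lambda>A. ?F1 A - F A"]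
    by (intro add_mono mult_left_mono) (simp_all add: bexp_diff)
  also have "\<dots> = p * ?q * (\<Sum>f\<in>insert e P. bexp p (insert e P) (\<lambda>A. (add_one_cost f F A)\<^sup>2))"
    using insert(1,2) by (simp add: S bexp_insert[OF insert(1,2), of _ "\<lambda>A. (add_one_cost e F A)\<^sup>2"] eD algebra_simps)
  finally show ?case .
qed simp

section \<open>A Stein kernel for the number of lattice points\<close>

text \<open>
  Revealing the members of \<open>W\<close> in the order given by \<open>idx\<close>, this is the martingale decomposition of
  the event that \<open>A\<close> misses \<open>W\<close>.
\<close>

lemma telescoping_product:
  fixes idx :: "'a \<Rightarrow> nat" and p :: real
  assumes "finite W" "inj_on idx W"
  shows "(\<Sum>e\<in>W. (of_bool (e \<in> A) - p) * (of_bool (A \<inter> {f\<in>W. idx f < idx e} = {}) * (1 - p) ^ card {f\<in>W. idx e < idx f}))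
    = (1 - p) ^ card W - of_bool (A \<inter> W = {})"
  using assms
\<comment> \<open>The ranking induction adds the last element in the order: for the old elements the
  set before them stays, and the set after them gains one element, hence a factor
  \<open>1 - p\<close>.\<close>
proof (induction W rule: finite_ranking_induct[where f = idx])
  case (insert x W)
  show ?case
  proof (cases "x \<in> W")
    case True then show ?thesis using insert by (simp add: insert_absorb)
  next
    case False
    have inj: "inj_on idx W" using insert.prems by (rule inj_on_subset) blast
    have lt: "idx y < idx x" if "y \<in> W" for y
      using insert.hyps(2)[OF that] insert.prems that False by (metis inj_onD insertI1 insertI2 le_neq_implies_less)
    let ?t = "\<lambda>W e. (of_bool (e \<in> A) - p) * (of_bool (A \<inter> {f\<in>W. idx f < idx e} = {}) * (1 - p) ^ card {f\<in>W. idx e < idx f})"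
    have old: "?t (insert x W) e = (1 - p) * ?t W e" if "e \<in> W" for e
    proof -
      have "{f \<in> insert x W. idx f < idx e} = {f \<in> W. idx f < idx e}" using lt[OF that] by auto
      moreover have "{f \<in> insert x W. idx e < idx f} = insert x {f \<in> W. idx e < idx f}" using lt[OF that] by auto
      ultimately show ?thesis using False insert.hyps(1) by simp
    qed
    have new: "?t (insert x W) x = (of_bool (x \<in> A) - p) * of_bool (A \<inter> W = {})"
    proof -
      have *: "{f \<in> insert x W. idx f < idx x} = W" "{f \<in> insert x W. idx x < idx f} = {}"
        using lt by (auto dest: less_asym)
      show ?thesis unfolding * by simp
    qed
    have "(\<Sum>e\<in>insert x W. ?t (insert x W) e) = ?t (insert x W) x + (\<Sum>e\<in>W. ?t (insert x W) e)"
      using insert.hyps(1) False by (rule sum.insert)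
    also have "(\<Sum>e\<in>W. ?t (insert x W) e) = (1 - p) * (\<Sum>e\<in>W. ?t W e)"
      unfolding sum_distrib_left by (intro sum.cong refl old)
    also have "(\<Sum>e\<in>W. ?t W e) = (1 - p) ^ card W - of_bool (A \<inter> W = {})" by (rule insert.IH[OF inj])
    finally have "(\<Sum>e\<in>insert x W. ?t (insert x W) e)
      = (of_bool (x \<in> A) - p) * of_bool (A \<inter> W = {}) + (1 - p) * ((1 - p) ^ card W - of_bool (A \<inter> W = {}))"
      unfolding new .
    also have "\<dots> = (1 - p) ^ card (insert x W) - of_bool (A \<inter> insert x W = {})"
      using False insert.hyps(1) by (cases "x \<in> A"; cases "A \<inter> W = {}") (simp_all add: algebra_simps)
    finally show ?thesis .
  qed
qed simp

text \<open>With \<open>x = j p\<close> this follows from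
  \<open>x\<^sup>2 exp (- x) \<le> 2\<close>.\<close>

lemma sq_mult_power_le:
  fixes p :: real assumes "0 \<le> p" "p \<le> 1"
  shows "(real j * p)\<^sup>2 * (1 - p) ^ j \<le> 2"
proof -
  let ?x = "real j * p"
  have "1 - p \<le> exp (- p)" using exp_ge_add_one_self[of "-p"] by simp
  then have "(1 - p) ^ j \<le> exp (- p) ^ j" using assms by (intro power_mono) auto
  also have "\<dots> = exp (- ?x)" by (simp flip: exp_of_nat_mult)
  finally have q: "(1 - p) ^ j \<le> exp (- ?x)" .
  have "?x\<^sup>2 / 2 \<le> exp ?x" using exp_lower_Taylor_quadratic[of ?x] assms by (smt (verit) mult_nonneg_nonneg of_nat_0_le_iff)
  then have "?x\<^sup>2 * exp (- ?x) \<le> 2" by (simp add: exp_minus field_simps)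
  moreover have "?x\<^sup>2 * (1 - p) ^ j \<le> ?x\<^sup>2 * exp (- ?x)" by (rule mult_left_mono[OF q]) simp
  ultimately show ?thesis by linarith
qed

locale random_arcs = random_subset p P for p and P :: "'v set set" +
  assumes card_arc: "e \<in> P \<Longrightarrow> card e = 2"
begin

definition "star v = {e\<in>P. v \<in> e}"
definition S :: "'v set set \<Rightarrow> real" where "S A = real (card (\<Union>A)) + 4 * real (card A)"
text \<open>An arbitrary order in which the arcs are revealed.\<close>

definition "idx = (SOME h::'v set \<Rightarrow> nat. inj_on h P)"
definition "lower v e = {f\<in>star v. idx f < idx e}"
definition "upper v e = {f\<in>star v. idx e < idx f}"
text \<open>The conditional probability, given the arcs before \<open>e\<close>, that no arc at
  \<open>v\<close> other than \<open>e\<close> is present. Hence \<open>g e\<close> is the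
  conditional mean of \<open>d e\<close>, which is the add-one cost of \<open>S\<close>.\<close>

definition "\<alpha> v e A = of_bool (A \<inter> lower v e = {}) * (1 - p) ^ card (upper v e)"
definition "g e A = 4 + (\<Sum>v\<in>e. \<alpha> v e A)"
definition "d e A = (4::real) + (\<Sum>v\<in>e. of_bool (A \<inter> star v \<subseteq> {e}))"

lemma inj_idx: "inj_on idx P"
proof -
  obtain h :: "'v set \<Rightarrow> nat" where "inj_on h P" using finite_imp_inj_to_nat_seg[OF finite_P] by blast
  then show ?thesis unfolding idx_def by (rule someI[of "\<lambda>h. inj_on h P"])
qed

lemma finite_arc: "e \<in> P \<Longrightarrow> finite e"
  using card_arc by (metis card.infinite zero_neq_numeral)

lemma finite_star: "finite (star v)" unfolding star_def using finite_P by simp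

lemma finite_Union_arcs: "finite (\<Union>P)" using finite_P finite_arc by auto

lemma \<alpha>_bounds: "0 \<le> \<alpha> v e A" "\<alpha> v e A \<le> 1"
  using p by (simp_all add: \<alpha>_def power_le_one)

lemma g_bounds: assumes "e \<in> P" shows "4 \<le> g e A" "g e A \<le> 6"
proof -
  have "(\<Sum>v\<in>e. \<alpha> v e A) \<le> (\<Sum>v\<in>e. 1)" by (intro sum_mono \<alpha>_bounds)
  then show "g e A \<le> 6" using card_arc[OF assms] by (simp add: g_def)
  show "4 \<le> g e A" unfolding g_def by (simp add: sum_nonneg \<alpha>_bounds)
qed

lemma d_bounds: assumes "e \<in> P" shows "4 \<le> d e A" "d e A \<le> 6"
proof -
  have "(\<Sum>v\<in>e. of_bool (A \<inter> star v \<subseteq> {e}) :: real) \<le> (\<Sum>v\<in>e. 1)" by (intro sum_mono) simp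
  then show "d e A \<le> 6" using card_arc[OF assms] by (simp add: d_def)
  show "4 \<le> d e A" unfolding d_def by (simp add: sum_nonneg)
qed

lemma add_one_cost_S:
  assumes "A \<subseteq> P" "e \<in> P"
  shows "add_one_cost e S A = d e A"
proof -
  let ?A = "A - {e}"
  have fin: "finite ?A" "finite (\<Union>?A)" "finite e"
    using assms finite_P finite_arc finite_subset[OF assms(1)] by (auto intro!: finite_Union)
  have "card (insert e A) = Suc (card ?A)" using fin(1) by (metis card_insert_disjoint insert_Diff_single Diff_iff singletonI)
  moreover have U: "\<Union>(insert e A) = \<Union>?A \<union> (e - \<Union>?A)" by auto
  have "card (\<Union>(insert e A)) = card (\<Union>?A) + card (e - \<Union>?A)"
    unfolding U using fin by (intro card_Un_disjoint) auto
  moreover have "real (card (e - \<Union>?A)) = (\<Sum>v\<in>e. of_bool (A \<inter> star v \<subseteq> {e}))"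
  proof -
    have "(\<Sum>v\<in>e. of_bool (A \<inter> star v \<subseteq> {e}) :: real) = (\<Sum>v\<in>e. of_bool (v \<in> e - \<Union>?A))"
      using assms by (intro sum.cong refl arg_cong[of _ _ of_bool]) (auto simp: star_def)
    also have "\<dots> = real (card (e \<inter> {v. v \<in> e - \<Union>?A}))" using fin(3) by (intro sum_of_bool_eq) simp
    also have "e \<inter> {v. v \<in> e - \<Union>?A} = e - \<Union>?A" by blast
    finally show ?thesis by simp
  qed
  ultimately show ?thesis by (simp add: add_one_cost_def S_def d_def)
qed

lemma sum_star: "(\<Sum>v\<in>\<Union>P. \<Sum>e\<in>star v. h v e) = (\<Sum>e\<in>P. \<Sum>v\<in>e. h v e)"
proof -
  have "(\<Sum>v\<in>\<Union>P. \<Sum>e\<in>star v. h v e) = (\<Sum>v\<in>\<Union>P. \<Sum>e | e \<in> P \<and> v \<in> e. h v e)"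
    by (simp add: star_def)
  also have "\<dots> = (\<Sum>e\<in>P. \<Sum>v | v \<in> \<Union>P \<and> v \<in> e. h v e)"
    using finite_Union_arcs finite_P by (rule sum.swap_restrict)
  also have "\<dots> = (\<Sum>e\<in>P. \<Sum>v\<in>e. h v e)"
    by (intro sum.cong) auto
  finally show ?thesis .
qed

lemma covered_eq:
  assumes "A \<subseteq> P"
  shows "(\<Sum>e\<in>star v. (of_bool (e \<in> A) - p) * \<alpha> v e A) = of_bool (v \<in> \<Union>A) - (1 - (1 - p) ^ card (star v))"
proof -
  have "inj_on idx (star v)" using inj_idx by (rule inj_on_subset) (auto simp: star_def)
  then have "(\<Sum>e\<in>star v. (of_bool (e \<in> A) - p) * \<alpha> v e A) = (1 - p) ^ card (star v) - of_bool (A \<inter> star v = {})"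
    unfolding \<alpha>_def lower_def upper_def by (rule telescoping_product[OF finite_star])
  moreover have "v \<in> \<Union>A \<longleftrightarrow> A \<inter> star v \<noteq> {}" using assms by (auto simp: star_def)
  ultimately show ?thesis by (cases "v \<in> \<Union>A") simp_all
qed

text \<open>A discrete Clark-Ocone formula. Each covered node is decomposed by
  \<open>telescoping_product\<close> over its star, and \<open>sum_star\<close> regroups the terms
  by arcs.\<close>

lemma S_decomposition: "\<exists>c. \<forall>A\<subseteq>P. S A = c + (\<Sum>e\<in>P. (of_bool (e \<in> A) - p) * g e A)"
proof (intro exI allI impI)
  fix A assume A: "A \<subseteq> P"
  have "real (card (\<Union>A)) = (\<Sum>v\<in>\<Union>P. of_bool (v \<in> \<Union>A))"
    using finite_Union_arcs A by (simp add: of_bool_def sum.If_cases Int_absorb1 Union_mono del: Union_iff)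
  also have "\<dots> = (\<Sum>v\<in>\<Union>P. (1 - (1 - p) ^ card (star v)) + (\<Sum>e\<in>star v. (of_bool (e \<in> A) - p) * \<alpha> v e A))"
    by (simp add: covered_eq[OF A])
  also have "\<dots> = (\<Sum>v\<in>\<Union>P. 1 - (1 - p) ^ card (star v)) + (\<Sum>e\<in>P. \<Sum>v\<in>e. (of_bool (e \<in> A) - p) * \<alpha> v e A)"
    unfolding sum.distrib sum_star ..
  finally have V: "real (card (\<Union>A)) = (\<Sum>v\<in>\<Union>P. 1 - (1 - p) ^ card (star v)) + (\<Sum>e\<in>P. (of_bool (e \<in> A) - p) * (\<Sum>v\<in>e. \<alpha> v e A))"
    by (simp only: sum_distrib_left)
  have "real (card A) = (\<Sum>e\<in>P. of_bool (e \<in> A))"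
    using finite_P A by (simp add: of_bool_def sum.If_cases Int_absorb1)
  then have "real (card A) = p * real (card P) + (\<Sum>e\<in>P. of_bool (e \<in> A) - p)"
    by (simp add: sum_subtractf)
  then show "S A = ((\<Sum>v\<in>\<Union>P. 1 - (1 - p) ^ card (star v)) + 4 * (p * real (card P))) + (\<Sum>e\<in>P. (of_bool (e \<in> A) - p) * g e A)"
    unfolding S_def V g_def by (simp add: algebra_simps sum.distrib sum_distrib_left sum_subtractf)
qed

lemma \<alpha>_indep: "\<alpha> v e (insert e A) = \<alpha> v e A" "\<alpha> v e (A - {e}) = \<alpha> v e A"
proof -
  have "e \<notin> lower v e" by (simp add: lower_def)
  then have "insert e A \<inter> lower v e = A \<inter> lower v e" "(A - {e}) \<inter> lower v e = A \<inter> lower v e" by auto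
  then show "\<alpha> v e (insert e A) = \<alpha> v e A" "\<alpha> v e (A - {e}) = \<alpha> v e A" by (simp_all add: \<alpha>_def)
qed

lemma g_indep: "g e (insert e A) = g e A" "g e (A - {e}) = g e A"
  by (simp_all add: g_def \<alpha>_indep)

text \<open>As \<open>g e\<close> does not depend on the presence of \<open>e\<close>, applying
  \<open>covariance_formula\<close> to \<open>g e\<close> times \<open>F\<close> puts the discrete
  derivative on \<open>F\<close> alone. The test function 1 identifies the constant of the
  decomposition as the mean.\<close>

lemma Stein_identity:
  "\<EE> (\<lambda>A. (S A - \<EE> S) * F A) = p * (1 - p) * (\<Sum>e\<in>P. \<EE> (\<lambda>A. g e A * add_one_cost e F A))"
proof -
  obtain c where c: "\<And>A. A \<subseteq> P \<Longrightarrow> S A = c + (\<Sum>e\<in>P. (of_bool (e \<in> A) - p) * g e A)"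
    using S_decomposition by blast
  have *: "\<EE> (\<lambda>A. \<Sum>e\<in>P. (of_bool (e \<in> A) - p) * (g e A * F A)) = p * (1 - p) * (\<Sum>e\<in>P. \<EE> (\<lambda>A. g e A * add_one_cost e F A))" for F
  proof -
    have "\<EE> (\<lambda>A. \<Sum>e\<in>P. (of_bool (e \<in> A) - p) * (g e A * F A)) = (\<Sum>e\<in>P. p * (1 - p) * \<EE> (add_one_cost e (\<lambda>A. g e A * F A)))"
      unfolding bexp_sum by (intro sum.cong refl covariance_formula)
    also have "\<dots> = (\<Sum>e\<in>P. p * (1 - p) * \<EE> (\<lambda>A. g e A * add_one_cost e F A))"
      by (intro sum.cong refl arg_cong[where f = "\<lambda>x. _ * x"] bexp_cong) (simp add: add_one_cost_def g_indep algebra_simps)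
    finally show ?thesis by (simp add: sum_distrib_left)
  qed
  have "\<EE> S = \<EE> (\<lambda>A. c + (\<Sum>e\<in>P. (of_bool (e \<in> A) - p) * (g e A * 1)))"
    by (intro bexp_cong) (simp add: c)
  also have "\<dots> = c" unfolding bexp_add *[of "\<lambda>_. 1"] by (simp add: add_one_cost_def)
  finally have "\<EE> S = c" .
  then have "\<EE> (\<lambda>A. (S A - \<EE> S) * F A) = \<EE> (\<lambda>A. \<Sum>e\<in>P. (of_bool (e \<in> A) - p) * (g e A * F A))"
    by (intro bexp_cong) (simp add: c sum_distrib_right mult.assoc)
  then show ?thesis using * by simp
qed

text \<open>The right side of \<open>Stein_identity\<close> for \<open>F = S\<close> before taking
  expectations: a Stein kernel of \<open>S\<close>, up to conditioning on \<open>S\<close>.\<close>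

definition "\<tau> A = p * (1 - p) * (\<Sum>e\<in>P. g e A * d e A)"
text \<open>The variance of the number of arcs, and the scale of all later bounds.\<close>

definition "\<sigma>E2 = real (card P) * p * (1 - p)"

lemma Var_S_eq: "Var S = \<EE> \<tau>"
proof -
  have sq: "(x - m)\<^sup>2 = (x - m) * x - m * (x - m)" for x m :: real
    by (simp add: power2_eq_square algebra_simps)
  have "Var S = \<EE> (\<lambda>A. (S A - \<EE> S) * S A - \<EE> S * (S A - \<EE> S))"
    unfolding Var_def by (rule bexp_cong) (rule sq)
  also have "\<dots> = \<EE> (\<lambda>A. (S A - \<EE> S) * S A)" unfolding bexp_diff bexp_cmult by simp
  also have "\<dots> = p * (1 - p) * (\<Sum>e\<in>P. \<EE> (\<lambda>A. g e A * d e A))"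
    unfolding Stein_identity
    by (intro arg_cong[where f = "\<lambda>x. _ * x"] sum.cong refl bexp_cong) (simp add: add_one_cost_S)
  also have "\<dots> = \<EE> \<tau>" unfolding \<tau>_def[abs_def] bexp_cmult bexp_sum ..
  finally show ?thesis .
qed

lemma \<tau>_bounds: "16 * \<sigma>E2 \<le> \<tau> A" "\<tau> A \<le> 36 * \<sigma>E2"
proof -
  have gd: "16 \<le> g e A * d e A \<and> g e A * d e A \<le> 36" if "e \<in> P" for e
    using mult_mono[of 4 "g e A" 4 "d e A"] mult_mono[of "g e A" 6 "d e A" 6] g_bounds[OF that, of A] d_bounds[OF that, of A]
    by simp
  have "(\<Sum>e\<in>P. 16) \<le> (\<Sum>e\<in>P. g e A * d e A)" using gd by (intro sum_mono) blast
  then have "p * (1 - p) * (\<Sum>e\<in>P. 16) \<le> \<tau> A"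
    unfolding \<tau>_def using p by (intro mult_left_mono) auto
  then show "16 * \<sigma>E2 \<le> \<tau> A" by (simp add: \<sigma>E2_def algebra_simps)
  have "(\<Sum>e\<in>P. g e A * d e A) \<le> (\<Sum>e\<in>P. 36)" using gd by (intro sum_mono) blast
  then have "\<tau> A \<le> p * (1 - p) * (\<Sum>e\<in>P. 36)"
    unfolding \<tau>_def using p by (intro mult_left_mono) auto
  then show "\<tau> A \<le> 36 * \<sigma>E2" by (simp add: \<sigma>E2_def algebra_simps)
qed

lemma Var_S_bounds: "16 * \<sigma>E2 \<le> Var S" "Var S \<le> 36 * \<sigma>E2"
  using mono[of "\<lambda>_. 16 * \<sigma>E2" \<tau>] mono[of \<tau> "\<lambda>_. 36 * \<sigma>E2"] \<tau>_bounds by (simp_all add: Var_S_eq)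

end

section \<open>The variance of the Stein kernel\<close>

context random_arcs
begin

text \<open>The number of arcs at \<open>v\<close> whose contribution to \<open>d\<close> changes with the presence of the arc \<open>a\<close>.\<close>

definition "pivotal v a A = real (card {e \<in> star v - {a}. A \<inter> star v \<subseteq> {e, a}})"

lemma abs_diff_\<alpha>_le:
  "\<bar>\<alpha> v e (insert a A) - \<alpha> v e (A - {a})\<bar> \<le> of_bool (a \<in> star v) * (1 - p) ^ card (upper v e)"
proof (cases "a \<in> star v")
  case True
  then show ?thesis using p by (auto simp: \<alpha>_def)
next
  case False
  then have "a \<notin> lower v e" by (simp add: lower_def)
  then have "insert a A \<inter> lower v e = A \<inter> lower v e" "(A - {a}) \<inter> lower v e = A \<inter> lower v e" by auto
  then show ?thesis using p by (simp add: \<alpha>_def)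
qed

text \<open>By \<open>telescoping_product\<close> at the empty set, the left side is the probability
  that \<open>v\<close> is covered.\<close>

lemma sum_power_upper_le: "p * (\<Sum>e\<in>star v. (1 - p) ^ card (upper v e)) \<le> 1"
proof -
  have "inj_on idx (star v)" using inj_idx by (rule inj_on_subset) (auto simp: star_def)
  from telescoping_product[OF finite_star this, where A = "{}" and p = p]
  have "p * (\<Sum>e\<in>star v. (1 - p) ^ card (upper v e)) = 1 - (1 - p) ^ card (star v)"
    by (simp add: upper_def sum_negf sum_distrib_left)
  then show ?thesis using p by simp
qed

lemma sum_restrict_star:
  assumes "a \<in> P"
  shows "(\<Sum>e\<in>P. \<Sum>v\<in>e. of_bool (a \<in> star v) * h v e) = (\<Sum>v\<in>a. \<Sum>e\<in>star v. h v e :: real)"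
proof -
  have "(\<Sum>e\<in>P. \<Sum>v\<in>e. of_bool (a \<in> star v) * h v e) = (\<Sum>v\<in>\<Union>P. \<Sum>e\<in>star v. of_bool (a \<in> star v) * h v e)"
    by (rule sum_star[symmetric])
  also have "\<dots> = (\<Sum>v\<in>\<Union>P. if v \<in> a then \<Sum>e\<in>star v. h v e else 0)"
    using assms by (intro sum.cong) (auto simp: star_def)
  also have "\<dots> = (\<Sum>v\<in>\<Union>P \<inter> {v. v \<in> a}. \<Sum>e\<in>star v. h v e)"
    using finite_Union_arcs by (simp add: sum.If_cases)
  also have "\<Union>P \<inter> {v. v \<in> a} = a" using assms by auto
  finally show ?thesis .
qed

text \<open>Only arcs sharing an end point with \<open>a\<close> are affected, and after
  multiplication by \<open>p\<close> each of the two end points contributes at most 1.\<close>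

lemma sum_abs_diff_g_le:
  assumes "a \<in> P"
  shows "p * (\<Sum>e\<in>P. \<bar>g e (insert a A) - g e (A - {a})\<bar>) \<le> 2"
proof -
  have "\<bar>g e (insert a A) - g e (A - {a})\<bar> \<le> (\<Sum>v\<in>e. of_bool (a \<in> star v) * (1 - p) ^ card (upper v e))" for e
  proof -
    have "\<bar>g e (insert a A) - g e (A - {a})\<bar> = \<bar>\<Sum>v\<in>e. \<alpha> v e (insert a A) - \<alpha> v e (A - {a})\<bar>"
      by (simp add: g_def sum_subtractf)
    also have "\<dots> \<le> (\<Sum>v\<in>e. \<bar>\<alpha> v e (insert a A) - \<alpha> v e (A - {a})\<bar>)" by (rule sum_abs)
    also have "\<dots> \<le> (\<Sum>v\<in>e. of_bool (a \<in> star v) * (1 - p) ^ card (upper v e))" by (intro sum_mono abs_diff_\<alpha>_le)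
    finally show ?thesis .
  qed
  then have "(\<Sum>e\<in>P. \<bar>g e (insert a A) - g e (A - {a})\<bar>) \<le> (\<Sum>e\<in>P. \<Sum>v\<in>e. of_bool (a \<in> star v) * (1 - p) ^ card (upper v e))"
    by (intro sum_mono)
  also have "\<dots> = (\<Sum>v\<in>a. \<Sum>e\<in>star v. (1 - p) ^ card (upper v e))" by (rule sum_restrict_star[OF assms])
  finally have "p * (\<Sum>e\<in>P. \<bar>g e (insert a A) - g e (A - {a})\<bar>) \<le> p * (\<Sum>v\<in>a. \<Sum>e\<in>star v. (1 - p) ^ card (upper v e))"
    using p by (intro mult_left_mono) auto
  also have "\<dots> = (\<Sum>v\<in>a. p * (\<Sum>e\<in>star v. (1 - p) ^ card (upper v e)))" by (simp add: sum_distrib_left)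
  also have "\<dots> \<le> (\<Sum>v\<in>a. 1)" by (intro sum_mono sum_power_upper_le)
  finally show ?thesis using card_arc[OF assms] by simp
qed

lemma sum_abs_diff_d_le:
  assumes "a \<in> P"
  shows "(\<Sum>e\<in>P. \<bar>d e (insert a A) - d e (A - {a})\<bar>) \<le> (\<Sum>v\<in>a. pivotal v a A)"
proof -
  have "\<bar>d e (insert a A) - d e (A - {a})\<bar> \<le> (\<Sum>v\<in>e. of_bool (a \<in> star v) * of_bool (e \<noteq> a \<and> A \<inter> star v \<subseteq> {e, a}))" for e
  proof -
    have "\<bar>d e (insert a A) - d e (A - {a})\<bar> = \<bar>\<Sum>v\<in>e. (of_bool (insert a A \<inter> star v \<subseteq> {e}) - of_bool ((A - {a}) \<inter> star v \<subseteq> {e}) :: real)\<bar>"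
      by (simp add: d_def sum_subtractf del: sum_of_bool_eq)
    also have "\<dots> \<le> (\<Sum>v\<in>e. \<bar>of_bool (insert a A \<inter> star v \<subseteq> {e}) - of_bool ((A - {a}) \<inter> star v \<subseteq> {e})\<bar>)"
      by (rule sum_abs)
    also have "\<dots> \<le> (\<Sum>v\<in>e. of_bool (a \<in> star v) * of_bool (e \<noteq> a \<and> A \<inter> star v \<subseteq> {e, a}))"
    proof (rule sum_mono)
      fix v
      have 1: "a \<notin> star v \<Longrightarrow> insert a A \<inter> star v = (A - {a}) \<inter> star v" by blast
      have 2: "e = a \<Longrightarrow> insert a A \<inter> star v \<subseteq> {e} \<longleftrightarrow> (A - {a}) \<inter> star v \<subseteq> {e}" by blast
      have 3: "a \<in> star v \<Longrightarrow> insert a A \<inter> star v \<subseteq> {e} \<Longrightarrow> e = a" by blast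
      have 4: "(A - {a}) \<inter> star v \<subseteq> {e} \<Longrightarrow> A \<inter> star v \<subseteq> {e, a}" by blast
      show "\<bar>of_bool (insert a A \<inter> star v \<subseteq> {e}) - of_bool ((A - {a}) \<inter> star v \<subseteq> {e})\<bar>
        \<le> (of_bool (a \<in> star v) * of_bool (e \<noteq> a \<and> A \<inter> star v \<subseteq> {e, a}) :: real)"
        using 1 2 3 4 by (cases "a \<in> star v"; cases "e = a"; cases "insert a A \<inter> star v \<subseteq> {e}"; cases "(A - {a}) \<inter> star v \<subseteq> {e}") simp_all
    qed
    finally show ?thesis .
  qed
  then have "(\<Sum>e\<in>P. \<bar>d e (insert a A) - d e (A - {a})\<bar>) \<le> (\<Sum>e\<in>P. \<Sum>v\<in>e. of_bool (a \<in> star v) * of_bool (e \<noteq> a \<and> A \<inter> star v \<subseteq> {e, a}))"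
    by (intro sum_mono)
  also have "\<dots> = (\<Sum>v\<in>a. \<Sum>e\<in>star v. of_bool (e \<noteq> a \<and> A \<inter> star v \<subseteq> {e, a}))" by (rule sum_restrict_star[OF assms])
  also have "\<dots> = (\<Sum>v\<in>a. pivotal v a A)"
  proof (intro sum.cong refl)
    fix v
    have "star v \<inter> {e. e \<noteq> a \<and> A \<inter> star v \<subseteq> {e, a}} = {e \<in> star v - {a}. A \<inter> star v \<subseteq> {e, a}}" by blast
    then show "(\<Sum>e\<in>star v. of_bool (e \<noteq> a \<and> A \<inter> star v \<subseteq> {e, a})) = pivotal v a A"
      using finite_star by (simp add: pivotal_def)
  qed
  finally show ?thesis .
qed

text \<open>If some arc f other than \<open>a\<close> is present at \<open>v\<close>, only
  \<open>e = f\<close> qualifies. Otherwise all arcs at \<open>v\<close> may, but their absence is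
  unlikely when they are many.\<close>

lemma pivotal_sq_le:
  assumes "A \<subseteq> P"
  shows "(pivotal v a A)\<^sup>2 \<le> (real (card (star v - {a})))\<^sup>2 * of_bool (A \<inter> (star v - {a}) = {}) + 1"
proof (cases "A \<inter> (star v - {a}) = {}")
  case True
  have "card {e \<in> star v - {a}. A \<inter> star v \<subseteq> {e, a}} \<le> card (star v - {a})"
    using finite_star by (intro card_mono) auto
  then have "(pivotal v a A)\<^sup>2 \<le> (real (card (star v - {a})))\<^sup>2"
    unfolding pivotal_def by (intro power_mono) auto
  then show ?thesis using True by simp
next
  case False
  then obtain f where "f \<in> A" "f \<in> star v" "f \<noteq> a" by blast
  then have "{e \<in> star v - {a}. A \<inter> star v \<subseteq> {e, a}} \<subseteq> {f}" by blast
  then have "card {e \<in> star v - {a}. A \<inter> star v \<subseteq> {e, a}} \<le> card {f}" by (rule card_mono[rotated]) simp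
  then have "(pivotal v a A)\<^sup>2 \<le> 1\<^sup>2" unfolding pivotal_def by (intro power_mono) auto
  then show ?thesis using False by simp
qed

text \<open>The bound 3 is 2 from \<open>sq_mult_power_le\<close>, for the absence of all other arcs
  at \<open>v\<close>, plus 1 for the remaining term \<open>p\<^sup>2\<close>.\<close>

lemma pivotal_moment: "\<EE> (\<lambda>A. (p * pivotal v a A)\<^sup>2) \<le> 3"
proof -
  let ?j = "card (star v - {a})"
  have sub: "star v - {a} \<subseteq> P" by (auto simp: star_def)
  have "\<EE> (\<lambda>A. (p * pivotal v a A)\<^sup>2) = p\<^sup>2 * \<EE> (\<lambda>A. (pivotal v a A)\<^sup>2)"
    unfolding power_mult_distrib bexp_cmult ..
  also have "\<dots> \<le> p\<^sup>2 * \<EE> (\<lambda>A. (real ?j)\<^sup>2 * of_bool (A \<inter> (star v - {a}) = {}) + 1)"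
    by (intro mult_left_mono mono pivotal_sq_le) auto
  also have "\<dots> = (real ?j * p)\<^sup>2 * (1 - p) ^ ?j + p\<^sup>2"
    unfolding bexp_add bexp_cmult disjoint_prob[OF sub] const by (simp add: power_mult_distrib algebra_simps)
  also have "\<dots> \<le> 2 + 1"
    using p by (intro add_mono sq_mult_power_le) (auto simp: power_le_one)
  finally show ?thesis by simp
qed

text \<open>The product rule for \<open>g\<close> and \<open>d\<close>, both at most 6; the constant
  12 is 6 times the bound 2 of \<open>sum_abs_diff_g_le\<close>.\<close>

lemma add_one_cost_\<tau>_le:
  assumes "a \<in> P"
  shows "\<bar>add_one_cost a \<tau> A\<bar> \<le> 12 + 6 * (\<Sum>v\<in>a. p * pivotal v a A)"
proof -
  let ?B = "insert a A" and ?C = "A - {a}"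
  have "\<bar>g e ?B * d e ?B - g e ?C * d e ?C\<bar> \<le> 6 * \<bar>g e ?B - g e ?C\<bar> + 6 * \<bar>d e ?B - d e ?C\<bar>" if "e \<in> P" for e
  proof -
    have "g e ?B * d e ?B - g e ?C * d e ?C = d e ?B * (g e ?B - g e ?C) + g e ?C * (d e ?B - d e ?C)"
      by (simp add: algebra_simps)
    then have "\<bar>g e ?B * d e ?B - g e ?C * d e ?C\<bar> \<le> \<bar>d e ?B\<bar> * \<bar>g e ?B - g e ?C\<bar> + \<bar>g e ?C\<bar> * \<bar>d e ?B - d e ?C\<bar>"
      by (metis abs_mult abs_triangle_ineq)
    also have "\<dots> \<le> 6 * \<bar>g e ?B - g e ?C\<bar> + 6 * \<bar>d e ?B - d e ?C\<bar>"
      using g_bounds[OF that, of ?C] d_bounds[OF that, of ?B] by (intro add_mono mult_right_mono) auto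
    finally show ?thesis .
  qed
  then have "(\<Sum>e\<in>P. \<bar>g e ?B * d e ?B - g e ?C * d e ?C\<bar>) \<le> (\<Sum>e\<in>P. 6 * \<bar>g e ?B - g e ?C\<bar> + 6 * \<bar>d e ?B - d e ?C\<bar>)"
    by (rule sum_mono)
  then have "\<bar>\<Sum>e\<in>P. g e ?B * d e ?B - g e ?C * d e ?C\<bar> \<le> (\<Sum>e\<in>P. 6 * \<bar>g e ?B - g e ?C\<bar> + 6 * \<bar>d e ?B - d e ?C\<bar>)"
    by (rule order_trans[OF sum_abs])
  also have "\<dots> = 6 * (\<Sum>e\<in>P. \<bar>g e ?B - g e ?C\<bar>) + 6 * (\<Sum>e\<in>P. \<bar>d e ?B - d e ?C\<bar>)"
    by (simp add: sum.distrib sum_distrib_left)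
  finally have "p * \<bar>\<Sum>e\<in>P. g e ?B * d e ?B - g e ?C * d e ?C\<bar> \<le> p * (6 * (\<Sum>e\<in>P. \<bar>g e ?B - g e ?C\<bar>) + 6 * (\<Sum>e\<in>P. \<bar>d e ?B - d e ?C\<bar>))"
    using p by (intro mult_left_mono) auto
  also have "\<dots> = 6 * (p * (\<Sum>e\<in>P. \<bar>g e ?B - g e ?C\<bar>)) + 6 * (p * (\<Sum>e\<in>P. \<bar>d e ?B - d e ?C\<bar>))"
    by (simp add: algebra_simps)
  also have "\<dots> \<le> 6 * 2 + 6 * (p * (\<Sum>v\<in>a. pivotal v a A))"
    using p sum_abs_diff_g_le[OF assms] sum_abs_diff_d_le[OF assms] by (intro add_mono mult_left_mono) auto
  finally have *: "p * \<bar>\<Sum>e\<in>P. g e ?B * d e ?B - g e ?C * d e ?C\<bar> \<le> 12 + 6 * (\<Sum>v\<in>a. p * pivotal v a A)"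
    by (simp add: sum_distrib_left)
  have "add_one_cost a \<tau> A = (1 - p) * (p * (\<Sum>e\<in>P. g e ?B * d e ?B - g e ?C * d e ?C))"
    by (simp add: add_one_cost_def \<tau>_def sum_subtractf algebra_simps)
  then have "\<bar>add_one_cost a \<tau> A\<bar> = (1 - p) * (p * \<bar>\<Sum>e\<in>P. g e ?B * d e ?B - g e ?C * d e ?C\<bar>)"
    using p by (simp add: abs_mult)
  also have "\<dots> \<le> 1 * (p * \<bar>\<Sum>e\<in>P. g e ?B * d e ?B - g e ?C * d e ?C\<bar>)"
    using p by (intro mult_right_mono) auto
  finally show ?thesis using * by simp
qed

text \<open>Efron-Stein with a bounded second moment per arc:
  \<open>1152 = 288 + 144 (3 + 3)\<close>.\<close>

lemma Var_\<tau>_le: "Var \<tau> \<le> 1152 * \<sigma>E2"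
proof -
  have "\<EE> (\<lambda>A. (add_one_cost a \<tau> A)\<^sup>2) \<le> 1152" if a: "a \<in> P" for a
  proof -
    obtain x y where xy: "a = {x, y}" "x \<noteq> y" using card_arc[OF a] unfolding card_2_iff by blast
    let ?M = "\<lambda>v A. p * pivotal v a A"
    have "\<EE> (\<lambda>A. (add_one_cost a \<tau> A)\<^sup>2) \<le> \<EE> (\<lambda>A. 288 + 144 * ((?M x A)\<^sup>2 + (?M y A)\<^sup>2))"
    proof (rule mono)
      fix A
      have "(add_one_cost a \<tau> A)\<^sup>2 \<le> (12 + 6 * (?M x A + ?M y A))\<^sup>2"
        using power_mono[OF add_one_cost_\<tau>_le[OF a, of A], of 2] xy by simp
      also have "\<dots> \<le> 288 + 144 * ((?M x A)\<^sup>2 + (?M y A)\<^sup>2)"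
      proof -
        have "(12 + 6 * (u + w))\<^sup>2 \<le> 288 + 144 * (u\<^sup>2 + w\<^sup>2)" for u w :: real
        proof -
          have "288 + 144 * (u\<^sup>2 + w\<^sup>2) - (12 + 6 * (u + w))\<^sup>2 = (12 - 6 * (u + w))\<^sup>2 + 72 * (u - w)\<^sup>2"
            by (simp add: power2_eq_square algebra_simps)
          then show ?thesis by (metis add_nonneg_nonneg diff_ge_0_iff_ge mult_nonneg_nonneg zero_le_numeral zero_le_power2)
        qed
        then show ?thesis .
      qed
      finally show "(add_one_cost a \<tau> A)\<^sup>2 \<le> 288 + 144 * ((?M x A)\<^sup>2 + (?M y A)\<^sup>2)" .
    qed
    also have "\<dots> = 288 + 144 * (\<EE> (\<lambda>A. (?M x A)\<^sup>2) + \<EE> (\<lambda>A. (?M y A)\<^sup>2))"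
      unfolding bexp_add bexp_cmult const ..
    also have "\<dots> \<le> 1152" using pivotal_moment[of x a] pivotal_moment[of y a] by simp
    finally show ?thesis .
  qed
  then have "(\<Sum>a\<in>P. \<EE> (\<lambda>A. (add_one_cost a \<tau> A)\<^sup>2)) \<le> (\<Sum>a\<in>P. 1152)" by (rule sum_mono)
  then have "p * (1 - p) * (\<Sum>a\<in>P. \<EE> (\<lambda>A. (add_one_cost a \<tau> A)\<^sup>2)) \<le> p * (1 - p) * (\<Sum>a\<in>P. 1152)"
    using p by (intro mult_left_mono) auto
  then show ?thesis using Efron_Stein[OF p finite_P, of \<tau>] by (simp add: Var_eq \<sigma>E2_def algebra_simps)
qed

end

section \<open>Stein's equation\<close>

abbreviation "\<phi> \<equiv> std_normal_density"

definition "\<Phi> z = measure (density lborel \<phi>) {..z}"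

lemma \<Phi>_cdf: "\<Phi> = cdf std_normal_distribution"
  by (simp add: \<Phi>_def[abs_def] cdf_def[abs_def])

lemma \<phi>_pos: "0 < \<phi> x"
  by (rule normal_density_pos) simp

lemma DERIV_\<phi>: "(\<phi> has_real_derivative - x * \<phi> x) (at x)"
proof -
  let ?c = "1 / sqrt (2 * pi)"
  have "((\<lambda>x. ?c * exp (- x\<^sup>2 / 2)) has_real_derivative - x * (?c * exp (- x\<^sup>2 / 2))) (at x)"
    by (rule derivative_eq_intros refl | simp)+
  then show ?thesis unfolding std_normal_density_def .
qed

lemma continuous_\<phi>: "continuous_on A \<phi>"
  using DERIV_\<phi> by (intro continuous_at_imp_continuous_on ballI) (rule DERIV_isCont)

lemma \<Phi>_diff:
  assumes "a \<le> b"
  shows "\<Phi> b - \<Phi> a = integral {a..b} \<phi>"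
proof -
  interpret real_distribution std_normal_distribution by (rule real_dist_normal_dist)
  have "\<Phi> b - \<Phi> a = measure std_normal_distribution {a<..b}"
    unfolding \<Phi>_cdf using assms by (cases "a = b") (simp_all add: cdf_diff_eq)
  also have "\<dots> = (LINT x|std_normal_distribution. indicator {a<..b} x)" by simp
  also have "\<dots> = (LINT x|lborel. \<phi> x * indicator {a<..b} x)"
    by (subst integral_density) (auto simp: less_imp_le[OF \<phi>_pos])
  also have "\<dots> = (LINT x:{a<..b}|lborel. \<phi> x)"
    unfolding set_lebesgue_integral_def by (simp add: mult.commute)
  also have "\<dots> = integral {a<..b} \<phi>"
  proof (rule set_borel_integral_eq_integral(2))
    have "integrable lborel \<phi>" by simp
    then show "set_integrable lborel {a<..b} \<phi>"
      unfolding set_integrable_def by (rule integrable_mult_indicator[rotated]) simp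
  qed
  also have "\<dots> = integral {a..b} \<phi>"
    by (rule integral_subset_negligible) (auto intro: negligible_subset[of "{a}"])
  finally show ?thesis .
qed

lemma DERIV_\<Phi>: "(\<Phi> has_real_derivative \<phi> x) (at x)"
proof -
  have "((\<lambda>y. integral {x - 1..y} \<phi>) has_real_derivative \<phi> x) (at x within {x - 1..x + 1})"
    by (rule integral_has_real_derivative[OF continuous_\<phi>]) simp
  then have D: "((\<lambda>y. \<Phi> (x - 1) + integral {x - 1..y} \<phi>) has_real_derivative \<phi> x) (at x within {x - 1..x + 1})"
    by (auto intro!: derivative_eq_intros)
  have eq: "\<Phi> y = \<Phi> (x - 1) + integral {x - 1..y} \<phi>" if "y \<in> {x - 1..x + 1}" for y
    using \<Phi>_diff[of "x - 1" y] that by simp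
  have "(\<Phi> has_real_derivative \<phi> x) (at x within {x - 1..x + 1})"
    by (rule has_field_derivative_transform_within[OF D zero_less_one]) (simp, rule eq[symmetric])
  moreover have "at x within {x - 1..x + 1} = at x"
    by (rule at_within_interior) (simp add: interior_atLeastAtMost_real)
  ultimately show ?thesis by simp
qed

lemma \<Phi>_mono: "a \<le> b \<Longrightarrow> \<Phi> a \<le> \<Phi> b"
  and \<Phi>_nonneg: "0 \<le> \<Phi> a" and \<Phi>_le_1: "\<Phi> a \<le> 1"
  and \<Phi>_at_top: "(\<Phi> \<longlongrightarrow> 1) at_top" and \<Phi>_at_bot: "(\<Phi> \<longlongrightarrow> 0) at_bot"
proof -
  interpret real_distribution std_normal_distribution by (rule real_dist_normal_dist)
  show "a \<le> b \<Longrightarrow> \<Phi> a \<le> \<Phi> b" "0 \<le> \<Phi> a" "\<Phi> a \<le> 1" "(\<Phi> \<longlongrightarrow> 1) at_top" "(\<Phi> \<longlongrightarrow> 0) at_bot"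
    unfolding \<Phi>_cdf using cdf_nondecreasing cdf_nonneg cdf_bounded_prob cdf_lim_at_top_prob cdf_lim_at_bot by auto
qed

lemma \<phi>_minus: "\<phi> (- x) = \<phi> x"
  by (simp add: std_normal_density_def)

lemma \<phi>_le_1: "\<phi> x \<le> 1"
proof -
  have "exp (- x\<^sup>2 / 2) \<le> 1" by simp
  also have "1 \<le> sqrt (2 * pi)" using pi_ge_two by (intro real_le_rsqrt) simp
  finally show ?thesis unfolding std_normal_density_def by simp
qed

lemma \<Phi>_minus: "\<Phi> (- x) = 1 - \<Phi> x"
proof -
  let ?h = "\<lambda>x. \<Phi> x + \<Phi> (- x)"
  have "(?h has_real_derivative \<phi> x + \<phi> (- x) * (-1)) (at x)" for x
    by (intro derivative_intros DERIV_chain2[OF DERIV_\<Phi>]) (auto intro!: DERIV_\<Phi> derivative_eq_intros)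
  then have "\<forall>x. (?h has_real_derivative 0) (at x)" by (simp add: \<phi>_minus)
  then have const: "?h y = ?h x" for y by (rule DERIV_isconst_all)
  have "(?h \<longlongrightarrow> 1 + 0) at_top"
    by (intro tendsto_add \<Phi>_at_top filterlim_compose[OF \<Phi>_at_bot] filterlim_uminus_at_bot_at_top)
  moreover have "(?h \<longlongrightarrow> ?h x) at_top"
    by (rule Lim_transform_eventually[OF tendsto_const always_eventually]) (rule allI, rule const[symmetric])
  ultimately have "?h x = 1 + 0" by (intro tendsto_unique[of at_top ?h]) auto
  then show ?thesis by simp
qed

text \<open>The difference of the two sides has derivative \<open>- \<phi> x / x\<^sup>2\<close> and
  tends to 0, so it is positive.\<close>

lemma Mills_ratio:
  assumes "0 < w"
  shows "1 - \<Phi> w \<le> \<phi> w / w"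
proof -
  let ?u = "\<lambda>w. \<phi> w / w - (1 - \<Phi> w)"
  have "0 < ?u w"
  proof (rule DERIV_neg_imp_decreasing_at_top[where f = ?u and b = w and flim = 0])
    fix x assume x: "w \<le> x"
    with assms have x0: "x > 0" by simp
    have "(?u has_real_derivative ((- x * \<phi> x) * x - \<phi> x * 1) / (x * x) - (0 - \<phi> x)) (at x)"
      using x0 by (intro DERIV_diff DERIV_divide DERIV_\<phi> DERIV_\<Phi> DERIV_ident DERIV_const) simp
    moreover have "((- x * \<phi> x) * x - \<phi> x * 1) / (x * x) - (0 - \<phi> x) = - \<phi> x / (x * x)"
      using x0 by (simp add: field_simps)
    moreover have "- \<phi> x / (x * x) < 0" using x0 \<phi>_pos[of x] by simp
    ultimately show "\<exists>y. (?u has_real_derivative y) (at x) \<and> y < 0" by metis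
  next
    have A: "((\<lambda>w. \<phi> w / w) \<longlongrightarrow> 0) at_top"
    proof (rule tendsto_sandwich)
      show "\<forall>\<^sub>F w in at_top. 0 \<le> \<phi> w / w"
        using eventually_gt_at_top[of 0] by eventually_elim (simp add: less_imp_le[OF \<phi>_pos])
      show "\<forall>\<^sub>F w in at_top. \<phi> w / w \<le> 1 / w"
        using eventually_gt_at_top[of 0] by eventually_elim (simp add: divide_right_mono \<phi>_le_1)
      show "((\<lambda>w. 1 / w) \<longlongrightarrow> 0) (at_top :: real filter)"
        by (rule tendsto_divide_0[OF tendsto_const filterlim_at_top_imp_at_infinity[OF filterlim_ident]])
    qed simp
    have B: "((\<lambda>w. 1 - \<Phi> w) \<longlongrightarrow> 1 - 1) at_top" by (intro tendsto_diff tendsto_const \<Phi>_at_top)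
    show "(?u \<longlongrightarrow> 0) at_top" using tendsto_diff[OF A B] by simp
  qed
  then show ?thesis by simp
qed

text \<open>From \<open>2 pi e \<le> 24 < 25\<close>. The reciprocal 5 becomes the bound for
  \<open>stein_f\<close>.\<close>

lemma \<phi>_1_ge: "1 / 5 \<le> \<phi> 1"
proof -
  have "(sqrt (2 * pi) * exp (1 / 2))\<^sup>2 = 2 * pi * exp 1"
    by (simp add: power_mult_distrib flip: exp_double)
  also have "\<dots> \<le> 2 * 4 * 3" using pi_less_4 exp_le by (intro mult_mono) auto
  also have "\<dots> \<le> 5\<^sup>2" by simp
  finally have "sqrt (2 * pi) * exp (1 / 2) \<le> 5" by (rule power2_le_imp_le) simp
  then show ?thesis unfolding std_normal_density_def
    by (simp add: exp_minus field_simps)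
qed

lemma \<phi>_antimono:
  assumes "\<bar>x\<bar> \<le> \<bar>y\<bar>" shows "\<phi> y \<le> \<phi> x"
proof -
  have "x\<^sup>2 \<le> y\<^sup>2" using assms by (simp add: abs_le_square_iff)
  then show ?thesis unfolding std_normal_density_def by (simp add: divide_right_mono)
qed

lemma upper_tail_ratio:
  assumes "0 \<le> w"
  shows "(1 - \<Phi> w) / \<phi> w \<le> 5" "w * ((1 - \<Phi> w) / \<phi> w) \<le> 1"
proof -
  show "w * ((1 - \<Phi> w) / \<phi> w) \<le> 1"
  proof (cases "w = 0")
    case False
    with assms Mills_ratio[of w] show ?thesis using \<phi>_pos[of w] by (simp add: field_simps)
  qed simp
  show "(1 - \<Phi> w) / \<phi> w \<le> 5"
  proof (cases "w \<le> 1")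
    case True
    then have "\<phi> 1 \<le> \<phi> w" using assms by (intro \<phi>_antimono) simp
    then have "1 / 5 \<le> \<phi> w" using \<phi>_1_ge by linarith
    then show ?thesis using \<Phi>_nonneg[of w] \<phi>_pos[of w] by (simp add: divide_le_eq)
  next
    case False
    then have "1 - \<Phi> w \<le> \<phi> w / w" by (intro Mills_ratio) simp
    also have "\<dots> \<le> \<phi> w / 1" using False \<phi>_pos[of w] by (intro divide_left_mono) auto
    finally show ?thesis using \<phi>_pos[of w] by (simp add: divide_le_eq)
  qed
qed

lemma lower_tail_ratio:
  assumes "w \<le> 0"
  shows "\<Phi> w / \<phi> w \<le> 5" "- w * (\<Phi> w / \<phi> w) \<le> 1"
  using upper_tail_ratio[of "- w"] assms by (simp_all add: \<Phi>_minus \<phi>_minus)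

section \<open>The bounded solution of Stein's equation for a half-line\<close>

definition "stein_f z w = (if w \<le> z then \<Phi> w * (1 - \<Phi> z) else \<Phi> z * (1 - \<Phi> w)) / \<phi> w"
text \<open>Defined through Stein's equation, which thus holds also at \<open>w = z\<close>. There
  \<open>stein_f z\<close> has a kink and this value is its left derivative.\<close>

definition "stein_f' z w = w * stein_f z w + of_bool (w \<le> z) - \<Phi> z"

lemma stein_f_nonneg: "0 \<le> stein_f z w"
  using \<Phi>_nonneg \<Phi>_le_1 \<phi>_pos[of w] by (simp add: stein_f_def)

text \<open>By monotonicity of \<open>\<Phi>\<close>, the numerator in either branch is at most both
  tails, so each half-line can use the tail for which Mills' ratio is bounded.\<close>

lemma stein_f_le_tails: "stein_f z w \<le> \<Phi> w / \<phi> w" "stein_f z w \<le> (1 - \<Phi> w) / \<phi> w"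
proof -
  have "\<Phi> w * (1 - \<Phi> z) \<le> \<Phi> w * 1" "\<Phi> w * (1 - \<Phi> z) \<le> 1 * (1 - \<Phi> z)"
    "\<Phi> z * (1 - \<Phi> w) \<le> \<Phi> z * 1" "\<Phi> z * (1 - \<Phi> w) \<le> 1 * (1 - \<Phi> w)"
    using \<Phi>_nonneg \<Phi>_le_1 by (intro mult_left_mono mult_right_mono; simp)+
  then have "(if w \<le> z then \<Phi> w * (1 - \<Phi> z) else \<Phi> z * (1 - \<Phi> w)) \<le> \<Phi> w"
    "(if w \<le> z then \<Phi> w * (1 - \<Phi> z) else \<Phi> z * (1 - \<Phi> w)) \<le> 1 - \<Phi> w"
    using \<Phi>_mono[of w z] \<Phi>_mono[of z w] by (auto split: if_splits)
  then show "stein_f z w \<le> \<Phi> w / \<phi> w" "stein_f z w \<le> (1 - \<Phi> w) / \<phi> w"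
    unfolding stein_f_def using \<phi>_pos[of w] by (intro divide_right_mono; simp)+
qed

lemma stein_f_bound: "\<bar>stein_f z w\<bar> \<le> 5"
  using stein_f_nonneg[of z w] stein_f_le_tails[of z w] upper_tail_ratio(1)[of w] lower_tail_ratio(1)[of w]
  by (cases "0 \<le> w") linarith+

lemma stein_wf_bound: "\<bar>w * stein_f z w\<bar> \<le> 1"
proof (cases "0 \<le> w")
  case True
  then have "w * stein_f z w \<le> w * ((1 - \<Phi> w) / \<phi> w)" using stein_f_le_tails(2) by (intro mult_left_mono)
  then show ?thesis using upper_tail_ratio(2)[OF True] True stein_f_nonneg[of z w] by (simp add: abs_mult)
next
  case False
  then have "- w * stein_f z w \<le> - w * (\<Phi> w / \<phi> w)" using stein_f_le_tails(1) by (intro mult_left_mono) auto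
  then show ?thesis using lower_tail_ratio(2)[of w] False stein_f_nonneg[of z w] by (simp add: abs_mult)
qed

lemma stein_f'_bound: "\<bar>stein_f' z w\<bar> \<le> 2"
  using stein_wf_bound[of w z] \<Phi>_nonneg[of z] \<Phi>_le_1[of z] unfolding stein_f'_def by (cases "w \<le> z") auto

lemma DERIV_lower: "((\<lambda>w. \<Phi> w * (1 - \<Phi> z) / \<phi> w) has_real_derivative w * (\<Phi> w * (1 - \<Phi> z) / \<phi> w) + 1 - \<Phi> z) (at w)"
  and DERIV_upper: "((\<lambda>w. \<Phi> z * (1 - \<Phi> w) / \<phi> w) has_real_derivative w * (\<Phi> z * (1 - \<Phi> w) / \<phi> w) - \<Phi> z) (at w)"
proof -
  have [simp]: "\<phi> w \<noteq> 0" using \<phi>_pos[of w] by simp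
  have "((\<lambda>w. \<Phi> w * (1 - \<Phi> z) / \<phi> w) has_real_derivative
      ((\<phi> w * (1 - \<Phi> z)) * \<phi> w - \<Phi> w * (1 - \<Phi> z) * (- w * \<phi> w)) / (\<phi> w * \<phi> w)) (at w)"
    by (intro DERIV_divide DERIV_cmult_right DERIV_\<Phi> DERIV_\<phi>) simp
  then show "((\<lambda>w. \<Phi> w * (1 - \<Phi> z) / \<phi> w) has_real_derivative w * (\<Phi> w * (1 - \<Phi> z) / \<phi> w) + 1 - \<Phi> z) (at w)"
    by (rule DERIV_cong) (simp add: field_simps)
  have "((\<lambda>w. \<Phi> z * (1 - \<Phi> w) / \<phi> w) has_real_derivative
      ((\<Phi> z * (0 - \<phi> w)) * \<phi> w - \<Phi> z * (1 - \<Phi> w) * (- w * \<phi> w)) / (\<phi> w * \<phi> w)) (at w)"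
    by (intro DERIV_divide DERIV_cmult DERIV_diff DERIV_const DERIV_\<Phi> DERIV_\<phi>) simp
  then show "((\<lambda>w. \<Phi> z * (1 - \<Phi> w) / \<phi> w) has_real_derivative w * (\<Phi> z * (1 - \<Phi> w) / \<phi> w) - \<Phi> z) (at w)"
    by (rule DERIV_cong) (simp add: field_simps)
qed

lemma DERIV_stein_f:
  assumes "w \<noteq> z"
  shows "(stein_f z has_real_derivative stein_f' z w) (at w)"
proof (cases "w < z")
  case True
  have "(stein_f z has_real_derivative w * (\<Phi> w * (1 - \<Phi> z) / \<phi> w) + 1 - \<Phi> z) (at w)"
    by (rule has_field_derivative_transform_within_open[OF DERIV_lower, of "{..<z}"]) (use True in \<open>auto simp: stein_f_def\<close>)
  then show ?thesis using True by (simp add: stein_f'_def stein_f_def)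
next
  case False
  have "(stein_f z has_real_derivative w * (\<Phi> z * (1 - \<Phi> w) / \<phi> w) - \<Phi> z) (at w)"
    by (rule has_field_derivative_transform_within_open[OF DERIV_upper, of "{z<..}"]) (use False assms in \<open>auto simp: stein_f_def\<close>)
  then show ?thesis using False assms by (simp add: stein_f'_def stein_f_def)
qed

lemma continuous_stein_f: "continuous_on A (stein_f z)"
proof -
  have c: "continuous_on B \<Phi>" for B using DERIV_\<Phi> by (intro continuous_at_imp_continuous_on ballI) (rule DERIV_isCont)
  have "continuous_on ({..z} \<union> {z..}) (\<lambda>w. if w \<le> z then \<Phi> w * (1 - \<Phi> z) / \<phi> w else \<Phi> z * (1 - \<Phi> w) / \<phi> w)"
    using \<phi>_pos by (intro continuous_on_If continuous_intros c continuous_\<phi>) (auto simp: less_imp_neq[OF \<phi>_pos, symmetric])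
  moreover have "{..z} \<union> {z..} = UNIV" by auto
  ultimately have "continuous_on UNIV (\<lambda>w. if w \<le> z then \<Phi> w * (1 - \<Phi> z) / \<phi> w else \<Phi> z * (1 - \<Phi> w) / \<phi> w)" by simp
  moreover have "(\<lambda>w. if w \<le> z then \<Phi> w * (1 - \<Phi> z) / \<phi> w else \<Phi> z * (1 - \<Phi> w) / \<phi> w) = stein_f z"
    by (auto simp: stein_f_def fun_eq_iff)
  ultimately have "continuous_on UNIV (stein_f z)" by (simp only:)
  then show ?thesis by (rule continuous_on_subset) simp
qed

lemma stein_f_MVT:
  assumes "a < b" "z \<notin> {a<..<b}"
  obtains \<xi> where "a < \<xi>" "\<xi> < b" "stein_f z b - stein_f z a = (b - a) * stein_f' z \<xi>"
proof -
  have der: "(stein_f z has_derivative (\<lambda>h. stein_f' z x * h)) (at x)" if "a < x" "x < b" for x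
    using DERIV_stein_f[of x z] assms(2) that by (auto simp: has_field_derivative_def)
  obtain \<xi> where "a < \<xi>" "\<xi> < b" "stein_f z b - stein_f z a = stein_f' z \<xi> * (b - a)"
    by (rule mvt[OF assms(1) continuous_stein_f der])
  then show thesis by (intro that) (simp_all add: mult.commute)
qed

lemma stein_f_Lipschitz: "\<bar>stein_f z b - stein_f z a\<bar> \<le> 2 * \<bar>b - a\<bar>"
proof -
  have *: "\<bar>stein_f z b - stein_f z a\<bar> \<le> 2 * (b - a)" if ab: "a < b" "z \<notin> {a<..<b}" for a b
  proof -
    obtain \<xi> where "stein_f z b - stein_f z a = (b - a) * stein_f' z \<xi>" using stein_f_MVT[OF ab] by blast
    then show ?thesis using stein_f'_bound[of z \<xi>] ab mult_left_mono[of "\<bar>stein_f' z \<xi>\<bar>" 2 "b - a"] by (simp add: abs_mult)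
  qed
  have **: "\<bar>stein_f z b - stein_f z a\<bar> \<le> 2 * (b - a)" if "a < b" for a b
  proof (cases "z \<in> {a<..<b}")
    case True
    then show ?thesis using *[of a z] *[of z b] by simp
  qed (use * that in blast)
  show ?thesis using **[of a b] **[of b a] by (cases a b rule: linorder_cases) auto
qed

text \<open>Away from \<open>z\<close> the derivative at an intermediate point differs from that at
  \<open>c\<close> by \<open>(\<xi> - c) f \<xi> + c (f \<xi> - f c)\<close>, at most
  \<open>h (5 + 2 |c|)\<close>. Near \<open>z\<close> the jump leaves the crude bound
  \<open>2 + 2 = 4\<close>, charged to an indicator whose mean anticoncentration has to
  control.\<close>

lemma stein_f_expansion:
  assumes "\<bar>a - c\<bar> \<le> h" "\<bar>b - c\<bar> \<le> h"
  shows "\<bar>stein_f z b - stein_f z a - (b - a) * stein_f' z c\<bar> \<le> \<bar>b - a\<bar> * (h * (5 + 2 * \<bar>c\<bar>) + 4 * of_bool (\<bar>c - z\<bar> \<le> h))"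
proof (cases "\<bar>c - z\<bar> \<le> h")
  case True
  have "\<bar>stein_f z b - stein_f z a - (b - a) * stein_f' z c\<bar> \<le> 2 * \<bar>b - a\<bar> + \<bar>b - a\<bar> * 2"
    using stein_f_Lipschitz[of z b a] mult_left_mono[OF stein_f'_bound[of z c], of "\<bar>b - a\<bar>"] by (simp add: abs_mult[symmetric])
  also have "\<dots> = \<bar>b - a\<bar> * 4" by simp
  also have "\<dots> \<le> \<bar>b - a\<bar> * (h * (5 + 2 * \<bar>c\<bar>) + 4 * of_bool (\<bar>c - z\<bar> \<le> h))"
    using True assms by (intro mult_left_mono) auto
  finally show ?thesis .
next
  case False
  have *: "\<bar>stein_f z b - stein_f z a - (b - a) * stein_f' z c\<bar> \<le> (b - a) * (h * (5 + 2 * \<bar>c\<bar>))"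
    if ab: "a < b" "\<bar>a - c\<bar> \<le> h" "\<bar>b - c\<bar> \<le> h" for a b
  proof -
    have "z \<notin> {a<..<b}" using False ab by auto
    then obtain \<xi> where \<xi>: "a < \<xi>" "\<xi> < b" "stein_f z b - stein_f z a = (b - a) * stein_f' z \<xi>"
      using stein_f_MVT[OF ab(1)] by blast
    then have h: "\<bar>\<xi> - c\<bar> \<le> h" using ab by auto
    then have "\<xi> \<le> z \<longleftrightarrow> c \<le> z" using False by auto
    then have "stein_f' z \<xi> - stein_f' z c = (\<xi> - c) * stein_f z \<xi> + c * (stein_f z \<xi> - stein_f z c)"
      by (simp add: stein_f'_def algebra_simps)
    then have "\<bar>stein_f' z \<xi> - stein_f' z c\<bar> \<le> \<bar>\<xi> - c\<bar> * \<bar>stein_f z \<xi>\<bar> + \<bar>c\<bar> * \<bar>stein_f z \<xi> - stein_f z c\<bar>"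
      by (metis abs_mult abs_triangle_ineq)
    also have "\<dots> \<le> h * 5 + \<bar>c\<bar> * (2 * h)"
      using h stein_f_bound[of z \<xi>] stein_f_Lipschitz[of z \<xi> c] by (intro add_mono mult_mono) auto
    finally have "\<bar>stein_f' z \<xi> - stein_f' z c\<bar> \<le> h * (5 + 2 * \<bar>c\<bar>)" by (simp add: algebra_simps)
    then have "(b - a) * \<bar>stein_f' z \<xi> - stein_f' z c\<bar> \<le> (b - a) * (h * (5 + 2 * \<bar>c\<bar>))"
      using ab by (intro mult_left_mono) auto
    then show ?thesis using \<xi>(3) ab(1) by (simp add: abs_mult flip: right_diff_distrib)
  qed
  show ?thesis
  proof (cases a b rule: linorder_cases)
    case less then show ?thesis using *[of a b] assms False by simp
  next
    case greater
    have "stein_f z b - stein_f z a - (b - a) * stein_f' z c = - (stein_f z a - stein_f z b - (a - b) * stein_f' z c)"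
      by (simp add: algebra_simps)
    then show ?thesis using *[of b a] assms False greater by simp
  qed simp
qed

section \<open>Normal approximation for the number of lattice points\<close>

context random_arcs
begin

definition "s = \<EE> S"
definition "\<sigma> = sqrt (Var S)"
definition Y :: "'v set set \<Rightarrow> real" where "Y A = (S A - s) / \<sigma>"
text \<open>The reciprocal standard deviation of the number of arcs: the target rate.\<close>

definition "\<rho> = 1 / sqrt \<sigma>E2"

lemma S_near:
  assumes "A \<subseteq> P" "e \<in> P"
  shows "\<bar>S (insert e A) - S A\<bar> \<le> 6" "\<bar>S (A - {e}) - S A\<bar> \<le> 6" "S (insert e A) - S (A - {e}) = d e A"
proof -
  show *: "S (insert e A) - S (A - {e}) = d e A"
    using add_one_cost_S[OF assms] by (simp add: add_one_cost_def)
  show "\<bar>S (insert e A) - S A\<bar> \<le> 6" "\<bar>S (A - {e}) - S A\<bar> \<le> 6"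
    using * d_bounds[OF assms(2), of A] by (cases "e \<in> A"; simp add: insert_absorb)+
qed

lemma \<sigma>E2_nonneg: "0 \<le> \<sigma>E2"
  using p by (simp add: \<sigma>E2_def)

context
  assumes ne: "P \<noteq> {}"
begin

lemma \<sigma>E2_pos: "0 < \<sigma>E2"
  using ne finite_P p by (simp add: \<sigma>E2_def card_gt_0_iff)

lemma \<sigma>_sq: "\<sigma>\<^sup>2 = Var S"
  unfolding \<sigma>_def using Var_nonneg by simp

lemma \<sigma>_bounds: "4 * sqrt \<sigma>E2 \<le> \<sigma>" "\<sigma> \<le> 6 * sqrt \<sigma>E2" "0 < \<sigma>"
proof -
  have "sqrt (16 * \<sigma>E2) \<le> \<sigma>" "\<sigma> \<le> sqrt (36 * \<sigma>E2)"
    unfolding \<sigma>_def using Var_S_bounds by simp_all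
  then show 1: "4 * sqrt \<sigma>E2 \<le> \<sigma>" "\<sigma> \<le> 6 * sqrt \<sigma>E2" by (simp_all add: real_sqrt_mult)
  show "0 < \<sigma>" using 1(1) \<sigma>E2_pos by (smt (verit) real_sqrt_gt_zero)
qed

text \<open>Tested against a truncated identity \<open>c\<close>, the Stein identity has a right
  side of at least \<open>16 \<sigma>E2\<close> times the probability in question, since
  \<open>g\<close> and \<open>d\<close> are at least 4. The left side is at most
  \<open>12 \<sigma> \<le> 72 sqrt \<sigma>E2\<close>.\<close>

lemma anticoncentration: "\<EE> (\<lambda>A. of_bool (\<bar>S A - x\<bar> \<le> 6)) \<le> 9 / 2 * \<rho>"
proof -
  \<comment> \<open>The cut-off is \<open>12 = 6 + 6\<close>: from a point within 6 of
    \<open>x\<close>, toggling one arc moves \<open>S\<close> by at most 6 and stays where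
    \<open>c\<close> has slope 1.\<close>
  define c where "c t = max (-12) (min 12 (t - x))" for t :: real
  have "16 * \<sigma>E2 * \<EE> (\<lambda>A. of_bool (\<bar>S A - x\<bar> \<le> 6))
    = p * (1 - p) * (\<Sum>e\<in>P. \<EE> (\<lambda>A. 16 * of_bool (\<bar>S A - x\<bar> \<le> 6)))"
    unfolding bexp_cmult by (simp add: \<sigma>E2_def)
  also have "\<dots> \<le> p * (1 - p) * (\<Sum>e\<in>P. \<EE> (\<lambda>A. g e A * add_one_cost e (\<lambda>A. c (S A)) A))"
  proof (intro mult_left_mono sum_mono mono)
    fix e A assume A: "e \<in> P" "A \<subseteq> P"
    note near = S_near[OF A(2,1)] and d = d_bounds[OF A(1), of A] and g = g_bounds[OF A(1), of A]
    show "16 * of_bool (\<bar>S A - x\<bar> \<le> 6) \<le> g e A * add_one_cost e (\<lambda>A. c (S A)) A"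
    proof (cases "\<bar>S A - x\<bar> \<le> 6")
      case True
      then have "c (S (insert e A)) = S (insert e A) - x" "c (S (A - {e})) = S (A - {e}) - x"
        using near by (auto simp: c_def)
      then have "add_one_cost e (\<lambda>A. c (S A)) A = d e A" using near(3) by (simp add: add_one_cost_def)
      then show ?thesis using True mult_mono[of 4 "g e A" 4 "d e A"] d g by simp
    next
      case False
      have "c (S (A - {e})) \<le> c (S (insert e A))" using near(3) d by (auto simp: c_def)
      then have "0 \<le> add_one_cost e (\<lambda>A. c (S A)) A" by (simp add: add_one_cost_def)
      then show ?thesis using False g by simp
    qed
  qed (use p in auto)
  also have "\<dots> = \<EE> (\<lambda>A. (S A - s) * c (S A))" unfolding s_def by (rule Stein_identity[symmetric])
  also have "\<dots> \<le> \<EE> (\<lambda>A. 12 * \<bar>S A - s\<bar>)"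
  proof (rule mono)
    fix A
    have "(S A - s) * c (S A) \<le> \<bar>S A - s\<bar> * \<bar>c (S A)\<bar>" by (metis abs_ge_self abs_mult)
    also have "\<dots> \<le> \<bar>S A - s\<bar> * 12" by (intro mult_left_mono) (auto simp: c_def)
    finally show "(S A - s) * c (S A) \<le> 12 * \<bar>S A - s\<bar>" by simp
  qed
  also have "\<dots> \<le> 12 * \<sigma>"
    unfolding bexp_cmult using abs_le_sqrt[of "\<lambda>A. S A - s"] by (simp add: \<sigma>_def Var_def s_def)
  also have "\<dots> \<le> 12 * (6 * sqrt \<sigma>E2)" using \<sigma>_bounds by simp
  finally have "16 * \<sigma>E2 * \<EE> (\<lambda>A. of_bool (\<bar>S A - x\<bar> \<le> 6)) \<le> 72 * sqrt \<sigma>E2" by simp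
  moreover have "(16 * x * r) * r = 16 * (r * r) * x" for x r :: real by (simp only: ac_simps)
  moreover have "sqrt \<sigma>E2 * sqrt \<sigma>E2 = \<sigma>E2" using \<sigma>E2_nonneg by simp
  ultimately have "(16 * \<EE> (\<lambda>A. of_bool (\<bar>S A - x\<bar> \<le> 6)) * sqrt \<sigma>E2) * sqrt \<sigma>E2 \<le> 72 * sqrt \<sigma>E2"
    by (simp only:)
  then have "16 * \<EE> (\<lambda>A. of_bool (\<bar>S A - x\<bar> \<le> 6)) * sqrt \<sigma>E2 \<le> 72"
    by (rule mult_right_le_imp_le) (simp add: \<sigma>E2_pos)
  then show ?thesis using \<sigma>E2_pos by (simp add: \<rho>_def field_simps)
qed

lemma Y_moments: "\<EE> Y = 0" "\<EE> (\<lambda>A. (Y A)\<^sup>2) = 1" "\<EE> (\<lambda>A. \<bar>Y A\<bar>) \<le> 1"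
proof -
  have "\<EE> Y = \<EE> (\<lambda>A. (1 / \<sigma>) * (S A - s))" by (intro bexp_cong) (simp add: Y_def)
  also have "\<dots> = (1 / \<sigma>) * (\<EE> S - s)" unfolding bexp_cmult bexp_diff const ..
  finally show "\<EE> Y = 0" by (simp add: s_def)
  have "\<EE> (\<lambda>A. (Y A)\<^sup>2) = \<EE> (\<lambda>A. (1 / \<sigma>\<^sup>2) * (S A - s)\<^sup>2)"
    by (intro bexp_cong) (simp add: Y_def power_divide)
  also have "\<dots> = (1 / \<sigma>\<^sup>2) * \<sigma>\<^sup>2" unfolding bexp_cmult \<sigma>_sq Var_def s_def ..
  also have "\<dots> = 1" using \<sigma>_bounds(3) by simp
  finally show 2: "\<EE> (\<lambda>A. (Y A)\<^sup>2) = 1" .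
  show "\<EE> (\<lambda>A. \<bar>Y A\<bar>) \<le> 1" using abs_le_sqrt[of Y] 2 by simp
qed

text \<open>By Stein's equation the error is the mean of \<open>f' Y - Y f Y\<close>. Comparing both
  terms with the mean of \<open>\<tau> / \<sigma>\<^sup>2\<close> times \<open>f' Y\<close> leaves a
  linearisation error (\<open>stein_f_expansion\<close> and anticoncentration) and the fluctuation
  of \<open>\<tau>\<close>; \<open>69 = 513/8 + 39/8\<close>.\<close>

lemma Berry_Esseen_S: "\<bar>\<EE> (\<lambda>A. of_bool (Y A \<le> z)) - \<Phi> z\<bar> \<le> 69 * \<rho>"
proof -
  let ?f = "stein_f z" and ?f' = "stein_f' z"
  \<comment> \<open>The largest change of \<open>Y\<close> caused by one arc.\<close>
  define h where "h = 6 / \<sigma>"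
  define B where "B A = h * (5 + 2 * \<bar>Y A\<bar>) + 4 * of_bool (\<bar>Y A - z\<bar> \<le> h)" for A
  have h: "0 < h" using \<sigma>_bounds by (simp add: h_def)
  have B_nonneg: "0 \<le> B A" for A using h by (simp add: B_def)
  have h_le: "h \<le> 3 / 2 * \<rho>"
  proof -
    have "6 / \<sigma> \<le> 6 / (4 * sqrt \<sigma>E2)" using \<sigma>_bounds \<sigma>E2_pos by (intro divide_left_mono) auto
    then show ?thesis by (simp add: h_def \<rho>_def)
  qed
  have eq: "\<EE> (\<lambda>A. of_bool (Y A \<le> z)) - \<Phi> z = \<EE> (\<lambda>A. ?f' (Y A)) - \<EE> (\<lambda>A. Y A * ?f (Y A))"
    unfolding stein_f'_def bexp_add bexp_diff by simp

  have "\<EE> (\<lambda>A. Y A * ?f (Y A)) = (1 / \<sigma>) * \<EE> (\<lambda>A. (S A - s) * ?f (Y A))"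
    unfolding bexp_cmult[symmetric] by (intro bexp_cong) (simp add: Y_def)
  also have "\<dots> = \<EE> (\<lambda>A. p * (1 - p) / \<sigma> * (\<Sum>e\<in>P. g e A * (?f (Y (insert e A)) - ?f (Y (A - {e})))))"
    unfolding s_def Stein_identity bexp_cmult bexp_sum by (simp add: add_one_cost_def)
  finally have Yf: "\<EE> (\<lambda>A. Y A * ?f (Y A)) = \<EE> (\<lambda>A. p * (1 - p) / \<sigma> * (\<Sum>e\<in>P. g e A * (?f (Y (insert e A)) - ?f (Y (A - {e})))))" .

  have "\<bar>\<EE> (\<lambda>A. Y A * ?f (Y A)) - \<EE> (\<lambda>A. \<tau> A / \<sigma>\<^sup>2 * ?f' (Y A))\<bar> \<le> \<EE> (\<lambda>A. \<tau> A / \<sigma>\<^sup>2 * B A)"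
    unfolding Yf bexp_diff[symmetric]
  proof (rule order_trans[OF abs_le], rule mono)
    fix A assume A: "A \<subseteq> P"
    have tm: "\<bar>?f (Y (insert e A)) - ?f (Y (A - {e})) - d e A / \<sigma> * ?f' (Y A)\<bar> \<le> d e A / \<sigma> * B A" if e: "e \<in> P" for e
    proof -
      note near = S_near[OF A e]
      have Ydiff: "Y A1 - Y A2 = (S A1 - S A2) / \<sigma>" for A1 A2
        by (simp add: Y_def diff_divide_distrib)
      have "\<bar>Y (A - {e}) - Y A\<bar> \<le> h" "\<bar>Y (insert e A) - Y A\<bar> \<le> h" "Y (insert e A) - Y (A - {e}) = d e A / \<sigma>"
        unfolding Ydiff h_def using near \<sigma>_bounds(3) by (simp_all add: divide_right_mono)
      then show ?thesis
        using stein_f_expansion[of "Y (A - {e})" "Y A" h "Y (insert e A)" z] d_bounds[OF e, of A] \<sigma>_bounds(3)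
        by (simp add: B_def)
    qed
    have scale: "0 \<le> c \<Longrightarrow> \<bar>x\<bar> \<le> y \<Longrightarrow> \<bar>c * x\<bar> \<le> c * y" for c x y :: real
      by (simp add: abs_mult mult_left_mono)
    let ?D = "\<lambda>e. ?f (Y (insert e A)) - ?f (Y (A - {e}))"
    have \<tau>: "\<tau> A / \<sigma>\<^sup>2 * x = p * (1 - p) / \<sigma> * (\<Sum>e\<in>P. g e A * (d e A / \<sigma> * x))" for x
      unfolding \<tau>_def power2_eq_square sum_distrib_left sum_distrib_right sum_divide_distrib
      by (intro sum.cong) (simp_all add: mult_ac)
    have diff: "p * (1 - p) / \<sigma> * (\<Sum>e\<in>P. g e A * ?D e) - \<tau> A / \<sigma>\<^sup>2 * ?f' (Y A)
      = p * (1 - p) / \<sigma> * (\<Sum>e\<in>P. g e A * (?D e - d e A / \<sigma> * ?f' (Y A)))"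
      unfolding \<tau> by (simp only: right_diff_distrib[symmetric] sum_subtractf[symmetric])
    have "\<bar>p * (1 - p) / \<sigma> * (\<Sum>e\<in>P. g e A * ?D e) - \<tau> A / \<sigma>\<^sup>2 * ?f' (Y A)\<bar> = p * (1 - p) / \<sigma> * \<bar>\<Sum>e\<in>P. g e A * (?D e - d e A / \<sigma> * ?f' (Y A))\<bar>"
      unfolding diff using p \<sigma>_bounds(3) by (simp add: abs_mult)
    also have "\<dots> \<le> p * (1 - p) / \<sigma> * (\<Sum>e\<in>P. g e A * (d e A / \<sigma> * B A))"
    proof (rule mult_left_mono)
      have "\<bar>\<Sum>e\<in>P. g e A * (?D e - d e A / \<sigma> * ?f' (Y A))\<bar> \<le> (\<Sum>e\<in>P. \<bar>g e A * (?D e - d e A / \<sigma> * ?f' (Y A))\<bar>)"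
        by (rule sum_abs)
      also have "\<dots> \<le> (\<Sum>e\<in>P. g e A * (d e A / \<sigma> * B A))"
      proof (rule sum_mono)
        fix e assume e: "e \<in> P"
        have "0 \<le> g e A" using g_bounds(1)[OF e, of A] by simp
        then show "\<bar>g e A * (?D e - d e A / \<sigma> * ?f' (Y A))\<bar> \<le> g e A * (d e A / \<sigma> * B A)"
          by (rule scale[OF _ tm[OF e]])
      qed
      finally show "\<bar>\<Sum>e\<in>P. g e A * (?D e - d e A / \<sigma> * ?f' (Y A))\<bar> \<le> (\<Sum>e\<in>P. g e A * (d e A / \<sigma> * B A))" .
      show "0 \<le> p * (1 - p) / \<sigma>" using p \<sigma>_bounds(3) by simp
    qed
    also have "\<dots> = \<tau> A / \<sigma>\<^sup>2 * B A" by (rule \<tau>[symmetric])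
    finally show "\<bar>p * (1 - p) / \<sigma> * (\<Sum>e\<in>P. g e A * ?D e) - \<tau> A / \<sigma>\<^sup>2 * ?f' (Y A)\<bar> \<le> \<tau> A / \<sigma>\<^sup>2 * B A" .
  qed
  \<comment> \<open>\<open>9/4 = 36/16\<close>, the upper bound for \<open>\<tau>\<close> over the
    lower bound for the variance of \<open>S\<close>.\<close>
  also have "\<dots> \<le> \<EE> (\<lambda>A. 9 / 4 * B A)"
  proof (intro mono mult_right_mono B_nonneg)
    fix A
    have "\<tau> A \<le> 36 * \<sigma>E2" by (rule \<tau>_bounds)
    also have "\<dots> \<le> 9 / 4 * \<sigma>\<^sup>2" using Var_S_bounds(1) \<sigma>_sq by simp
    finally show "\<tau> A / \<sigma>\<^sup>2 \<le> 9 / 4" using \<sigma>_bounds(3) by (simp add: divide_le_eq)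
  qed
  also have "\<dots> = 9 / 4 * (h * (5 + 2 * \<EE> (\<lambda>A. \<bar>Y A\<bar>)) + 4 * \<EE> (\<lambda>A. of_bool (\<bar>Y A - z\<bar> \<le> h)))"
    unfolding B_def bexp_cmult bexp_add const ..
  also have "\<dots> \<le> 9 / 4 * (3 / 2 * \<rho> * (5 + 2 * 1) + 4 * (9 / 2 * \<rho>))"
  proof (intro mult_left_mono add_mono mult_mono h_le)
    have "\<bar>Y A - z\<bar> \<le> h \<longleftrightarrow> \<bar>S A - (s + z * \<sigma>)\<bar> \<le> 6" for A
    proof -
      have "Y A - z = (S A - (s + z * \<sigma>)) / \<sigma>" using \<sigma>_bounds(3) by (simp add: Y_def field_simps)
      then show ?thesis using \<sigma>_bounds(3) by (simp add: h_def divide_le_cancel)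
    qed
    then show "\<EE> (\<lambda>A. of_bool (\<bar>Y A - z\<bar> \<le> h)) \<le> 9 / 2 * \<rho>" using anticoncentration[of "s + z * \<sigma>"] by simp
  qed (use Y_moments(3) h h_le nonneg[of "\<lambda>A. \<bar>Y A\<bar>"] in auto)
  finally have part1: "\<bar>\<EE> (\<lambda>A. Y A * ?f (Y A)) - \<EE> (\<lambda>A. \<tau> A / \<sigma>\<^sup>2 * ?f' (Y A))\<bar> \<le> 513 / 8 * \<rho>" by simp

  have "\<bar>\<EE> (\<lambda>A. ?f' (Y A)) - \<EE> (\<lambda>A. \<tau> A / \<sigma>\<^sup>2 * ?f' (Y A))\<bar> \<le> \<EE> (\<lambda>A. (2 / \<sigma>\<^sup>2) * \<bar>\<tau> A - \<EE> \<tau>\<bar>)"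
    unfolding bexp_diff[symmetric]
  proof (rule order_trans[OF abs_le], rule mono)
    fix A
    have "?f' (Y A) - \<tau> A / \<sigma>\<^sup>2 * ?f' (Y A) = (1 / \<sigma>\<^sup>2) * ?f' (Y A) * (\<EE> \<tau> - \<tau> A)"
      using \<sigma>_bounds(3) unfolding Var_S_eq[symmetric] \<sigma>_sq[symmetric] by (simp add: field_simps)
    then have "\<bar>?f' (Y A) - \<tau> A / \<sigma>\<^sup>2 * ?f' (Y A)\<bar> = (1 / \<sigma>\<^sup>2) * \<bar>?f' (Y A)\<bar> * \<bar>\<tau> A - \<EE> \<tau>\<bar>"
      by (simp add: abs_mult abs_minus_commute)
    also have "\<dots> \<le> (1 / \<sigma>\<^sup>2) * 2 * \<bar>\<tau> A - \<EE> \<tau>\<bar>"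
      by (intro mult_right_mono mult_left_mono stein_f'_bound) auto
    finally show "\<bar>?f' (Y A) - \<tau> A / \<sigma>\<^sup>2 * ?f' (Y A)\<bar> \<le> (2 / \<sigma>\<^sup>2) * \<bar>\<tau> A - \<EE> \<tau>\<bar>" by simp
  qed
  also have "\<dots> \<le> 2 / \<sigma>\<^sup>2 * sqrt (Var \<tau>)"
    unfolding bexp_cmult Var_def by (intro mult_left_mono abs_le_sqrt) simp
  \<comment> \<open>39 is an upper bound for the root of 1152; with it the constants of the two
    parts add up to the integer 69.\<close>
  also have "\<dots> \<le> 2 / (16 * \<sigma>E2) * (39 * sqrt \<sigma>E2)"
  proof (intro mult_mono)
    show "2 / \<sigma>\<^sup>2 \<le> 2 / (16 * \<sigma>E2)" using Var_S_bounds(1) \<sigma>_sq \<sigma>E2_pos by (intro divide_left_mono) auto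
    have "sqrt (Var \<tau>) \<le> sqrt (39\<^sup>2 * \<sigma>E2)" using Var_\<tau>_le \<sigma>E2_nonneg by simp
    then show "sqrt (Var \<tau>) \<le> 39 * sqrt \<sigma>E2" by (simp add: real_sqrt_mult)
  qed (use \<sigma>E2_pos Var_nonneg in auto)
  also have "\<dots> = 39 / 8 * \<rho>"
    using \<sigma>E2_pos by (simp add: \<rho>_def field_simps)
  finally have part2: "\<bar>\<EE> (\<lambda>A. ?f' (Y A)) - \<EE> (\<lambda>A. \<tau> A / \<sigma>\<^sup>2 * ?f' (Y A))\<bar> \<le> 39 / 8 * \<rho>" .
  show ?thesis unfolding eq using part1 part2 by linarith
qed

end

end

section \<open>Normal approximation for the number of edges\<close>

lemma \<Phi>_diff_le:
  assumes "a \<le> b" "\<And>x. a \<le> x \<Longrightarrow> x \<le> b \<Longrightarrow> \<phi> x \<le> M"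
  shows "\<Phi> b - \<Phi> a \<le> (b - a) * M"
proof (cases "a = b")
  case False
  with assms(1) have "a < b" by simp
  then obtain x where "a < x" "x < b" "\<Phi> b - \<Phi> a = (b - a) * \<phi> x"
    using MVT2[of a b \<Phi> \<phi>] DERIV_\<Phi> by auto
  then show ?thesis using assms by (simp add: mult_left_mono)
qed simp

lemma \<phi>_decay: "\<phi> x \<le> 1 / (1 + x\<^sup>2)"
proof -
  have "1 + x\<^sup>2 / 2 \<le> exp (x\<^sup>2 / 2)" by (rule exp_ge_add_one_self)
  moreover have "2 \<le> sqrt (2 * pi)" using pi_ge_two by (intro real_le_rsqrt) simp
  ultimately have "2 * (1 + x\<^sup>2 / 2) \<le> sqrt (2 * pi) * exp (x\<^sup>2 / 2)" by (intro mult_mono) auto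
  then have "1 + x\<^sup>2 \<le> sqrt (2 * pi) * exp (x\<^sup>2 / 2)" by simp
  then have "1 / (sqrt (2 * pi) * exp (x\<^sup>2 / 2)) \<le> 1 / (1 + x\<^sup>2)"
    by (intro divide_left_mono mult_pos_pos add_pos_nonneg) auto
  then show ?thesis by (simp add: std_normal_density_def exp_minus field_simps)
qed

lemma \<Phi>_upper_tail:
  assumes "1 \<le> t" shows "1 - \<Phi> t \<le> 1 / t\<^sup>2"
proof -
  have "1 - \<Phi> t \<le> \<phi> t / t" using assms by (intro Mills_ratio) simp
  also have "\<dots> \<le> \<phi> t / 1" using assms \<phi>_pos[of t] by (intro divide_left_mono) auto
  also have "\<dots> \<le> 1 / (1 + t\<^sup>2)" using \<phi>_decay by simp
  also have "\<dots> \<le> 1 / t\<^sup>2" using assms by (intro divide_left_mono) (auto intro!: mult_pos_pos add_pos_pos)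
  finally show ?thesis .
qed

text \<open>Between \<open>z\<close> and \<open>z r\<close> all points have modulus at least
  \<open>|z| / 2\<close>, so the density there is at most \<open>1 / (1 + z\<^sup>2 / 4)\<close>,
  and \<open>|z| \<le> 1 + z\<^sup>2 / 4\<close> absorbs the length of the segment.\<close>

lemma \<Phi>_scale:
  assumes "1 / 2 \<le> r"
  shows "\<bar>\<Phi> (z * r) - \<Phi> z\<bar> \<le> \<bar>r - 1\<bar>"
proof -
  have dens: "\<phi> x \<le> 1 / (1 + z\<^sup>2 / 4)" if "\<bar>z\<bar> / 2 \<le> \<bar>x\<bar>" for x
  proof -
    have "(\<bar>z\<bar> / 2)\<^sup>2 \<le> \<bar>x\<bar>\<^sup>2" using that by (intro power_mono) auto
    then have "1 + z\<^sup>2 / 4 \<le> 1 + x\<^sup>2" by (simp add: power_divide)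
    then have "1 / (1 + x\<^sup>2) \<le> 1 / (1 + z\<^sup>2 / 4)" by (intro divide_left_mono mult_pos_pos add_pos_nonneg) auto
    with \<phi>_decay[of x] show ?thesis by linarith
  qed
  have between: "\<bar>z\<bar> / 2 \<le> \<bar>x\<bar>" if "min z (z * r) \<le> x" "x \<le> max z (z * r)" for x
  proof (cases "0 \<le> z")
    case True
    then have "z / 2 \<le> z * r" using assms mult_left_mono[of "1/2" r z] by simp
    then show ?thesis using that True by auto
  next
    case False
    then have "z * r \<le> z * (1 / 2)" using assms by (intro mult_left_mono_neg) auto
    moreover have "x \<le> z \<or> x \<le> z * r" using that(2) by (simp only: le_max_iff_disj)
    ultimately have "x \<le> z * (1 / 2)" using False by linarith
    then show ?thesis using False by simp
  qed
  have "\<bar>\<Phi> (z * r) - \<Phi> z\<bar> \<le> \<bar>z * r - z\<bar> * (1 / (1 + z\<^sup>2 / 4))"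
  proof (cases "z \<le> z * r")
    case True
    then have "\<Phi> (z * r) - \<Phi> z \<le> (z * r - z) * (1 / (1 + z\<^sup>2 / 4))"
      by (intro \<Phi>_diff_le dens between) auto
    then show ?thesis using True \<Phi>_mono[OF True] by simp
  next
    case False
    then have "\<Phi> z - \<Phi> (z * r) \<le> (z - z * r) * (1 / (1 + z\<^sup>2 / 4))"
      by (intro \<Phi>_diff_le dens between) auto
    then show ?thesis using False \<Phi>_mono[of "z * r" z] by simp
  qed
  also have "z * r - z = (r - 1) * z" by (simp add: algebra_simps)
  also have "\<bar>(r - 1) * z\<bar> = \<bar>r - 1\<bar> * \<bar>z\<bar>" by (rule abs_mult)
  also have "\<bar>r - 1\<bar> * \<bar>z\<bar> * (1 / (1 + z\<^sup>2 / 4)) = \<bar>r - 1\<bar> * (\<bar>z\<bar> / (1 + z\<^sup>2 / 4))" by simp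
  also have "\<dots> \<le> \<bar>r - 1\<bar> * 1"
  proof (intro mult_left_mono)
    have "0 \<le> (\<bar>z\<bar> / 2 - 1)\<^sup>2" by simp
    then have "\<bar>z\<bar> \<le> 1 + z\<^sup>2 / 4" by (simp add: power2_diff power_divide)
    moreover have "0 < 1 + z\<^sup>2 / 4" by (intro add_pos_nonneg) auto
    ultimately show "\<bar>z\<bar> / (1 + z\<^sup>2 / 4) \<le> 1" by (simp add: divide_le_eq)
  qed simp
  finally show ?thesis by simp
qed

text \<open>The shift \<open>b\<close> is made for \<open>y = t - b\<close> to satisfy
  \<open>y + \<rho> y\<^sup>2 + \<rho> \<le> t\<close>: the hypotheses give
  \<open>b \<le> 3\<close>, hence \<open>y\<^sup>2 \<le> 2 t\<^sup>2 + 18\<close>. Although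
  \<open>b\<close> grows with \<open>t\<^sup>2\<close>, the density on the segment decays at the
  same rate: there \<open>2 t\<^sup>2 + 19 \<le> 4 x\<^sup>2 + 55\<close>.\<close>

lemma \<Phi>_bounded_perturbation:
  assumes "0 \<le> \<rho>" "\<rho> \<le> 1 / 19" "\<rho> * t\<^sup>2 \<le> 1" and b: "b = \<rho> * (2 * t\<^sup>2 + 19)"
  shows "\<Phi> t - \<Phi> (t - b) \<le> 55 * \<rho>" "\<rho> * (t - b)\<^sup>2 + \<rho> \<le> b" "0 \<le> b"
proof -
  show b0: "0 \<le> b" using assms by simp
  have b3: "b \<le> 3" using assms by (simp add: b algebra_simps)
  have sq: "(x + y)\<^sup>2 \<le> 2 * x\<^sup>2 + 2 * y\<^sup>2" for x y :: real
    using zero_le_power2[of "x - y"] by (simp add: power2_eq_square algebra_simps)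
  have "(t - b)\<^sup>2 \<le> 2 * t\<^sup>2 + 2 * b\<^sup>2" using sq[of t "- b"] by simp
  also have "b\<^sup>2 \<le> 3\<^sup>2" using b0 b3 by (intro power_mono)
  finally have "(t - b)\<^sup>2 \<le> 2 * t\<^sup>2 + 18" by simp
  then have "\<rho> * (t - b)\<^sup>2 \<le> \<rho> * (2 * t\<^sup>2 + 18)" using assms by (intro mult_left_mono)
  then show "\<rho> * (t - b)\<^sup>2 + \<rho> \<le> b" by (simp add: b algebra_simps)
  have "\<Phi> t - \<Phi> (t - b) \<le> (t - (t - b)) * (55 / (2 * t\<^sup>2 + 19))"
  proof (rule \<Phi>_diff_le)
    fix x assume x: "t - b \<le> x" "x \<le> t"
    have "t\<^sup>2 \<le> 2 * x\<^sup>2 + 2 * (t - x)\<^sup>2" using sq[of x "t - x"] by simp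
    also have "(t - x)\<^sup>2 \<le> 3\<^sup>2" using x b3 by (intro power_mono) auto
    finally have "t\<^sup>2 \<le> 2 * x\<^sup>2 + 18" by simp
    then have "2 * t\<^sup>2 + 19 \<le> 2 * (2 * x\<^sup>2 + 18) + 19" by simp
    also have "\<dots> \<le> 55 * (1 + x\<^sup>2)"
      using mult_right_mono[of 4 55 "x\<^sup>2"] by (simp add: algebra_simps)
    finally have "2 * t\<^sup>2 + 19 \<le> 55 * (1 + x\<^sup>2)" .
    moreover have pos: "0 < 2 * t\<^sup>2 + 19" "0 < 1 + x\<^sup>2" by (intro add_nonneg_pos add_pos_nonneg; simp)+
    ultimately have "1 / (1 + x\<^sup>2) \<le> 55 / (2 * t\<^sup>2 + 19)" by (simp add: field_simps)
    with \<phi>_decay[of x] show "\<phi> x \<le> 55 / (2 * t\<^sup>2 + 19)" by linarith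
  qed (use b0 in simp)
  also have "\<dots> = 55 * \<rho>"
  proof -
    have "0 < 2 * t\<^sup>2 + 19" by (intro add_nonneg_pos) auto
    then show ?thesis by (simp add: b)
  qed
  finally show "\<Phi> t - \<Phi> (t - b) \<le> 55 * \<rho>" .
qed

section \<open>Mean and variance of the number of edges\<close>

context random_arcs
begin

lemma card_covariance: "\<EE> (\<lambda>A. (real (card A) - real (card P) * p) * F A) = p * (1 - p) * (\<Sum>e\<in>P. \<EE> (add_one_cost e F))"
proof -
  have "\<EE> (\<lambda>A. (real (card A) - real (card P) * p) * F A) = \<EE> (\<lambda>A. \<Sum>e\<in>P. (of_bool (e \<in> A) - p) * F A)"
  proof (rule bexp_cong)
    fix A assume "A \<subseteq> P"
    then have "real (card A) = (\<Sum>e\<in>P. of_bool (e \<in> A))"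
      using finite_P by (simp add: of_bool_def sum.If_cases Int_absorb1)
    then have "real (card A) - real (card P) * p = (\<Sum>e\<in>P. of_bool (e \<in> A) - p)" by (simp add: sum_subtractf)
    then show "(real (card A) - real (card P) * p) * F A = (\<Sum>e\<in>P. (of_bool (e \<in> A) - p) * F A)"
      by (simp only: sum_distrib_right)
  qed
  also have "\<dots> = (\<Sum>e\<in>P. p * (1 - p) * \<EE> (add_one_cost e F))"
    unfolding bexp_sum by (intro sum.cong refl covariance_formula)
  finally show ?thesis by (simp add: sum_distrib_left)
qed

lemma add_one_cost_const: "add_one_cost e (\<lambda>_. c) = (\<lambda>_. 0)"
  by (simp add: fun_eq_iff add_one_cost_def)

lemma expectation_card: "\<EE> (\<lambda>A. real (card A)) = real (card P) * p"
  using card_covariance[of "\<lambda>_. 1"] by (simp add: add_one_cost_const bexp_diff)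

lemma add_one_cost_card:
  assumes "A \<subseteq> P" shows "real (card (insert e A)) - real (card (A - {e})) = 1"
proof -
  have "finite A" using assms finite_P finite_subset by blast
  then have "card (insert e A) = Suc (card (A - {e}))" by (rule card.insert_remove)
  then show ?thesis by simp
qed

lemma Var_card: "\<EE> (\<lambda>A. (real (card A) - real (card P) * p)\<^sup>2) = \<sigma>E2"
proof -
  have "\<EE> (\<lambda>A. (real (card A) - real (card P) * p)\<^sup>2)
    = \<EE> (\<lambda>A. (real (card A) - real (card P) * p) * (real (card A) - real (card P) * p))"
    by (simp add: power2_eq_square)
  also have "\<dots> = p * (1 - p) * (\<Sum>e\<in>P. \<EE> (\<lambda>_. 1))"
    unfolding card_covariance
    by (intro arg_cong[where f = "\<lambda>x. _ * x"] sum.cong refl bexp_cong) (simp add: add_one_cost_def add_one_cost_card)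
  finally show ?thesis by (simp add: \<sigma>E2_def)
qed

definition K :: "'v set set \<Rightarrow> real" where "K A = S A * (S A - 1) / 2 - 6 * real (card A)"

lemma S_bounds:
  assumes "A \<subseteq> P" shows "4 * real (card A) \<le> S A" "S A \<le> 6 * real (card A)"
proof -
  show "4 * real (card A) \<le> S A" by (simp add: S_def)
  have "card (\<Union>A) \<le> (\<Sum>e\<in>A. card e)"
    by (rule card_Union_le_sum_card)
  also have "\<dots> = (\<Sum>e\<in>A. 2)" using assms card_arc by (intro sum.cong) auto
  finally have "real (card (\<Union>A)) \<le> 2 * real (card A)" by simp
  then show "S A \<le> 6 * real (card A)" by (simp add: S_def)
qed

lemma K_bounds:
  assumes "A \<subseteq> P"
  shows "8 * (real (card A))\<^sup>2 - 8 * real (card A) \<le> K A" "K A \<le> 18 * (real (card A))\<^sup>2"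
proof -
  note S = S_bounds[OF assms]
  have "S A * (S A - 1) \<le> S A * S A" using S(1) by (simp add: algebra_simps)
  also have "\<dots> \<le> (6 * real (card A)) * (6 * real (card A))" using S by (intro mult_mono) auto
  finally show "K A \<le> 18 * (real (card A))\<^sup>2" by (simp add: K_def power2_eq_square)
  show "8 * (real (card A))\<^sup>2 - 8 * real (card A) \<le> K A"
  \<comment> \<open>The empty set is treated apart because \<open>4 card A - 1\<close> has to be
    nonnegative for multiplying the inequalities.\<close>
  proof (cases "card A = 0")
    case True then show ?thesis using S by (simp add: K_def)
  next
    case False
    then have "4 * real (card A) * (4 * real (card A) - 1) \<le> S A * (S A - 1)" using S(1) by (intro mult_mono) auto
    then show ?thesis by (simp add: K_def power2_eq_square algebra_simps)
  qed
qed

lemma second_moment_card: "\<EE> (\<lambda>A. (real (card A))\<^sup>2) = \<sigma>E2 + (real (card P) * p)\<^sup>2"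
  using Var_card Var_eq[of "\<lambda>A. real (card A)"] by (simp add: Var_def expectation_card)

lemma expectation_K_bounds:
  "8 * real (card P) * (real (card P) - 1) * p\<^sup>2 \<le> \<EE> K"
  "\<EE> K \<le> 18 * (real (card P) * p + (real (card P) * p)\<^sup>2)"
proof -
  have le: "\<EE> (\<lambda>A. 8 * (real (card A))\<^sup>2 - 8 * real (card A)) \<le> \<EE> K" by (rule mono) (rule K_bounds)
  have "\<EE> (\<lambda>A. 8 * (real (card A))\<^sup>2 - 8 * real (card A)) = 8 * real (card P) * (real (card P) - 1) * p\<^sup>2"
    unfolding bexp_diff bexp_cmult second_moment_card expectation_card \<sigma>E2_def
    by (simp add: power2_eq_square algebra_simps)
  with le show "8 * real (card P) * (real (card P) - 1) * p\<^sup>2 \<le> \<EE> K" by simp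
  have "\<EE> K \<le> \<EE> (\<lambda>A. 18 * (real (card A))\<^sup>2)" by (rule mono) (rule K_bounds)
  also have "\<dots> = 18 * (\<sigma>E2 + (real (card P) * p)\<^sup>2)" unfolding bexp_cmult second_moment_card ..
  also have "\<sigma>E2 \<le> real (card P) * p" using p by (simp add: \<sigma>E2_def mult_left_le)
  finally show "\<EE> K \<le> 18 * (real (card P) * p + (real (card P) * p)\<^sup>2)" by simp
qed

lemma add_one_cost_K:
  assumes "A \<subseteq> P" "e \<in> P"
  shows "16 * (real (card A) - of_bool (e \<in> A)) \<le> add_one_cost e K A"
proof -
  let ?k = "real (card (A - {e}))" and ?S1 = "S (insert e A)" and ?S0 = "S (A - {e})"
  have "finite A" using assms finite_P finite_subset by blast
  then have k: "real (card A) - of_bool (e \<in> A) = ?k"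
    using card.remove[of A e] by (cases "e \<in> A") simp_all
  have d: "4 \<le> ?S1 - ?S0" unfolding S_near(3)[OF assms] by (rule d_bounds(1)[OF assms(2)])
  have S0: "4 * ?k \<le> ?S0" by (rule S_bounds(1)) (use assms in auto)
  have "add_one_cost e K A = (?S1 - ?S0) * (?S1 + ?S0 - 1) / 2 - 6 * (real (card (insert e A)) - ?k)"
    by (simp add: add_one_cost_def K_def field_simps)
  also have "\<dots> = (?S1 - ?S0) * (?S1 + ?S0 - 1) / 2 - 6" by (simp add: add_one_cost_card[OF assms(1)])
  \<comment> \<open>\<open>S1 \<ge> S0 + 4\<close> and \<open>S0 \<ge> 4 k\<close> give
    \<open>S1 + S0 - 1 \<ge> 8 k + 3\<close>; the surplus 6 offsets the six relations of the new arc
    exactly.\<close>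
  also have "\<dots> \<ge> 4 * (8 * ?k + 3) / 2 - 6"
    using d S0 by (intro diff_right_mono divide_right_mono mult_mono) auto
  finally show ?thesis unfolding k by (simp add: add_divide_distrib)
qed

text \<open>Cauchy-Schwarz against the number of arcs. By \<open>card_covariance\<close> and
  \<open>add_one_cost_K\<close> the covariance is at least
  \<open>16 p\<^sup>2 (1 - p) m (m - 1)\<close>; its square is divided by
  \<open>\<sigma>E2 = m p (1 - p)\<close>.\<close>

lemma Var_K_ge: "256 * p ^ 3 * (1 - p) * real (card P) * (real (card P) - 1)\<^sup>2 \<le> Var K"
proof (cases "P = {}")
  case True then show ?thesis using Var_nonneg by simp
next
  case False
  let ?m = "real (card P)"
  have m: "1 \<le> ?m" using False finite_P by (simp add: Suc_le_eq card_gt_0_iff)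
  have pr: "\<EE> (\<lambda>A. of_bool (e \<in> A)) = p" if "e \<in> P" for e
    using covariance_formula[OF that, of "\<lambda>_. 1"] by (simp add: add_one_cost_const bexp_diff)
  have "16 * (?m * p - p) \<le> \<EE> (add_one_cost e K)" if e: "e \<in> P" for e
  proof -
    have "\<EE> (\<lambda>A. 16 * (real (card A) - of_bool (e \<in> A))) \<le> \<EE> (add_one_cost e K)"
      by (rule mono) (rule add_one_cost_K[OF _ e])
    then show ?thesis unfolding bexp_cmult bexp_diff expectation_card pr[OF e] .
  qed
  then have "(\<Sum>e\<in>P. 16 * (?m * p - p)) \<le> (\<Sum>e\<in>P. \<EE> (add_one_cost e K))" by (rule sum_mono)
  then have "p * (1 - p) * (\<Sum>e\<in>P. 16 * (?m * p - p)) \<le> p * (1 - p) * (\<Sum>e\<in>P. \<EE> (add_one_cost e K))"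
    using p by (intro mult_left_mono) auto
  also have "\<dots> = \<EE> (\<lambda>A. (real (card A) - ?m * p) * K A)" by (rule card_covariance[symmetric])
  also have "\<dots> = \<EE> (\<lambda>A. (real (card A) - ?m * p) * (K A - \<EE> K))"
  proof -
    have "\<EE> (\<lambda>A. (real (card A) - ?m * p) * (K A - \<EE> K)) = \<EE> (\<lambda>A. (real (card A) - ?m * p) * K A - \<EE> K * (real (card A) - ?m * p))"
      by (intro bexp_cong) (simp add: algebra_simps)
    then show ?thesis by (simp add: bexp_diff bexp_cmult expectation_card)
  qed
  finally have "16 * p\<^sup>2 * (1 - p) * ?m * (?m - 1) \<le> \<EE> (\<lambda>A. (real (card A) - ?m * p) * (K A - \<EE> K))"
    by (simp add: power2_eq_square algebra_simps)
  then have "(16 * p\<^sup>2 * (1 - p) * ?m * (?m - 1))\<^sup>2 \<le> (\<EE> (\<lambda>A. (real (card A) - ?m * p) * (K A - \<EE> K)))\<^sup>2"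
    using m p by (intro power_mono) auto
  also have "\<dots> \<le> \<sigma>E2 * Var K"
    using Cauchy_Schwarz[of "\<lambda>A. real (card A) - ?m * p" "\<lambda>A. K A - \<EE> K"] by (simp add: Var_card Var_def)
  finally have "(16 * p\<^sup>2 * (1 - p) * ?m * (?m - 1))\<^sup>2 \<le> \<sigma>E2 * Var K" .
  moreover have "(16 * p\<^sup>2 * q * m * n)\<^sup>2 = (m * p * q) * (256 * p ^ 3 * q * m * n\<^sup>2)" for q m n :: real
    by (simp add: power2_eq_square power3_eq_cube)
  ultimately have "\<sigma>E2 * (256 * p ^ 3 * (1 - p) * ?m * (?m - 1)\<^sup>2) \<le> \<sigma>E2 * Var K"
    unfolding \<sigma>E2_def by (simp only:)
  moreover have "0 < \<sigma>E2" using False by (rule \<sigma>E2_pos)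
  ultimately show ?thesis by simp
qed

lemma add_one_cost_sq_S:
  assumes "A \<subseteq> P" "e \<in> P"
  shows "(add_one_cost e (\<lambda>A. (S A - s)\<^sup>2) A)\<^sup>2 \<le> 288 * (S A - s)\<^sup>2 + 10368"
proof -
  let ?S1 = "S (insert e A)" and ?S0 = "S (A - {e})"
  note near = S_near[OF assms] and d = d_bounds[OF assms(2), of A]
  have "add_one_cost e (\<lambda>A. (S A - s)\<^sup>2) A = d e A * ((?S1 - s) + (?S0 - s))"
    unfolding near(3)[symmetric] by (simp add: add_one_cost_def power2_eq_square algebra_simps)
  then have "\<bar>add_one_cost e (\<lambda>A. (S A - s)\<^sup>2) A\<bar> = d e A * \<bar>(?S1 - s) + (?S0 - s)\<bar>"
    using d by (simp add: abs_mult)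
  also have "\<dots> \<le> 6 * (2 * \<bar>S A - s\<bar> + 12)"
  proof (rule mult_mono)
    show "\<bar>(?S1 - s) + (?S0 - s)\<bar> \<le> 2 * \<bar>S A - s\<bar> + 12" using near(1,2) by (smt (verit))
  qed (use d in simp_all)
  finally have "\<bar>add_one_cost e (\<lambda>A. (S A - s)\<^sup>2) A\<bar>\<^sup>2 \<le> (6 * (2 * \<bar>S A - s\<bar> + 12))\<^sup>2"
    by (intro power_mono) auto
  also have "\<dots> \<le> 288 * \<bar>S A - s\<bar>\<^sup>2 + 10368"
  proof -
    have "288 * x\<^sup>2 + 10368 - (6 * (2 * x + 12))\<^sup>2 = 36 * (2 * x - 12)\<^sup>2" for x :: real
      by (simp add: power2_eq_square algebra_simps)
    then show ?thesis by (metis diff_ge_0_iff_ge mult_nonneg_nonneg zero_le_numeral zero_le_power2)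
  qed
  finally show ?thesis by simp
qed

section \<open>The edge count as a quadratic perturbation of the normalised lattice point
  count\<close>

context
  assumes large: "1 \<le> \<sigma>E2"
begin

lemma P_nonempty: "P \<noteq> {}"
  using large by (auto simp: \<sigma>E2_def)

lemmas \<sigma>_bounds' = \<sigma>_bounds[OF P_nonempty] and \<sigma>_sq' = \<sigma>_sq[OF P_nonempty] and Y_moments' = Y_moments[OF P_nonempty]

lemma S_eq: "S A = s + \<sigma> * Y A"
  using \<sigma>_bounds'(3) by (simp add: Y_def)

text \<open>Efron-Stein for the square of \<open>S - s\<close>. As
  \<open>\<sigma>\<^sup>2 \<ge> 16\<close>, the constant 10368 is at most
  \<open>648 \<sigma>\<^sup>2\<close>, and \<open>(288 + 648) / 16 \<le> 60\<close>.\<close>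

lemma Y_fourth_moment: "\<EE> (\<lambda>A. ((Y A)\<^sup>2 - 1)\<^sup>2) \<le> 60"
proof -
  let ?F = "\<lambda>A. (S A - s)\<^sup>2"
  have "Var ?F \<le> p * (1 - p) * (\<Sum>e\<in>P. \<EE> (\<lambda>A. (add_one_cost e ?F A)\<^sup>2))"
    unfolding Var_eq by (rule Efron_Stein[OF p finite_P])
  also have "\<dots> \<le> p * (1 - p) * (\<Sum>e\<in>P. \<EE> (\<lambda>A. 288 * ?F A + 10368))"
    using p by (intro mult_left_mono sum_mono mono add_one_cost_sq_S) auto
  also have "\<dots> = \<sigma>E2 * (288 * \<sigma>\<^sup>2 + 10368)"
    unfolding bexp_add bexp_cmult const \<sigma>_sq' Var_def s_def by (simp add: \<sigma>E2_def)
  also have "\<dots> \<le> \<sigma>\<^sup>2 / 16 * (288 * \<sigma>\<^sup>2 + 648 * \<sigma>\<^sup>2)"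
  proof (intro mult_mono)
    show "\<sigma>E2 \<le> \<sigma>\<^sup>2 / 16" using Var_S_bounds(1) \<sigma>_sq' by simp
    then show "288 * \<sigma>\<^sup>2 + 10368 \<le> 288 * \<sigma>\<^sup>2 + 648 * \<sigma>\<^sup>2" using large by simp
  qed auto
  also have "\<dots> \<le> 60 * (\<sigma>\<^sup>2)\<^sup>2" using \<sigma>_bounds'(3) by (simp add: power2_eq_square)
  finally have V: "Var ?F \<le> 60 * (\<sigma>\<^sup>2)\<^sup>2" .
  have "\<EE> ?F = \<sigma>\<^sup>2" unfolding \<sigma>_sq' Var_def s_def ..
  then have "Var ?F = \<EE> (\<lambda>A. (\<sigma>\<^sup>2)\<^sup>2 * ((Y A)\<^sup>2 - 1)\<^sup>2)"
    unfolding Var_def S_eq by (intro bexp_cong) (simp add: power2_eq_square algebra_simps)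
  with V have "(\<sigma>\<^sup>2)\<^sup>2 * \<EE> (\<lambda>A. ((Y A)\<^sup>2 - 1)\<^sup>2) \<le> (\<sigma>\<^sup>2)\<^sup>2 * 60" unfolding bexp_cmult by simp
  then show ?thesis by (rule mult_left_le_imp_le) (use \<sigma>_bounds'(3) in simp)
qed

text \<open>In the expansion of \<open>K\<close> around \<open>S = s\<close>, \<open>s'\<close> is
  the derivative of \<open>x (x - 1) / 2\<close> at \<open>s\<close>, so \<open>s' \<sigma>\<close>
  is the coefficient of \<open>Y\<close>. Relative to it, \<open>\<epsilon>\<close> is the
  coefficient of the quadratic term and \<open>\<eta>\<close> the centred correction by six per
  arc.\<close>

definition "s' = s - 1 / 2"
definition "\<epsilon> = \<sigma> / (2 * s')"
definition \<eta> :: "'v set set \<Rightarrow> real" where "\<eta> A = 6 * (real (card A) - real (card P) * p) / (s' * \<sigma>)"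
definition U :: "'v set set \<Rightarrow> real" where "U A = Y A + \<epsilon> * ((Y A)\<^sup>2 - 1) - \<eta> A"

lemma s'_ge: "7 / 2 * \<sigma>E2 \<le> s'" "0 < s'"
proof -
  have "\<EE> (\<lambda>A. 4 * real (card A)) \<le> s" unfolding s_def by (intro mono S_bounds)
  then have "4 * (real (card P) * p) \<le> s" unfolding bexp_cmult expectation_card .
  moreover have "\<sigma>E2 \<le> real (card P) * p" using p by (simp add: \<sigma>E2_def mult_left_le)
  ultimately show "7 / 2 * \<sigma>E2 \<le> s'" using large by (simp add: s'_def)
  with large show "0 < s'" by simp
qed

lemma \<rho>_bounds: "0 < \<rho>" "\<rho> \<le> 1" "\<rho>\<^sup>2 * \<sigma>E2 = 1" "\<rho> * sqrt \<sigma>E2 = 1"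
  using large by (simp_all add: \<rho>_def power_divide)

lemma \<epsilon>_bounds: "0 < \<epsilon>" "\<epsilon> \<le> \<rho>"
proof -
  show "0 < \<epsilon>" using s'_ge \<sigma>_bounds'(3) by (simp add: \<epsilon>_def)
  have "\<sigma> / (2 * s') \<le> (6 * sqrt \<sigma>E2) / (2 * (7 / 2 * \<sigma>E2))"
    using s'_ge \<sigma>_bounds' large by (intro frac_le) auto
  also have "\<dots> = 6 / 7 * (sqrt \<sigma>E2 / \<sigma>E2)" by simp
  also have "sqrt \<sigma>E2 / \<sigma>E2 = \<rho>" using large unfolding \<rho>_def by (simp add: real_div_sqrt divide_simps)
  finally show "\<epsilon> \<le> \<rho>" using \<rho>_bounds(1) by (simp add: \<epsilon>_def)
qed

lemma \<eta>_moments: "\<EE> \<eta> = 0" "\<EE> (\<lambda>A. (\<eta> A)\<^sup>2) \<le> \<rho>\<^sup>2 * \<rho>\<^sup>2"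
proof -
  have eq: "\<eta> A = 6 / (s' * \<sigma>) * (real (card A) - real (card P) * p)" for A by (simp add: \<eta>_def)
  have "\<EE> \<eta> = \<EE> (\<lambda>A. 6 / (s' * \<sigma>) * (real (card A) - real (card P) * p))" by (intro bexp_cong eq)
  then show "\<EE> \<eta> = 0" unfolding bexp_cmult bexp_diff const expectation_card by simp
  have "\<EE> (\<lambda>A. (\<eta> A)\<^sup>2) = (6 / (s' * \<sigma>))\<^sup>2 * \<sigma>E2"
    unfolding eq power_mult_distrib bexp_cmult Var_card ..
  also have "\<dots> \<le> (6 / (7 / 2 * \<sigma>E2 * (4 * sqrt \<sigma>E2)))\<^sup>2 * \<sigma>E2"
    using s'_ge \<sigma>_bounds' large by (intro mult_right_mono power_mono divide_left_mono mult_mono mult_pos_pos) auto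
  also have "\<dots> = 9 / 49 * (1 / \<sigma>E2\<^sup>2)"
    using large by (simp add: power_mult_distrib power_divide)
  also have "1 / \<sigma>E2\<^sup>2 = \<rho>\<^sup>2 * \<rho>\<^sup>2" using large by (simp add: \<rho>_def power_divide power2_eq_square)
  also have "9 / 49 * (\<rho>\<^sup>2 * \<rho>\<^sup>2) \<le> \<rho>\<^sup>2 * \<rho>\<^sup>2" by simp
  finally show "\<EE> (\<lambda>A. (\<eta> A)\<^sup>2) \<le> \<rho>\<^sup>2 * \<rho>\<^sup>2" .
qed

lemma K_standardised: "K A - \<EE> K = s' * \<sigma> * U A"
proof -
  have K: "K A = (s\<^sup>2 - s) / 2 + s' * \<sigma> * Y A + \<sigma>\<^sup>2 / 2 * (Y A)\<^sup>2 - 6 * real (card A)" for A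
    unfolding K_def S_eq s'_def by (simp add: power2_eq_square field_simps)
  have "\<EE> K = (s\<^sup>2 - s) / 2 + \<sigma>\<^sup>2 / 2 - 6 * (real (card P) * p)"
    unfolding K[abs_def] bexp_add bexp_diff bexp_cmult const Y_moments' expectation_card by simp
  moreover have "s' * \<sigma> * \<epsilon> = \<sigma>\<^sup>2 / 2" "s' * \<sigma> * \<eta> A = 6 * (real (card A) - real (card P) * p)"
    using s'_ge(2) \<sigma>_bounds'(3) by (simp_all add: \<epsilon>_def \<eta>_def power2_eq_square)
  moreover have "s' * \<sigma> * U A = s' * \<sigma> * Y A + (s' * \<sigma> * \<epsilon>) * ((Y A)\<^sup>2 - 1) - s' * \<sigma> * \<eta> A"
    by (simp add: U_def algebra_simps)
  ultimately have "s' * \<sigma> * U A = s' * \<sigma> * Y A + \<sigma>\<^sup>2 / 2 * ((Y A)\<^sup>2 - 1) - 6 * (real (card A) - real (card P) * p)"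
    and "\<EE> K = (s\<^sup>2 - s) / 2 + \<sigma>\<^sup>2 / 2 - 6 * (real (card P) * p)" by (simp_all only:)
  then show ?thesis unfolding K[of A] by (simp add: right_diff_distrib)
qed

definition "r = sqrt (\<EE> (\<lambda>A. (U A)\<^sup>2))"

lemma sqrt_Var_K: "sqrt (Var K) = s' * \<sigma> * r"
proof -
  have "Var K = (s' * \<sigma>)\<^sup>2 * \<EE> (\<lambda>A. (U A)\<^sup>2)"
    unfolding Var_def K_standardised bexp_cmult[symmetric] by (intro bexp_cong) (simp add: power_mult_distrib)
  then show ?thesis using s'_ge(2) \<sigma>_bounds'(3) by (simp add: r_def real_sqrt_mult)
qed

text \<open>The difference of \<open>U\<close> and \<open>Y\<close> has second moment at most
  \<open>122 \<rho>\<^sup>2\<close>, where \<open>122 = 2 * 60 + 2\<close>. Cauchy-Schwarz bounds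
  the mixed term by \<open>24 \<rho>\<close>, and \<open>146 = 122 + 24\<close>.\<close>

lemma U_second_moment: "\<bar>\<EE> (\<lambda>A. (U A)\<^sup>2) - 1\<bar> \<le> 146 * \<rho>"
proof -
  let ?D = "\<lambda>A. \<epsilon> * ((Y A)\<^sup>2 - 1) - \<eta> A"
  have D: "\<EE> (\<lambda>A. (?D A)\<^sup>2) \<le> 122 * \<rho>\<^sup>2"
  proof -
    have "\<EE> (\<lambda>A. (?D A)\<^sup>2) \<le> \<EE> (\<lambda>A. (2 * \<epsilon>\<^sup>2) * ((Y A)\<^sup>2 - 1)\<^sup>2 + 2 * (\<eta> A)\<^sup>2)"
    proof (rule mono)
      fix A
      have "(x - y)\<^sup>2 \<le> 2 * x\<^sup>2 + 2 * y\<^sup>2" for x y :: real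
        using zero_le_power2[of "x + y"] by (simp add: power2_eq_square algebra_simps)
      from this[of "\<epsilon> * ((Y A)\<^sup>2 - 1)" "\<eta> A"]
      show "(?D A)\<^sup>2 \<le> (2 * \<epsilon>\<^sup>2) * ((Y A)\<^sup>2 - 1)\<^sup>2 + 2 * (\<eta> A)\<^sup>2" by (simp add: power_mult_distrib)
    qed
    also have "\<dots> = 2 * \<epsilon>\<^sup>2 * \<EE> (\<lambda>A. ((Y A)\<^sup>2 - 1)\<^sup>2) + 2 * \<EE> (\<lambda>A. (\<eta> A)\<^sup>2)"
      unfolding bexp_add bexp_cmult ..
    also have "\<dots> \<le> 2 * \<rho>\<^sup>2 * 60 + 2 * (\<rho>\<^sup>2 * 1)"
    proof (intro add_mono mult_mono Y_fourth_moment)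
      show "\<epsilon>\<^sup>2 \<le> \<rho>\<^sup>2" using \<epsilon>_bounds by (intro power_mono) auto
      have "\<rho>\<^sup>2 * \<rho>\<^sup>2 \<le> \<rho>\<^sup>2 * 1" using \<rho>_bounds by (intro mult_left_mono power_le_one) auto
      then show "\<EE> (\<lambda>A. (\<eta> A)\<^sup>2) \<le> \<rho>\<^sup>2 * 1" using \<eta>_moments(2) by linarith
    qed (auto intro!: nonneg)
    finally show ?thesis by simp
  qed
  have "\<EE> (\<lambda>A. (U A)\<^sup>2) = \<EE> (\<lambda>A. (Y A)\<^sup>2 + (?D A)\<^sup>2 + 2 * (Y A * ?D A))"
    by (intro bexp_cong) (simp add: U_def power2_eq_square algebra_simps)
  also have "\<dots> = 1 + \<EE> (\<lambda>A. (?D A)\<^sup>2) + 2 * \<EE> (\<lambda>A. Y A * ?D A)"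
    unfolding bexp_add bexp_cmult Y_moments' ..
  finally have eq: "\<EE> (\<lambda>A. (U A)\<^sup>2) - 1 = \<EE> (\<lambda>A. (?D A)\<^sup>2) + 2 * \<EE> (\<lambda>A. Y A * ?D A)" by simp
  have "(\<EE> (\<lambda>A. Y A * ?D A))\<^sup>2 \<le> 1 * \<EE> (\<lambda>A. (?D A)\<^sup>2)"
    using Cauchy_Schwarz[of Y ?D] Y_moments' by simp
  also have "\<dots> \<le> 122 * \<rho>\<^sup>2" using D by simp
  also have "\<dots> \<le> (12 * \<rho>)\<^sup>2" unfolding power_mult_distrib by (rule mult_right_mono) simp_all
  finally have "\<bar>\<EE> (\<lambda>A. Y A * ?D A)\<bar> \<le> \<bar>12 * \<rho>\<bar>" by (simp add: abs_le_square_iff)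
  then have "\<bar>\<EE> (\<lambda>A. Y A * ?D A)\<bar> \<le> 12 * \<rho>" using \<rho>_bounds by simp
  moreover have "\<rho>\<^sup>2 \<le> \<rho>" using \<rho>_bounds by (simp add: power2_eq_square mult_left_le)
  moreover have "0 \<le> \<EE> (\<lambda>A. (?D A)\<^sup>2)" by (intro nonneg) simp
  ultimately show ?thesis unfolding eq using D by linarith
qed

text \<open>The threshold is \<open>1 / (2 * 146)\<close>, which keeps \<open>r\<close> above 1/2.
  Passing from \<open>r\<^sup>2\<close> to \<open>r\<close> costs nothing because
  \<open>r + 1 \<ge> 1\<close>.\<close>

lemma r_bounds:
  assumes "\<rho> \<le> 1 / 292"
  shows "\<bar>r - 1\<bar> \<le> 146 * \<rho>" "1 / 2 \<le> r" "\<EE> (\<lambda>A. (U A)\<^sup>2) \<le> 2"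
proof -
  have r2: "r\<^sup>2 = \<EE> (\<lambda>A. (U A)\<^sup>2)" and r0: "0 \<le> r" unfolding r_def by (auto intro!: nonneg)
  have "\<bar>r - 1\<bar> \<le> \<bar>r - 1\<bar> * (r + 1)" using r0 by (simp add: algebra_simps)
  also have "\<dots> = \<bar>(r - 1) * (r + 1)\<bar>" using r0 by (simp add: abs_mult)
  also have "(r - 1) * (r + 1) = r\<^sup>2 - 1" by (simp add: power2_eq_square algebra_simps)
  also have "\<bar>r\<^sup>2 - 1\<bar> \<le> 146 * \<rho>" unfolding r2 by (rule U_second_moment)
  finally show "\<bar>r - 1\<bar> \<le> 146 * \<rho>" .
  with assms show "1 / 2 \<le> r" by linarith
  show "\<EE> (\<lambda>A. (U A)\<^sup>2) \<le> 2" using U_second_moment assms by linarith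
qed

lemma \<eta>_tail: "\<EE> (\<lambda>A. of_bool (\<rho> \<le> \<bar>\<eta> A\<bar>)) \<le> \<rho>\<^sup>2"
proof -
  have "\<EE> (\<lambda>A. of_bool (\<rho> \<le> \<bar>\<eta> A\<bar>)) \<le> \<EE> (\<lambda>A. (\<eta> A)\<^sup>2) / \<rho>\<^sup>2" by (rule Chebyshev[OF \<rho>_bounds(1)])
  also have "\<dots> \<le> (\<rho>\<^sup>2 * \<rho>\<^sup>2) / \<rho>\<^sup>2" by (intro divide_right_mono \<eta>_moments) simp
  also have "\<dots> = \<rho>\<^sup>2" by (rule nonzero_mult_div_cancel_right) (use \<rho>_bounds(1) in simp)
  finally show ?thesis .
qed

lemma \<rho>_sq_le: "\<rho>\<^sup>2 \<le> \<rho>"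
  using \<rho>_bounds by (simp add: power2_eq_square mult_left_le)

text \<open>Both distribution functions are close to 0 or 1 here: Chebyshev gives
  \<open>2 / t\<^sup>2 \<le> 2 \<rho>\<close> for \<open>U\<close>, and the normal tail is at most
  \<open>1 / t\<^sup>2 \<le> \<rho>\<close>.\<close>

lemma U_tail_bound:
  assumes \<rho>: "\<rho> \<le> 1 / 292" and t: "1 \<le> \<rho> * t\<^sup>2"
  shows "\<bar>\<EE> (\<lambda>A. of_bool (U A \<le> t)) - \<Phi> t\<bar> \<le> 3 * \<rho>"
proof -
  have "\<rho> * t\<^sup>2 \<le> 1 * t\<^sup>2" using \<rho>_bounds by (intro mult_right_mono) auto
  then have t2: "1\<^sup>2 \<le> t\<^sup>2" using t by simp
  then have t1: "1 \<le> \<bar>t\<bar>" unfolding abs_le_square_iff[of 1 t, symmetric] by simp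
  have inv: "1 / t\<^sup>2 \<le> \<rho>" using t t2 \<rho>_bounds(1) by (simp add: divide_le_eq)
  have "\<EE> (\<lambda>A. of_bool (\<bar>t\<bar> \<le> \<bar>U A\<bar>)) \<le> \<EE> (\<lambda>A. (U A)\<^sup>2) / \<bar>t\<bar>\<^sup>2"
    using t1 by (intro Chebyshev) simp
  also have "\<dots> \<le> 2 * (1 / t\<^sup>2)" using r_bounds(3)[OF \<rho>] by (simp add: divide_right_mono)
  also have "\<dots> \<le> 2 * \<rho>" using inv by simp
  finally have tail: "\<EE> (\<lambda>A. of_bool (\<bar>t\<bar> \<le> \<bar>U A\<bar>)) \<le> 2 * \<rho>" .
  have range: "0 \<le> \<EE> (\<lambda>A. of_bool (U A \<le> t))" "\<EE> (\<lambda>A. of_bool (U A \<le> t)) \<le> 1"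
    using mono[of "\<lambda>A. of_bool (U A \<le> t)" "\<lambda>_. 1"] by (auto intro!: nonneg)
  show ?thesis
  proof (cases "0 \<le> t")
    case True
    have "1 - \<EE> (\<lambda>A. of_bool (\<bar>t\<bar> \<le> \<bar>U A\<bar>)) = \<EE> (\<lambda>A. 1 - of_bool (\<bar>t\<bar> \<le> \<bar>U A\<bar>))" unfolding bexp_diff by simp
    also have "\<dots> \<le> \<EE> (\<lambda>A. of_bool (U A \<le> t))" by (intro mono) (use True in \<open>auto simp: of_bool_def\<close>)
    finally have "1 - 2 * \<rho> \<le> \<EE> (\<lambda>A. of_bool (U A \<le> t))" using tail by linarith
    moreover have "1 - \<Phi> t \<le> \<rho>" using \<Phi>_upper_tail[of t] t1 True inv by simp
    ultimately show ?thesis using range \<Phi>_le_1[of t] \<rho>_bounds(1) by (simp add: abs_le_iff)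
  next
    case False
    have "\<EE> (\<lambda>A. of_bool (U A \<le> t)) \<le> \<EE> (\<lambda>A. of_bool (\<bar>t\<bar> \<le> \<bar>U A\<bar>))"
      by (intro mono) (use False in \<open>auto simp: of_bool_def\<close>)
    then have "\<EE> (\<lambda>A. of_bool (U A \<le> t)) \<le> 2 * \<rho>" using tail by linarith
    moreover have "\<Phi> t \<le> \<rho>"
      using \<Phi>_upper_tail[of "- t"] t1 False inv by (simp add: \<Phi>_minus)
    ultimately show ?thesis using range \<Phi>_nonneg[of t] \<rho>_bounds(1) by (simp add: abs_le_iff)
  qed
qed

text \<open>From above, \<open>\<epsilon> (Y\<^sup>2 - 1) \<ge> - \<rho>\<close> shows that
  \<open>U \<le> t\<close> forces \<open>Y \<le> t + 2 \<rho>\<close> unless \<open>\<eta>\<close>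
  is large. From below, the shift \<open>b\<close> of \<open>\<Phi>_bounded_perturbation\<close>
  pays for the quadratic term; \<open>129 = 55 + 69 + 5\<close>.\<close>

lemma U_central_bound:
  assumes \<rho>: "\<rho> \<le> 1 / 292" and t: "\<rho> * t\<^sup>2 \<le> 1"
  shows "\<bar>\<EE> (\<lambda>A. of_bool (U A \<le> t)) - \<Phi> t\<bar> \<le> 129 * \<rho>"
proof -
  define b where "b = \<rho> * (2 * t\<^sup>2 + 19)"
  have "\<rho> \<le> 1 / 19" using \<rho> by simp
  note b = \<Phi>_bounded_perturbation[OF less_imp_le[OF \<rho>_bounds(1)] this t b_def]
  note BE = Berry_Esseen_S[OF P_nonempty]
  have "\<EE> (\<lambda>A. of_bool (U A \<le> t)) \<le> \<EE> (\<lambda>A. of_bool (Y A \<le> t + 2 * \<rho>) + of_bool (\<rho> \<le> \<bar>\<eta> A\<bar>))"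
  proof (rule mono)
    fix A
    have "0 \<le> \<epsilon> * (Y A)\<^sup>2" using \<epsilon>_bounds by simp
    then have "Y A \<le> U A + \<rho> + \<bar>\<eta> A\<bar>" using \<epsilon>_bounds(2) unfolding U_def right_diff_distrib by linarith
    then show "of_bool (U A \<le> t) \<le> (of_bool (Y A \<le> t + 2 * \<rho>) + of_bool (\<rho> \<le> \<bar>\<eta> A\<bar>) :: real)"
      by (auto simp: of_bool_def)
  qed
  also have "\<dots> \<le> (\<Phi> (t + 2 * \<rho>) + 69 * \<rho>) + \<rho>\<^sup>2"
    unfolding bexp_add using BE[of "t + 2 * \<rho>"] \<eta>_tail by linarith
  also have "\<Phi> (t + 2 * \<rho>) \<le> \<Phi> t + 2 * \<rho>"
    using \<Phi>_diff_le[of t "t + 2 * \<rho>" 1] \<rho>_bounds(1) \<phi>_le_1 by simp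
  finally have upper: "\<EE> (\<lambda>A. of_bool (U A \<le> t)) \<le> \<Phi> t + 72 * \<rho>" using \<rho>_sq_le by linarith

  \<comment> \<open>\<open>y + \<rho> y\<^sup>2\<close> increases only to the right of
    \<open>- 1 / (2 \<rho>)\<close>; the values of \<open>Y\<close> beyond this modulus are cut off
    by Chebyshev at cost \<open>4 \<rho>\<^sup>2\<close>.\<close>
  let ?c = "1 / (2 * \<rho>)"
  have "\<EE> (\<lambda>A. of_bool (Y A \<le> t - b)) \<le> \<EE> (\<lambda>A. of_bool (U A \<le> t) + (of_bool (\<rho> \<le> \<bar>\<eta> A\<bar>) + of_bool (?c \<le> \<bar>Y A\<bar>)))"
  proof (rule mono)
    fix A
    have "U A \<le> t" if y: "Y A \<le> t - b" and \<eta>: "\<bar>\<eta> A\<bar> < \<rho>" and Y: "\<bar>Y A\<bar> < ?c"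
    proof -
      have "- 1 \<le> \<rho> * (2 * Y A)" using Y \<rho>_bounds(1) by (simp add: field_simps abs_less_iff)
      moreover have "\<rho> * (2 * Y A) \<le> \<rho> * (Y A + (t - b))" using y \<rho>_bounds(1) by (intro mult_left_mono) auto
      ultimately have "0 \<le> 1 + \<rho> * (Y A + (t - b))" by linarith
      then have "0 \<le> ((t - b) - Y A) * (1 + \<rho> * (Y A + (t - b)))" using y by (intro mult_nonneg_nonneg) auto
      also have "\<dots> = ((t - b) + \<rho> * (t - b)\<^sup>2) - (Y A + \<rho> * (Y A)\<^sup>2)" by (simp add: power2_eq_square algebra_simps)
      finally have "Y A + \<rho> * (Y A)\<^sup>2 \<le> (t - b) + \<rho> * (t - b)\<^sup>2" by simp
      also have "\<dots> \<le> t - \<rho>" using b(2) by linarith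
      finally have "Y A + \<rho> * (Y A)\<^sup>2 \<le> t - \<rho>" .
      moreover have "\<epsilon> * (Y A)\<^sup>2 \<le> \<rho> * (Y A)\<^sup>2" using \<epsilon>_bounds by (intro mult_right_mono) auto
      ultimately show ?thesis using \<eta> \<epsilon>_bounds(1) unfolding U_def right_diff_distrib by linarith
    qed
    then show "of_bool (Y A \<le> t - b) \<le> (of_bool (U A \<le> t) + (of_bool (\<rho> \<le> \<bar>\<eta> A\<bar>) + of_bool (?c \<le> \<bar>Y A\<bar>)) :: real)"
      by (cases "Y A \<le> t - b"; cases "\<bar>\<eta> A\<bar> < \<rho>"; cases "\<bar>Y A\<bar> < ?c") (simp_all add: not_less)
  qed
  also have "\<dots> = \<EE> (\<lambda>A. of_bool (U A \<le> t)) + (\<EE> (\<lambda>A. of_bool (\<rho> \<le> \<bar>\<eta> A\<bar>)) + \<EE> (\<lambda>A. of_bool (?c \<le> \<bar>Y A\<bar>)))"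
    unfolding bexp_add ..
  finally have "\<EE> (\<lambda>A. of_bool (Y A \<le> t - b)) \<le> \<dots>" .
  moreover have "\<EE> (\<lambda>A. of_bool (?c \<le> \<bar>Y A\<bar>)) \<le> 4 * \<rho>\<^sup>2"
    using Chebyshev[of ?c Y] \<rho>_bounds(1) Y_moments'(2) by (simp add: power_divide)
  moreover have "4 * \<rho>\<^sup>2 + \<rho>\<^sup>2 \<le> 5 * \<rho>" using \<rho>_sq_le by simp
  ultimately have lower: "\<Phi> t - 129 * \<rho> \<le> \<EE> (\<lambda>A. of_bool (U A \<le> t))"
    using BE[of "t - b"] \<eta>_tail b(1) by linarith
  show ?thesis using upper lower \<rho>_bounds(1) by (simp add: abs_le_iff)
qed

end

text \<open>If \<open>\<rho>\<close> exceeds 1/292, the bound exceeds 1 and is trivial. Otherwise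
  standardising by \<open>r\<close> moves the threshold from \<open>z\<close> to \<open>z r\<close>,
  and \<open>129 + 146 \<le> 300\<close>.\<close>

lemma Berry_Esseen_K:
  assumes "P \<noteq> {}"
  shows "\<bar>\<EE> (\<lambda>A. of_bool ((K A - \<EE> K) / sqrt (Var K) \<le> z)) - \<Phi> z\<bar> \<le> 300 * \<rho>"
proof (cases "\<rho> \<le> 1 / 292")
  case False
  let ?E = "\<EE> (\<lambda>A. of_bool ((K A - \<EE> K) / sqrt (Var K) \<le> z))"
  have "0 \<le> ?E" "?E \<le> 1"
    using mono[of "\<lambda>A. of_bool ((K A - \<EE> K) / sqrt (Var K) \<le> z)" "\<lambda>_. 1"] by (auto intro!: nonneg)
  then have "\<bar>?E - \<Phi> z\<bar> \<le> 1" using \<Phi>_nonneg[of z] \<Phi>_le_1[of z] by linarith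
  then show ?thesis using False by linarith
next
  case \<rho>: True
  have large: "1 \<le> \<sigma>E2"
  proof -
    have pos: "0 < sqrt \<sigma>E2" using \<sigma>E2_pos[OF assms] by simp
    then have "292 \<le> sqrt \<sigma>E2" using \<rho> by (simp add: \<rho>_def field_simps)
    then have "1 \<le> sqrt \<sigma>E2" by linarith
    then show ?thesis by simp
  qed
  note r = r_bounds[OF large \<rho>]
  have c: "s' \<noteq> 0" "\<sigma> \<noteq> 0" using s'_ge(2)[OF large] \<sigma>_bounds(3)[OF assms] by simp_all
  have "(K A - \<EE> K) / sqrt (Var K) \<le> z \<longleftrightarrow> U A \<le> z * r" for A
  proof -
    have "(K A - \<EE> K) / sqrt (Var K) = U A / r"
      unfolding K_standardised[OF large] sqrt_Var_K[OF large] using c by simp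
    then show ?thesis using r(2) by (simp add: divide_le_eq)
  qed
  then have eq: "\<EE> (\<lambda>A. of_bool ((K A - \<EE> K) / sqrt (Var K) \<le> z)) = \<EE> (\<lambda>A. of_bool (U A \<le> z * r))" by simp
  have \<rho>0: "0 < \<rho>" using \<rho>_bounds[OF large] by simp
  have "\<bar>\<EE> (\<lambda>A. of_bool (U A \<le> z * r)) - \<Phi> (z * r)\<bar> \<le> 129 * \<rho>"
    using U_central_bound[OF large \<rho>, of "z * r"] U_tail_bound[OF large \<rho>, of "z * r"] \<rho>0 by linarith
  moreover have "\<bar>\<Phi> (z * r) - \<Phi> z\<bar> \<le> 146 * \<rho>" using \<Phi>_scale[OF r(2), of z] r(1) by linarith
  ultimately show ?thesis unfolding eq using \<rho>0 by linarith
qed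

end

section \<open>The random graph\<close>

lemma finite_possible_arcs: "finite (possible_arcs n)"
  by (rule finite_subset[of _ "Pow {1..n}"]) (auto simp: possible_arcs_def)

lemma arcs_subset:
  assumes "erdos_renyi_graph M n p G" "\<omega> \<in> space M"
  shows "arcs (G \<omega>) \<subseteq> possible_arcs n"
  using assms unfolding erdos_renyi_graph_def finite_simple_graph_def possible_arcs_def by blast

lemma erdos_renyi_arcs_measure:
  assumes "erdos_renyi_graph M n p G"
  shows "{\<omega> \<in> space M. arcs (G \<omega>) = A} \<in> sets M"
    and "A \<subseteq> possible_arcs n \<Longrightarrow> measure M {\<omega> \<in> space M. arcs (G \<omega>) = A} = p ^ card A * (1 - p) ^ card (possible_arcs n - A)"
proof -
  let ?P = "possible_arcs n" and ?ev = "\<lambda>f. {\<omega> \<in> space M. f \<in> arcs (G \<omega>)}"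
  interpret prob_space M using assms by (simp add: erdos_renyi_graph_def)
  have ind: "indep_events ?ev ?P" and pr: "\<And>f. f \<in> ?P \<Longrightarrow> prob (?ev f) = p"
    using assms by (simp_all add: erdos_renyi_graph_def)
  have ev: "?ev f \<in> events" if "f \<in> ?P" for f using ind that by (auto simp: indep_events_def)
  define B where "B A f = (if f \<in> A then ?ev f else space M - ?ev f)" for A f
  have B: "B A f \<in> events" if "f \<in> ?P" for A f using ev[OF that] by (auto simp: B_def)
  have eq: "{\<omega> \<in> space M. arcs (G \<omega>) = A} = {\<omega> \<in> space M. \<forall>f\<in>?P. \<omega> \<in> B A f}" if "A \<subseteq> ?P" for A
  proof (rule Collect_cong, rule conj_cong[OF refl])
    fix \<omega> assume \<omega>: "\<omega> \<in> space M"
    then have "\<omega> \<in> B A f \<longleftrightarrow> (f \<in> A \<longleftrightarrow> f \<in> arcs (G \<omega>))" for f by (simp add: B_def)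
    then show "arcs (G \<omega>) = A \<longleftrightarrow> (\<forall>f\<in>?P. \<omega> \<in> B A f)"
      using arcs_subset[OF assms \<omega>] that by blast
  qed
  have fin: "finite ?P" by (rule finite_possible_arcs)
  have meas: "{\<omega> \<in> space M. arcs (G \<omega>) = A} \<in> events" if "A \<subseteq> ?P" for A
    unfolding eq[OF that] using B fin by (intro sets.sets_Collect_finite_All) auto
  show "{\<omega> \<in> space M. arcs (G \<omega>) = A} \<in> events"
  proof (cases "A \<subseteq> ?P")
    case False
    then have empty: "{\<omega> \<in> space M. arcs (G \<omega>) = A} = {}" using arcs_subset[OF assms] by blast
    show ?thesis unfolding empty by simp
  qed (rule meas)
  assume A: "A \<subseteq> ?P"
  show "prob {\<omega> \<in> space M. arcs (G \<omega>) = A} = p ^ card A * (1 - p) ^ card (?P - A)"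
  \<comment> \<open>For n at most 1 there are no possible arcs, while the product formula requires a
    nonempty index set.\<close>
  proof (cases "?P = {}")
    case True
    then have "A = {}" "{\<omega> \<in> space M. arcs (G \<omega>) = A} = space M" using A eq[OF A] by auto
    then show ?thesis using True by (simp add: prob_space)
  next
    case False
    \<comment> \<open>Absent arcs contribute complements, so independence is first extended to the
      generated sigma-algebras.\<close>
    have "indep_sets (\<lambda>f. sigma_sets (space M) {?ev f}) ?P"
      using ind unfolding indep_events_def_alt by (intro indep_sets_sigma) (auto simp: Int_stable_def)
    moreover have "\<forall>f\<in>?P. B A f \<in> sigma_sets (space M) {?ev f}"
      by (auto simp: B_def intro: sigma_sets.intros)
    ultimately have "prob (\<Inter>f\<in>?P. B A f) = (\<Prod>f\<in>?P. prob (B A f))"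
      using False fin by (intro indep_setsD) auto
    also have "\<dots> = (\<Prod>f\<in>?P. if f \<in> A then p else 1 - p)"
      using pr ev by (intro prod.cong) (auto simp: B_def prob_compl)
    also have "\<dots> = p ^ card A * (1 - p) ^ card (?P - A)"
      using fin A by (simp add: prod.If_cases Int_absorb1 Diff_eq)
    also have "(\<Inter>f\<in>?P. B A f) = {\<omega> \<in> space M. arcs (G \<omega>) = A}"
      unfolding eq[OF A] using False B sets.sets_into_space by blast
    finally show ?thesis .
  qed
qed

lemma card_possible_arcs: "real (card (possible_arcs n)) = real n * (real n - 1) / 2"
  using n_subsets[of "{1..n}" 2] by (simp add: possible_arcs_def real_choose_two)

text \<open>Only finitely many arc sets occur, so on the probability space \<open>X\<close> is a
  finite combination of indicators of measurable events.\<close>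

lemma erdos_renyi_expectation:
  fixes F :: "nat set set \<Rightarrow> real"
  assumes G: "erdos_renyi_graph M n p G" and X: "\<And>\<omega>. \<omega> \<in> space M \<Longrightarrow> X \<omega> = F (arcs (G \<omega>))"
  shows "prob_space.expectation M X = bexp p (possible_arcs n) F"
proof -
  interpret prob_space M using G by (simp add: erdos_renyi_graph_def)
  let ?P = "possible_arcs n" and ?ev = "\<lambda>A. {\<omega> \<in> space M. arcs (G \<omega>) = A}"
  have fin: "finite (Pow ?P)" using finite_possible_arcs by simp
  have "expectation X = (LINT \<omega>|M. (\<Sum>A\<in>Pow ?P. F A * indicator (?ev A) \<omega>))"
  proof (rule Bochner_Integration.integral_cong[OF refl])
    fix \<omega> assume \<omega>: "\<omega> \<in> space M"
    have "(\<Sum>A\<in>Pow ?P. F A * indicator (?ev A) \<omega>) = (\<Sum>A\<in>Pow ?P. if A = arcs (G \<omega>) then F A else 0)"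
      using \<omega> by (intro sum.cong) (auto simp: indicator_def)
    also have "\<dots> = X \<omega>" using arcs_subset[OF G \<omega>] fin X[OF \<omega>] by simp
    finally show "X \<omega> = (\<Sum>A\<in>Pow ?P. F A * indicator (?ev A) \<omega>)" by simp
  qed
  also have "\<dots> = (\<Sum>A\<in>Pow ?P. LINT \<omega>|M. F A * indicator (?ev A) \<omega>)"
    by (intro Bochner_Integration.integral_sum integrable_mult_right integrable_real_indicator)
      (auto simp: erdos_renyi_arcs_measure[OF G] less_top[symmetric])
  also have "\<dots> = (\<Sum>A\<in>Pow ?P. F A * measure M (?ev A))"
    using erdos_renyi_arcs_measure(1)[OF G] by simp
  also have "\<dots> = bexp p ?P F"
    unfolding bexp_def using erdos_renyi_arcs_measure(2)[OF G] by (intro sum.cong) (auto simp: mult_ac)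
  finally show ?thesis .
qed

lemma erdos_renyi_probability:
  assumes G: "erdos_renyi_graph M n p G" and X: "\<And>\<omega>. \<omega> \<in> space M \<Longrightarrow> X \<omega> = F (arcs (G \<omega>))"
  shows "measure M {\<omega> \<in> space M. X \<omega> \<le> z} = bexp p (possible_arcs n) (\<lambda>A. of_bool (F A \<le> z))"
proof -
  interpret prob_space M using G by (simp add: erdos_renyi_graph_def)
  let ?B = "{\<omega> \<in> space M. X \<omega> \<le> z}"
  have "?B = (\<Union>A\<in>{A\<in>Pow (possible_arcs n). F A \<le> z}. {\<omega> \<in> space M. arcs (G \<omega>) = A})"
    using arcs_subset[OF G] X by auto
  also have "\<dots> \<in> sets M"
    using finite_possible_arcs by (intro sets.finite_UN erdos_renyi_arcs_measure(1)[OF G]) auto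
  finally have B: "?B \<in> sets M" .
  have "measure M ?B = expectation (indicator ?B)" using B by simp
  also have "\<dots> = bexp p (possible_arcs n) (\<lambda>A. of_bool (F A \<le> z))"
    by (rule erdos_renyi_expectation[OF G]) (simp add: X indicator_def)
  finally show ?thesis .
qed

lemma distributed_std_normal_cdf:
  assumes "prob_space L" "distributed L lborel N std_normal_density"
  shows "measure L {\<omega> \<in> space L. N \<omega> \<le> z} = \<Phi> z"
proof -
  have N: "N \<in> measurable L lborel" and d: "distr L lborel N = density lborel std_normal_density"
    using assms(2) by (simp_all add: distributed_def)
  have "measure (distr L lborel N) {..z} = measure L (N -` {..z} \<inter> space L)"
    using N by (intro measure_distr) auto
  also have "N -` {..z} \<inter> space L = {\<omega> \<in> space L. N \<omega> \<le> z}" by auto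
  finally show ?thesis unfolding d \<Phi>_def by simp
qed

section \<open>Asymptotic relations as eventual inequalities\<close>

lemma asymp_ratio_eq: "0 < b n \<Longrightarrow> asymp_ratio a b n = ereal (\<bar>a n\<bar> / b n)"
  by (simp add: asymp_ratio_def)

lemma lesssimI:
  assumes "\<forall>\<^sub>F n in sequentially. 0 < b n \<and> \<bar>a n\<bar> \<le> C * b n"
  shows "lesssim a b"
proof -
  have "\<forall>\<^sub>F n in sequentially. asymp_ratio a b n \<le> ereal C"
    using assms by eventually_elim (simp add: asymp_ratio_eq divide_le_eq)
  then have "limsup (asymp_ratio a b) \<le> ereal C" by (rule Limsup_bounded)
  then show ?thesis unfolding lesssim_def using le_less_trans by fastforce
qed

lemma same_orderI:
  assumes "\<forall>\<^sub>F n in sequentially. 0 < b n \<and> c * b n \<le> a n \<and> a n \<le> C * b n" "0 < c"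
  shows "same_order a b"
proof -
  have "\<forall>\<^sub>F n in sequentially. ereal c \<le> asymp_ratio a b n"
    using assms(1)
  proof eventually_elim
    case (elim n)
    then have "c * b n \<le> \<bar>a n\<bar>" by linarith
    then show ?case using elim by (simp add: asymp_ratio_eq le_divide_eq)
  qed
  then have 1: "ereal c \<le> liminf (asymp_ratio a b)" by (rule Liminf_bounded)
  have "\<forall>\<^sub>F n in sequentially. 0 < b n \<and> \<bar>a n\<bar> \<le> C * b n"
    using assms(1)
  proof eventually_elim
    case (elim n)
    then have "0 < c * b n" using assms(2) by simp
    with elim show ?case by simp
  qed
  then have "limsup (asymp_ratio a b) < \<infinity>" using lesssimI unfolding lesssim_def by blast
  moreover have "0 < liminf (asymp_ratio a b)" using 1 assms(2) by (meson ereal_less(2) less_le_trans)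
  moreover have "liminf (asymp_ratio a b) \<le> limsup (asymp_ratio a b)" by (intro Liminf_le_Limsup) simp
  ultimately show ?thesis unfolding same_order_def by blast
qed

lemma much_greaterD:
  assumes "much_greater a b" "\<And>n. 0 < n \<Longrightarrow> 0 < b n" "\<And>n. 0 < a n"
  shows "\<forall>\<^sub>F n in sequentially. C * b n \<le> a n"
proof -
  have "\<forall>\<^sub>F n in sequentially. ereal C < asymp_ratio a b n"
    using assms(1) unfolding much_greater_def tendsto_PInfty by blast
  then show ?thesis using eventually_gt_at_top[of 0]
  proof eventually_elim
    case (elim n)
    then show ?case using assms(2)[of n] assms(3)[of n] by (simp add: asymp_ratio_eq less_divide_eq)
  qed
qed

section \<open>Asymptotics\<close>

lemma possible_arcs_bounds:
  assumes "3 \<le> n"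
  defines "m \<equiv> real (card (possible_arcs n))"
  shows "(real n)\<^sup>2 / 4 \<le> m" "m \<le> (real n)\<^sup>2 / 2" "m / 2 \<le> m - 1"
proof -
  have m: "m = real n * (real n - 1) / 2" unfolding m_def by (rule card_possible_arcs)
  have n: "3 \<le> real n" using assms by simp
  have "real n * 3 \<le> real n * real n" using n by (intro mult_left_mono) auto
  then show "(real n)\<^sup>2 / 4 \<le> m" "m \<le> (real n)\<^sup>2 / 2" unfolding m power2_eq_square by (simp_all add: field_simps)
  have "3 * 2 \<le> real n * (real n - 1)" using n by (intro mult_mono) auto
  then show "m / 2 \<le> m - 1" unfolding m by simp
qed

lemma kolmogorov_distance_le:
  assumes "\<And>z. \<bar>measure M {\<omega>\<in>space M. Y \<omega> \<le> z} - measure M' {\<omega>\<in>space M'. Z \<omega> \<le> z}\<bar> \<le> c"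
  shows "\<bar>kolmogorov_distance M Y M' Z\<bar> \<le> c"
proof -
  let ?f = "\<lambda>z. \<bar>measure M {\<omega>\<in>space M. Y \<omega> \<le> z} - measure M' {\<omega>\<in>space M'. Z \<omega> \<le> z}\<bar>"
  have "bdd_above (range ?f)" using assms by (intro bdd_aboveI[of _ c]) auto
  then have "?f 0 \<le> (SUP z. ?f z)" by (rule cSUP_upper[OF UNIV_I])
  moreover have "0 \<le> ?f 0" by simp
  moreover have "(SUP z. ?f z) \<le> c" using assms by (intro cSUP_least) auto
  ultimately have "0 \<le> kolmogorov_distance M Y M' Z" "kolmogorov_distance M Y M' Z \<le> c"
    unfolding kolmogorov_distance_def by linarith+
  then show ?thesis by simp
qed

theorem theorem4p1:
  fixes p :: "nat \<Rightarrow> real"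
    and M :: "nat \<Rightarrow> 'w measure"
    and G :: "nat \<Rightarrow> 'w \<Rightarrow> nat graph"
    and \<Delta> :: "nat \<Rightarrow> 'w \<Rightarrow> ((nat + nat set) \<Rightarrow>\<^sub>0 real) set set"
    and K :: "nat \<Rightarrow> 'w \<Rightarrow> real"
    and L :: "'b measure" and N :: "'b \<Rightarrow> real"
  assumes p: "\<And>n. 0 < p n \<and> p n < 1"
    and p_large: "much_greater p (\<lambda>n. 1 / real n ^ 2)"
    and G: "\<And>n. erdos_renyi_graph (M n) n (p n) (G n)"
    and \<Delta>: "\<And>n \<omega>. \<omega> \<in> space (M n) \<Longrightarrow>
               unimodular_triangulation (\<Delta> n \<omega>) (cosmological_polytope (G n \<omega>))"
    and K: "\<And>n \<omega>. \<omega> \<in> space (M n) \<Longrightarrow> K n \<omega> = real (face_number 1 (\<Delta> n \<omega>))"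
    and L: "prob_space L"
    and N: "distributed L lborel N std_normal_density"
  shows "same_order (\<lambda>n. prob_space.expectation (M n) (K n)) (\<lambda>n. real n ^ 4 * p n ^ 2) \<and>
         gtrsim (\<lambda>n. prob_space.variance (M n) (K n)) (\<lambda>n. real n ^ 6 * p n ^ 3 * (1 - p n)) \<and>
         lesssim
           (\<lambda>n. kolmogorov_distance
                  (M n) (\<lambda>\<omega>. (K n \<omega> - prob_space.expectation (M n) (K n))
                             / sqrt (prob_space.variance (M n) (K n)))
                  L N)
           (\<lambda>n. 1 / (real n * sqrt (p n * (1 - p n))))"
proof -
  note p_rng = p
  let ?P = possible_arcs
  let ?m = "\<lambda>n. real (card (?P n))" and ?q = "\<lambda>n. 1 - p n"
  have R: "random_arcs (p n) (?P n)" for n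
    using p_rng[of n] finite_possible_arcs by unfold_locales (auto simp: possible_arcs_def)
  let ?K = "random_arcs.K :: nat set set \<Rightarrow> real"
  let ?E = "\<lambda>n. bexp (p n) (?P n) ?K"
  let ?V = "\<lambda>n. random_subset.Var (p n) (?P n) ?K"
  \<comment> \<open>The edge count is the same for every choice of unimodular triangulation, so it
    is a function of the arc set and its law is computed by \<open>bexp\<close>.\<close>
  have K_eq: "K n \<omega> = ?K (arcs (G n \<omega>))" if "\<omega> \<in> space (M n)" for n \<omega>
  proof -
    have "finite_simple_graph (G n \<omega>)" using G[of n] that by (simp add: erdos_renyi_graph_def)
    from face_number_1_cosmological_polytope[OF this \<Delta>[OF that]] show ?thesis
      unfolding K[OF that] random_arcs.K_def[OF R] random_arcs.S_def[OF R] by simp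
  qed
  have E_eq: "prob_space.expectation (M n) (K n) = ?E n" for n
    by (rule erdos_renyi_expectation[OF G]) (rule K_eq)
  have V_eq: "prob_space.variance (M n) (K n) = ?V n" for n
  proof -
    interpret random_arcs "p n" "?P n" by (rule R)
    show ?thesis unfolding E_eq Var_def by (rule erdos_renyi_expectation[OF G]) (simp add: K_eq)
  qed
  have n3: "\<forall>\<^sub>F n in sequentially. 3 \<le> n" by (rule eventually_ge_at_top)
  \<comment> \<open>That is \<open>n\<^sup>2 p \<ge> 1\<close>, which absorbs the linear term in the
    upper bound for the mean into the quadratic one.\<close>
  have large: "\<forall>\<^sub>F n in sequentially. 1 * (1 / real n ^ 2) \<le> p n"
    by (rule much_greaterD[OF p_large]) (use p in auto)

  have "same_order ?E (\<lambda>n. real n ^ 4 * p n ^ 2)"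
  proof (rule same_orderI)
    \<comment> \<open>For \<open>x = n\<^sup>2 p\<close>, \<open>m p\<close> lies between
      \<open>x / 4\<close> and \<open>x / 2\<close>. The constants come from
      \<open>4 (x / 4)\<^sup>2 = x\<^sup>2 / 4\<close> and
      \<open>18 (x / 2 + x\<^sup>2 / 4) \<le> 27/2 x\<^sup>2\<close>.\<close>
    show "\<forall>\<^sub>F n in sequentially. 0 < real n ^ 4 * p n ^ 2 \<and> 1 / 4 * (real n ^ 4 * p n ^ 2) \<le> ?E n \<and> ?E n \<le> 27 / 2 * (real n ^ 4 * p n ^ 2)"
      using n3 large
    proof eventually_elim
      case (elim n)
      interpret random_arcs "p n" "?P n" by (rule R)
      note m = possible_arcs_bounds[OF elim(1)]
      have n0: "0 < real n" using elim by simp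
      have x1: "1 \<le> (real n)\<^sup>2 * p n" using elim(2) n0 by (simp add: field_simps)
      let ?x = "(real n)\<^sup>2 * p n"
      have b: "real n ^ 4 * p n ^ 2 = ?x\<^sup>2" by (simp add: power_mult_distrib flip: power_mult)
      have mp: "?x / 4 \<le> ?m n * p n" "?m n * p n \<le> ?x / 2"
        using mult_right_mono[OF m(1), of "p n"] mult_right_mono[OF m(2), of "p n"] p_rng[of n] by simp_all
      have "(?x / 4)\<^sup>2 \<le> (?m n * p n)\<^sup>2" using mp x1 by (intro power_mono) auto
      then have "4 * (?x / 4)\<^sup>2 \<le> 4 * (?m n * p n)\<^sup>2" by simp
      also have "\<dots> = 8 * (?m n * (?m n / 2)) * (p n)\<^sup>2" by (simp add: power_mult_distrib power2_eq_square)
      also have "\<dots> \<le> 8 * (?m n * (?m n - 1)) * (p n)\<^sup>2"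
        using m(3) by (intro mult_right_mono mult_left_mono) auto
      also have "\<dots> \<le> ?E n" using expectation_K_bounds(1) by (simp add: mult.assoc)
      finally have lower: "1 / 4 * ?x\<^sup>2 \<le> ?E n" by (simp add: power_divide)
      have "?E n \<le> 18 * (?m n * p n + (?m n * p n)\<^sup>2)" by (rule expectation_K_bounds(2))
      also have "\<dots> \<le> 18 * (?x / 2 + (?x / 2)\<^sup>2)"
        using mp x1 by (intro mult_left_mono add_mono power_mono) auto
      also have "\<dots> \<le> 27 / 2 * ?x\<^sup>2"
      proof -
        have "18 * (x / 2 + (x / 2)\<^sup>2) \<le> 27 / 2 * x\<^sup>2" if "1 \<le> x" for x :: real
          using mult_left_mono[of 1 x x] that by (simp add: power2_eq_square)
        then show ?thesis using x1 by blast
      qed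
      finally have upper: "?E n \<le> 27 / 2 * ?x\<^sup>2" .
      have "0 < ?x" using x1 by linarith
      then have "0 < ?x\<^sup>2" by (rule zero_less_power)
      with lower upper show ?case unfolding b by blast
    qed
  qed simp
  moreover have "gtrsim ?V (\<lambda>n. real n ^ 6 * p n ^ 3 * (1 - p n))"
    unfolding gtrsim_def
  proof (rule lesssimI)
    \<comment> \<open>The constant is 1 because \<open>m \<ge> n\<^sup>2 / 4\<close> and
      \<open>m - 1 \<ge> m / 2\<close> give \<open>256 m (m - 1)\<^sup>2 \<ge> n^6\<close>.\<close>
    show "\<forall>\<^sub>F n in sequentially. 0 < ?V n \<and> \<bar>real n ^ 6 * p n ^ 3 * (1 - p n)\<bar> \<le> 1 * ?V n"
      using n3
    proof eventually_elim
      case (elim n)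
      interpret random_arcs "p n" "?P n" by (rule R)
      note m = possible_arcs_bounds[OF elim]
      have n0: "0 < real n" using elim by simp
      have "?m n ^ 3 = 4 * (?m n * (?m n / 2)\<^sup>2)" by (simp add: power2_eq_square power3_eq_cube)
      also have "\<dots> \<le> 4 * (?m n * (?m n - 1)\<^sup>2)"
        using m(3) by (intro mult_left_mono power_mono) auto
      finally have cube: "?m n ^ 3 \<le> 4 * (?m n * (?m n - 1)\<^sup>2)" .
      have "((real n)\<^sup>2 / 4) ^ 3 \<le> ?m n ^ 3" using m by (intro power_mono) auto
      also note cube
      finally have "(real n) ^ 6 \<le> 256 * (?m n * (?m n - 1)\<^sup>2)" by (simp add: power_divide flip: power_mult)
      then have "(real n) ^ 6 * (p n ^ 3 * (1 - p n)) \<le> 256 * (?m n * (?m n - 1)\<^sup>2) * (p n ^ 3 * (1 - p n))"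
        using p_rng[of n] by (intro mult_right_mono) auto
      also have "\<dots> \<le> ?V n" using Var_K_ge by (simp add: mult_ac)
      finally have le: "real n ^ 6 * p n ^ 3 * (1 - p n) \<le> ?V n" by (simp add: mult_ac)
      moreover have "0 < real n ^ 6 * p n ^ 3 * (1 - p n)" using p_rng[of n] n0 by simp
      ultimately show ?case by simp
    qed
  qed
  moreover have "lesssim (\<lambda>n. kolmogorov_distance (M n) (\<lambda>\<omega>. (K n \<omega> - ?E n) / sqrt (?V n)) L N)
      (\<lambda>n. 1 / (real n * sqrt (p n * (1 - p n))))"
  proof (rule lesssimI)
    \<comment> \<open>\<open>600 = 2 * 300\<close>: since \<open>m \<ge> n\<^sup>2 / 4\<close>, the
      standard deviation of the number of arcs is at least half of
      \<open>n sqrt (p (1 - p))\<close>.\<close>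
    show "\<forall>\<^sub>F n in sequentially. 0 < 1 / (real n * sqrt (p n * (1 - p n))) \<and>
      \<bar>kolmogorov_distance (M n) (\<lambda>\<omega>. (K n \<omega> - ?E n) / sqrt (?V n)) L N\<bar> \<le> 600 * (1 / (real n * sqrt (p n * (1 - p n))))"
      using n3
    proof eventually_elim
      case (elim n)
      interpret random_arcs "p n" "?P n" by (rule R)
      note m = possible_arcs_bounds[OF elim]
      have n0: "0 < real n" using elim by simp
      have pq: "0 < p n * (1 - p n)" using p_rng[of n] by simp
      then have b: "0 < real n * sqrt (p n * (1 - p n))" using n0 by simp
      have "0 < (real n)\<^sup>2 / 4" using n0 by simp
      then have "0 < ?m n" using m(1) by linarith
      then have ne: "?P n \<noteq> {}" by auto
      have "\<bar>kolmogorov_distance (M n) (\<lambda>\<omega>. (K n \<omega> - ?E n) / sqrt (?V n)) L N\<bar> \<le> 300 * \<rho>"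
      proof (rule kolmogorov_distance_le)
        fix z
        have "measure (M n) {\<omega> \<in> space (M n). (K n \<omega> - ?E n) / sqrt (?V n) \<le> z}
          = bexp (p n) (?P n) (\<lambda>A. of_bool ((?K A - ?E n) / sqrt (?V n) \<le> z))"
          by (rule erdos_renyi_probability[OF G]) (simp add: K_eq)
        then show "\<bar>measure (M n) {\<omega> \<in> space (M n). (K n \<omega> - ?E n) / sqrt (?V n) \<le> z} - measure L {\<omega> \<in> space L. N \<omega> \<le> z}\<bar> \<le> 300 * \<rho>"
          unfolding distributed_std_normal_cdf[OF L N] using Berry_Esseen_K[OF ne] by simp
      qed
      moreover have "\<rho> \<le> 2 * (1 / (real n * sqrt (p n * (1 - p n))))"
      proof -
        have "(real n / 2)\<^sup>2 * (p n * (1 - p n)) \<le> \<sigma>E2"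
          unfolding \<sigma>E2_def using mult_right_mono[OF m(1), of "p n * (1 - p n)"] pq by (simp add: power_divide mult.assoc)
        then have "sqrt ((real n / 2)\<^sup>2 * (p n * (1 - p n))) \<le> sqrt \<sigma>E2" by (rule real_sqrt_le_mono)
        then have "real n * sqrt (p n * (1 - p n)) / 2 \<le> sqrt \<sigma>E2" using n0 by (simp add: real_sqrt_mult)
        then have "1 / sqrt \<sigma>E2 \<le> 1 / (real n * sqrt (p n * (1 - p n)) / 2)" using b \<sigma>E2_pos[OF ne] by (intro divide_left_mono mult_pos_pos) auto
        then show ?thesis by (simp add: \<rho>_def)
      qed
      ultimately have "\<bar>kolmogorov_distance (M n) (\<lambda>\<omega>. (K n \<omega> - ?E n) / sqrt (?V n)) L N\<bar>
        \<le> 600 * (1 / (real n * sqrt (p n * (1 - p n))))" by linarith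
      moreover have "0 < 1 / (real n * sqrt (p n * (1 - p n)))" using b by simp
      ultimately show ?case by blast
    qed
  qed
  ultimately show ?thesis unfolding E_eq V_eq[unfolded E_eq] by blast
qed

end
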